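(* Let $a>1$ be fixed, and for even $n$ let $W_n=\frac{1}{\sqrt n}X_n+A_n$ be the random Hermitian matrix with external source, where $X_n=(\zeta_{ij})_{1\le i,j\le n}$ is a Wigner Hermitian matrix whose atom distributions $\nu,\tilde\nu$ both satisfy the Poincaré inequality and the logarithmic Sobolev inequality, and where $A_n$ is a deterministic diagonal matrix with diagonal values $a$ and $-a$, each of multiplicity $n/2$. Suppose that $|\zeta_{ij}|\le K$ almost surely for all $i,j$. Then for any $\epsilon,\delta>0$ and any interval $I\subset\mathbb{R}$ of width $|I|\ge \frac{K^2(\log n)^{20}}{n}$, the number $N_I$ of eigenvalues of $W_n$ in $I$ satisfies $$\left|N_I-n\int_I\rho(x)\,dx\right|\le \delta n|I|$$ with overwhelming probability, where $\rho$ is the density of the limiting eigenvalue distribution $\mu$ of $W_n$.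
   Context: Wigner Hermitian matrix: a random Hermitian $n\times n$ matrix $X_n=(\zeta_{ij})$ such that (1) for $1\le i<j\le n$, $\zeta_{ij}=\xi_{ij}+\sqrt{-1}\,\tau_{ij}$, where the $\xi_{ij},\tau_{ij}$ are i.i.d. copies of a real random variable $\xi$ with law $\nu$, mean $0$ and variance $1/2$; (2) the diagonal entries $\zeta_{ii}=\xi_{ii}$ are real i.i.d. copies of a real random variable $\tilde\xi$ with law $\tilde\nu$, mean $0$ and variance $1$ (all diagonal and strictly upper triangular entries being independent); (3) $\xi$ and $\tilde\xi$ have exponential decay: there are constants $C,C'$ with $\mathbb{P}(|\xi|\ge t^{C})\le e^{-t}$ for all $t\ge C'$, and similarly for $\tilde\xi$. Poincaré inequality for $\nu$: there is a constant $C$ such that for any function $u$, $\int|u-\int u\,d\nu|^2\,d\nu\le C\int|\nabla u|^2\,d\nu$. Logarithmic Sobolev inequality for $\nu$: there is a constant $C$ such that for any density function $u$ with $\int u\,d\nu=1$, $\int u\log u\,d\nu\le C\int|\nabla\sqrt u|^2\,d\nu$. The same inequalities are required of $\tilde\nu$. Limiting measure: for $a>1$, the empirical spectral distribution $\frac1n\sum_{i=1}^n\delta_{\lambda_i}$ of $W_n$ (with $\lambda_1\le\dots\le\lambda_n$ the eigenvalues of $W_n$) converges in distribution to a measure $\mu$ with density $\rho(x)=\frac1\pi|\mathrm{Im}\,w(x)|$, where $w=w(x)$ solves the cubic Pastur equation $w^3-xw^2-(a^2-1)w+xa^2=0$ (the non-real solution when there is one; otherwise $\rho(x)=0$). Its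 support is $(-z_1,-z_2)\cup(z_2,z_1)$ (up to endpoints), with $z_1,z_2$ real numbers depending only on $a$. Equivalently, $\mu$ is the free additive convolution $\mu_{sc}\boxplus\frac12(\delta_a+\delta_{-a})$ of the standard semicircle law with $\frac12(\delta_a+\delta_{-a})$. Asymptotics: $n\to\infty$ along even integers; $K$ and $I$ may depend on $n$. An event $E$ (depending on $n$) holds with overwhelming probability if $\mathbb{P}(E)\ge 1-\exp(-\omega(\log n))$, where $\omega(\log n)$ denotes a quantity whose ratio to $\log n$ tends to infinity. *)

theory Defs
  imports
    "HOL-Probability.Probability"
    "HOL-Computational_Algebra.Fundamental_Theorem_Algebra"
    "Jordan_Normal_Form.Char_Poly"
    "Jordan_Normal_Form.Schur_Decomposition"
begin

definition exponential_decay :: "real measure \<Rightarrow> bool" where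
  "exponential_decay \<nu> \<longleftrightarrow>
     (\<exists>C>0. \<exists>C'>0. \<forall>t\<ge>C'. measure \<nu> {x. \<bar>x\<bar> \<ge> t powr C} \<le> exp (- t))"

definition atom_law :: "real measure \<Rightarrow> real \<Rightarrow> bool" where
  "atom_law \<nu> v \<longleftrightarrow>
     real_distribution \<nu> \<and>
     integrable \<nu> (\<lambda>x. x) \<and> prob_space.expectation \<nu> (\<lambda>x. x) = 0 \<and>
     integrable \<nu> (\<lambda>x. x\<^sup>2) \<and> prob_space.variance \<nu> (\<lambda>x. x) = v \<and>
     exponential_decay \<nu>"

text \<open>
  The test functions are the continuously differentiable ones for which the integrals in the
  inequality converge. In the logarithmic Sobolev inequality the differentiability is that of
  \<open>sqrt u\<close>, so that \<open>u\<close> may vanish; there \<open>u ln u\<close> is \<open>0\<close>, since \<open>ln 0 = 0\<close>.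
\<close>

definition poincare_inequality :: "real measure \<Rightarrow> bool" where
  "poincare_inequality \<nu> \<longleftrightarrow>
     (\<exists>C. \<forall>u::real \<Rightarrow> real.
        u C1_differentiable_on UNIV \<longrightarrow>
        integrable \<nu> (\<lambda>x. (u x)\<^sup>2) \<longrightarrow> integrable \<nu> (\<lambda>x. (deriv u x)\<^sup>2) \<longrightarrow>
        (\<integral>x. \<bar>u x - (\<integral>y. u y \<partial>\<nu>)\<bar>\<^sup>2 \<partial>\<nu>) \<le> C * (\<integral>x. \<bar>deriv u x\<bar>\<^sup>2 \<partial>\<nu>))"

definition log_sobolev_inequality :: "real measure \<Rightarrow> bool" where
  "log_sobolev_inequality \<nu> \<longleftrightarrow>
     (\<exists>C. \<forall>u::real \<Rightarrow> real.
        (\<forall>x. u x \<ge> 0) \<longrightarrow> integrable \<nu> u \<longrightarrow> (\<integral>x. u x \<partial>\<nu>) = 1 \<longrightarrow>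
        (\<lambda>x. sqrt (u x)) C1_differentiable_on UNIV \<longrightarrow>
        integrable \<nu> (\<lambda>x. u x * ln (u x)) \<longrightarrow>
        integrable \<nu> (\<lambda>x. (deriv (\<lambda>y. sqrt (u y)) x)\<^sup>2) \<longrightarrow>
        (\<integral>x. u x * ln (u x) \<partial>\<nu>) \<le> C * (\<integral>x. \<bar>deriv (\<lambda>y. sqrt (u y)) x\<bar>\<^sup>2 \<partial>\<nu>))"

text \<open>
  The independent real coordinates of a random Hermitian matrix \<open>X\<close>: position \<open>(i, j)\<close> carries
  the real part of the entry \<open>(i, j)\<close> if \<open>i \<le> j\<close>, and the imaginary part of the entry
  \<open>(j, i)\<close> of the upper triangle if \<open>i > j\<close>.
\<close>

definition wigner_coord :: "('a \<Rightarrow> complex mat) \<Rightarrow> nat \<times> nat \<Rightarrow> 'a \<Rightarrow> real" where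
  "wigner_coord X p \<omega> =
     (case p of (i, j) \<Rightarrow> if i \<le> j then Re (X \<omega> $$ (i, j)) else Im (X \<omega> $$ (j, i)))"

definition wigner_hermitian ::
  "'a measure \<Rightarrow> nat \<Rightarrow> real measure \<Rightarrow> real measure \<Rightarrow> ('a \<Rightarrow> complex mat) \<Rightarrow> bool" where
  "wigner_hermitian M n \<nu> \<nu>' X \<longleftrightarrow>
     prob_space M \<and> atom_law \<nu> (1/2) \<and> atom_law \<nu>' 1 \<and>
     (\<forall>\<omega>\<in>space M. X \<omega> \<in> carrier_mat n n \<and> mat_adjoint (X \<omega>) = X \<omega>) \<and>
     prob_space.indep_vars M (\<lambda>_. borel) (wigner_coord X) ({..<n} \<times> {..<n}) \<and>
     (\<forall>i<n. \<forall>j<n. distr M borel (wigner_coord X (i, j)) = (if i = j then \<nu>' else \<nu>))"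

definition external_source :: "real \<Rightarrow> nat \<Rightarrow> complex mat \<Rightarrow> bool" where
  "external_source a n A \<longleftrightarrow>
     A \<in> carrier_mat n n \<and> diagonal_mat A \<and>
     2 * card {i. i < n \<and> A $$ (i, i) = complex_of_real a} = n \<and>
     2 * card {i. i < n \<and> A $$ (i, i) = - complex_of_real a} = n"

definition deformed_wigner :: "nat \<Rightarrow> complex mat \<Rightarrow> complex mat \<Rightarrow> complex mat" where
  "deformed_wigner n X A = complex_of_real (1 / sqrt (real n)) \<cdot>\<^sub>m X + A"

text \<open>Eigenvalues are counted with multiplicity.\<close>

definition num_eigenvalues_in :: "complex mat \<Rightarrow> real set \<Rightarrow> nat" where
  "num_eigenvalues_in W I = size {# z \<in># proots (char_poly W). z \<in> complex_of_real ` I #}"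

definition pastur_equation :: "real \<Rightarrow> real \<Rightarrow> complex \<Rightarrow> bool" where
  "pastur_equation a x w \<longleftrightarrow>
     w ^ 3 - of_real x * w\<^sup>2 - of_real (a\<^sup>2 - 1) * w + of_real (x * a\<^sup>2) = 0"

text \<open>
  The cubic has real coefficients, so its non-real solutions, if any, are a single conjugate pair
  and \<open>\<bar>Im w\<bar>\<close> does not depend on the choice of \<open>w\<close>.
\<close>

definition pastur_density :: "real \<Rightarrow> real \<Rightarrow> real" where
  "pastur_density a x =
     (if \<exists>w. pastur_equation a x w \<and> w \<notin> \<real>
      then \<bar>Im (SOME w. pastur_equation a x w \<and> w \<notin> \<real>)\<bar> / pi
      else 0)"

definition even_sequentially :: "nat filter" where
  "even_sequentially = inf sequentially (principal {n. even n})"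

definition overwhelming_probability :: "(nat \<Rightarrow> 'a measure) \<Rightarrow> (nat \<Rightarrow> 'a set) \<Rightarrow> bool" where
  "overwhelming_probability M E \<longleftrightarrow>
     (\<exists>f :: nat \<Rightarrow> real.
        filterlim (\<lambda>n. f n / ln (real n)) at_top even_sequentially \<and>
        (\<forall>\<^sub>F n in even_sequentially. E n \<in> sets (M n) \<and> measure (M n) (E n) \<ge> 1 - exp (- f n)))"

end

theory Submission
  imports Defs
begin

text \<open>
  Write \<open>W\<close> for the matrix, \<open>s(z) = (1/n) tr (W - z)\<^sup>-\<^sup>1\<close> for the Stieltjes transform of its spectrum and
  \<open>w = z + s(z)\<close>. The Stieltjes transform of the source law is
  \<open>F(w) = (1/(a - w) + 1/(-a - w))/2\<close>, and the Pastur equation is the cubic form of \<open>w - z = F(w)\<close>.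
  The proof shows that \<open>s\<close> solves this equation up to a small error down to the height
  \<open>\<eta> = K\<^sup>2 (ln n)\<^sup>1\<^sup>6 / n\<close>, deduces that \<open>Im s(E + i\<eta>)\<close> is uniformly close to \<open>\<pi> \<rho>(E)\<close>, and counts
  eigenvalues in \<open>I\<close> by integrating the Poisson kernels of which \<open>Im s\<close> is the average. The factor
  \<open>(ln n)\<^sup>4\<close> between \<open>\<eta>\<close> and \<open>|I|\<close> makes the smoothing at the end points of \<open>I\<close> negligible.

  \<^bold>\<open>The local equation.\<close> By the Schur complement formula the diagonal entry \<open>G\<^sub>i\<^sub>i\<close> of the resolvent is the
  inverse of \<open>a\<^sub>i + X\<^sub>i\<^sub>i/\<surd>n - z - Q\<^sub>i/n\<close>, where \<open>Q\<^sub>i\<close> is a quadratic form in the \<open>i\<close>-th row of \<open>X\<close> whose matrix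
  \<open>B\<close> is the resolvent of \<open>W\<close> with row and column \<open>i\<close> decoupled, hence independent of that row. So
  \<open>Q\<^sub>i\<close> concentrates around \<open>tr B\<close>, which differs from \<open>n s\<close> by at most \<open>1/\<eta>\<close>; this is
  \<open>local_equation\<close>. The concentration (\<open>quadratic_form_upper_tail\<close>) is a martingale estimate: revealing
  the variables one at a time, each increment is the new variable times a linear form in the old ones,
  and truncating that linear form at its typical size makes the conditional variances deterministic.
  The deviation is of order \<open>K\<close> times the Frobenius norm of \<open>B\<close>, with only one factor \<open>K\<close>, because one of
  the two variables enters through its variance. Since the squared Frobenius norm is
  at most \<open>Im (tr B)/\<eta>\<close> (the Ward identity), the error is a negative power of \<open>ln n\<close> as soon as
  \<open>n\<eta>\<close> exceeds \<open>K\<^sup>2\<close> by a sufficient power of \<open>ln n\<close>. Averaging over \<open>i\<close> gives the approximate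
  equation for \<open>s\<close> (\<open>approximate_source_equation\<close>).

  \<^bold>\<open>Stability.\<close> In the open upper half plane the equation has a single solution, but near the real
  axis an approximate solution may also follow the real root of the cubic. It cannot switch between
  roots: on the vertical segment above \<open>E\<close> it is continuous and stays in the union of small discs around
  the roots at \<open>E\<close>, and at the top of the segment the exact uniqueness selects the right disc. The same
  continuity keeps \<open>w\<close> away from the poles \<open>\<plusminus>a\<close> of \<open>F\<close>, close to which the error is not controlled. For
  large \<open>|E|\<close> all branches are almost real, which makes the estimate uniform in \<open>E\<close>. This is
  \<open>pastur_stability\<close>.

  \<^bold>\<open>Probability.\<close> The local equation is required on a grid of mesh \<open>n\<^sup>-\<^sup>3\<close> covering the spectral window; a union
  bound over the grid costs a power of \<open>n\<close> against \<open>exp (- (ln n)\<^sup>2)\<close>, and the Lipschitz continuity of \<open>s\<close>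
  extends the equation to the whole window. Intervals longer than a constant depending on \<open>a\<close> and
  \<open>\<delta>\<close> are settled by \<open>N\<^sub>I \<le> n\<close> and the smallness of \<open>\<rho>\<close> far out.
\<close>

section \<open>The cubic Pastur equation\<close>

text \<open>
  The Stieltjes transform of \<open>(\<delta>\<^sub>a + \<delta>\<^sub>-\<^sub>a)/2\<close>. Multiplying \<open>w - z = F(w)\<close> by \<open>w\<^sup>2 - a\<^sup>2\<close> clears its poles
  and gives the Pastur cubic.
\<close>

definition source_stieltjes :: "real \<Rightarrow> complex \<Rightarrow> complex" where
  "source_stieltjes a w = (1 / (of_real a - w) + 1 / (- of_real a - w)) / 2"

definition pastur_cubic :: "real \<Rightarrow> complex \<Rightarrow> complex \<Rightarrow> complex" where
  "pastur_cubic a z w = w ^ 3 - z * w\<^sup>2 - of_real (a\<^sup>2 - 1) * w + z * of_real (a\<^sup>2)"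

lemma pastur_equation_iff_cubic: "pastur_equation a x w \<longleftrightarrow> pastur_cubic a (of_real x) w = 0"
  by (simp add: pastur_equation_def pastur_cubic_def)

lemma pastur_cubic_eq:
  assumes "w \<noteq> of_real a" "w \<noteq> - of_real a"
  shows "pastur_cubic a z w = (w\<^sup>2 - of_real (a\<^sup>2)) * (w - z - source_stieltjes a w)"
proof -
  have 1: "of_real a - w \<noteq> 0" "- of_real a - w \<noteq> 0"
    using assms by (auto simp: algebra_simps add_eq_0_iff)
  have "(w\<^sup>2 - of_real (a\<^sup>2)) * source_stieltjes a w = - w"
  proof -
    define u where "u = of_real a - w"
    define v where "v = - of_real a - w"
    have "w\<^sup>2 - of_real (a\<^sup>2) = u * v"
      unfolding u_def v_def by (simp add: algebra_simps power2_eq_square)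
    moreover have "u * v * ((1 / u + 1 / v) / 2) = (u + v) / 2"
      using 1 unfolding u_def[symmetric] v_def[symmetric] by (simp add: field_simps)
    moreover have "(u + v) / 2 = - w" unfolding u_def v_def by simp
    ultimately show ?thesis
      unfolding source_stieltjes_def u_def[symmetric] v_def[symmetric] by simp
  qed
  then have "(w\<^sup>2 - of_real (a\<^sup>2)) * (w - z - source_stieltjes a w)
     = (w\<^sup>2 - of_real (a\<^sup>2)) * (w - z) + w"
    by (simp add: algebra_simps)
  then show ?thesis
    by (simp add: pastur_cubic_def algebra_simps power2_eq_square power3_eq_cube)
qed

lemma Im_pos_neq_real: "Im w > 0 \<Longrightarrow> w \<noteq> of_real a" "Im w > 0 \<Longrightarrow> w \<noteq> - of_real a"
  by auto

lemma Im_inverse_source: "Im (1 / (of_real b - w)) = Im w / (cmod (of_real b - w))\<^sup>2"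
  by (cases w) (simp add: Im_divide cmod_def power2_eq_square)

text \<open>
  Imaginary parts of \<open>w - z = F(w)\<close>: since \<open>Im (1/(b - w)) = Im w / |b - w|\<^sup>2\<close>, the average of
  \<open>1/|\<plusminus>a - w|\<^sup>2\<close> is smaller than \<open>1\<close> as soon as \<open>Im z > 0\<close>, and equal to \<open>1\<close> at a non-real root for real \<open>z\<close>.
\<close>

lemma upper_root_bound:
  assumes "Im z \<ge> 0" "Im w > 0" "w - z = source_stieltjes a w"
  defines "p \<equiv> 1 / cmod (of_real a - w)" and "q \<equiv> 1 / cmod (- of_real a - w)"
  shows "Im w = Im z + Im w * ((p\<^sup>2 + q\<^sup>2) / 2)"
proof -
  have "Im w - Im z = Im (source_stieltjes a w)" using assms(3) by (metis minus_complex.sel(2))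
  also have "\<dots> = (Im (1 / (of_real a - w)) + Im (1 / (of_real (-a) - w))) / 2"
    unfolding source_stieltjes_def by simp
  also have "\<dots> = Im w * ((p\<^sup>2 + q\<^sup>2) / 2)"
    unfolding Im_inverse_source p_def q_def by (simp add: field_simps)
  finally show ?thesis by simp
qed

text \<open>
  The difference of two solutions is reproduced by \<open>F\<close> with a factor that is the average of
  \<open>1/((\<plusminus>a - w\<^sub>1)(\<plusminus>a - w\<^sub>2))\<close>; by the arithmetic-geometric mean inequality and \<open>upper_root_bound\<close> it has
  modulus below \<open>1\<close>.
\<close>

lemma upper_root_unique:
  assumes z: "Im z > 0" and w: "Im w1 > 0" "Im w2 > 0"
    and 0: "pastur_cubic a z w1 = 0" "pastur_cubic a z w2 = 0"
  shows "w1 = w2"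
proof -
  have ne: "w\<^sup>2 - of_real (a\<^sup>2) \<noteq> 0" if "Im w > 0" for w
  proof -
    have "w\<^sup>2 - of_real (a\<^sup>2) = (w - of_real a) * (w - (- of_real a))"
      by (simp add: algebra_simps power2_eq_square)
    then show ?thesis using Im_pos_neq_real[OF that, of a] by (metis mult_eq_0_iff eq_iff_diff_eq_0)
  qed
  have fp: "w - z = source_stieltjes a w" if "Im w > 0" "pastur_cubic a z w = 0" for w
    using pastur_cubic_eq[OF Im_pos_neq_real[OF that(1)], of a z] ne[OF that(1)] that(2)
    by simp
  define p where "p w = 1 / cmod (of_real a - w)" for w
  define q where "q w = 1 / cmod (- of_real a - w)" for w
  have g: "(p w)\<^sup>2 + (q w)\<^sup>2 < 2" if "Im w > 0" "pastur_cubic a z w = 0" for w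
  proof -
    have "Im w = Im z + Im w * (((p w)\<^sup>2 + (q w)\<^sup>2) / 2)"
      using upper_root_bound[OF _ that(1) fp[OF that]] z unfolding p_def q_def by simp
    then have "Im w * (((p w)\<^sup>2 + (q w)\<^sup>2) / 2) < Im w * 1" using z by linarith
    then have "((p w)\<^sup>2 + (q w)\<^sup>2) / 2 < 1" using that(1) by (simp only: mult_less_cancel_left_pos)
    then show ?thesis by simp
  qed
  have d1: "1 / (b - w1) - 1 / (b - w2) = (w1 - w2) * ((1 / (b - w1)) * (1 / (b - w2)))"
    if "b - w1 \<noteq> 0" "b - w2 \<noteq> 0" for b :: complex
    using that by (simp add: field_simps)
  have nz: "of_real a - w1 \<noteq> 0" "of_real a - w2 \<noteq> 0" "- of_real a - w1 \<noteq> 0" "- of_real a - w2 \<noteq> 0"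
    using w by (auto simp: complex_eq_iff)
  define A1 where "A1 = 1 / (of_real a - w1)"
  define A2 where "A2 = 1 / (of_real a - w2)"
  define B1 where "B1 = 1 / (- of_real a - w1)"
  define B2 where "B2 = 1 / (- of_real a - w2)"
  have "w1 - w2 = source_stieltjes a w1 - source_stieltjes a w2"
    unfolding fp[OF w(1) 0(1), symmetric] fp[OF w(2) 0(2), symmetric] by simp
  also have "\<dots> = ((A1 - A2) + (B1 - B2)) / 2"
    unfolding source_stieltjes_def A1_def A2_def B1_def B2_def by (simp add: field_simps)
  also have "A1 - A2 = (w1 - w2) * (A1 * A2)" unfolding A1_def A2_def by (rule d1[OF nz(1,2)])
  also have "B1 - B2 = (w1 - w2) * (B1 * B2)" unfolding B1_def B2_def by (rule d1[OF nz(3,4)])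
  finally have e: "w1 - w2 = (w1 - w2) * ((A1 * A2 + B1 * B2) / 2)" by (simp add: algebra_simps)
  have "cmod (A1 * A2 + B1 * B2) \<le> cmod A1 * cmod A2 + cmod B1 * cmod B2"
    by (metis norm_triangle_ineq norm_mult)
  also have "\<dots> = p w1 * p w2 + q w1 * q w2"
    unfolding A1_def A2_def B1_def B2_def p_def q_def by (simp add: norm_divide)
  also have "\<dots> \<le> (((p w1)\<^sup>2 + (p w2)\<^sup>2) / 2) + (((q w1)\<^sup>2 + (q w2)\<^sup>2) / 2)"
    using sum_squares_bound[of "p w1" "p w2"] sum_squares_bound[of "q w1" "q w2"] by argo
  also have "\<dots> < 2" using g[OF w(1) 0(1)] g[OF w(2) 0(2)] by argo
  finally have "cmod ((A1 * A2 + B1 * B2) / 2) < 1" by (simp add: norm_divide)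
  then have "(A1 * A2 + B1 * B2) / 2 \<noteq> 1" by (metis less_irrefl norm_one)
  then have "w1 - w2 = 0" using mult_cancel_left1[of "w1 - w2" "(A1 * A2 + B1 * B2) / 2"] e by blast
  then show ?thesis by simp
qed

lemma pastur_cubic_factor:
  obtains r1 r2 r3 where "\<forall>w. pastur_cubic a z w = (w - r1) * (w - r2) * (w - r3)"
    "r1 + r2 + r3 = z"
proof -
  obtain r1 where r1: "pastur_cubic a z r1 = 0"
  proof -
    let ?p = "[: z * of_real (a\<^sup>2), - of_real (a\<^sup>2 - 1), - z, 1 :] :: complex poly"
    have "\<not> constant (poly ?p)" unfolding constant_degree by simp
    then obtain r where "poly ?p r = 0" using fundamental_theorem_of_algebra by blast
    then have "pastur_cubic a z r = 0"
      by (simp add: pastur_cubic_def algebra_simps power2_eq_square power3_eq_cube)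
    then show ?thesis using that by blast
  qed
  define b where "b = r1 - z"
  define c where "c = r1 * b - of_real (a\<^sup>2 - 1)"
  have f1: "pastur_cubic a z w = (w - r1) * (w\<^sup>2 + b * w + c)" for w
  proof -
    have "pastur_cubic a z w = pastur_cubic a z w - pastur_cubic a z r1" using r1 by simp
    also have "\<dots> = (w - r1) * (w\<^sup>2 + b * w + c)"
      unfolding pastur_cubic_def b_def c_def by (simp add: algebra_simps power2_eq_square power3_eq_cube)
    finally show ?thesis .
  qed
  obtain s where s: "s\<^sup>2 = b\<^sup>2 - 4 * c" by (metis power2_csqrt)
  define r2 where "r2 = (- b + s) / 2"
  define r3 where "r3 = (- b - s) / 2"
  have "r2 * r3 = (b\<^sup>2 - s\<^sup>2) / 4" unfolding r2_def r3_def by (simp add: field_simps power2_eq_square)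
  then have m: "r2 * r3 = c" using s by simp
  have sm: "r2 + r3 = - b" unfolding r2_def r3_def by (simp add: field_simps)
  have f2: "w\<^sup>2 + b * w + c = (w - r2) * (w - r3)" for w
  proof -
    have "(w - r2) * (w - r3) = w\<^sup>2 - (r2 + r3) * w + r2 * r3" by (simp add: algebra_simps power2_eq_square)
    then show ?thesis using m sm by simp
  qed
  have "pastur_cubic a z w = (w - r1) * (w - r2) * (w - r3)" for w
    using f1 f2 by (simp add: mult.assoc)
  moreover have "r1 + r2 + r3 = z" using sm b_def by (simp add: add.assoc)
  ultimately show ?thesis using that by blast
qed

text \<open>
  The value of a monic cubic is the product of the three distances to its roots, so one of them is at
  most the cube root. This yields perturbation bounds that stay uniform when roots collide.
\<close>

lemma pastur_cubic_near_root:
  assumes "cmod (pastur_cubic a z w) \<le> m ^ 3" "m \<ge> 0"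
  obtains r where "pastur_cubic a z r = 0" "cmod (w - r) \<le> m"
proof -
  obtain r1 r2 r3 where f: "\<forall>w. pastur_cubic a z w = (w - r1) * (w - r2) * (w - r3)"
    and "r1 + r2 + r3 = z"
    by (rule pastur_cubic_factor[of a z])
  have "\<exists>r\<in>{r1, r2, r3}. cmod (w - r) \<le> m"
  proof (rule ccontr)
    assume "\<not> ?thesis"
    then have "m < cmod (w - r1)" "m < cmod (w - r2)" "m < cmod (w - r3)" by auto
    moreover have "m * m < cmod (w - r1) * cmod (w - r2)"
      using calculation assms(2) by (intro mult_strict_mono') auto
    ultimately have "m * m * m < cmod (w - r1) * cmod (w - r2) * cmod (w - r3)"
      using assms(2) by (intro mult_strict_mono') auto
    then show False using assms(1) f by (simp add: norm_mult power3_eq_cube)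
  qed
  then show ?thesis using f that by auto
qed

lemma pastur_cubic_cnj: "pastur_cubic a (of_real x) (cnj w) = cnj (pastur_cubic a (of_real x) w)"
  by (simp add: pastur_cubic_def)

text \<open>
  The roots sum to the real number \<open>x\<close>, so the root besides a conjugate pair is real.
\<close>

lemma pastur_nonreal_roots:
  assumes "pastur_cubic a (of_real x) w0 = 0" "Im w0 > 0" "pastur_cubic a (of_real x) w = 0"
  shows "w = w0 \<or> w = cnj w0 \<or> Im w = 0"
proof -
  obtain r1 r2 r3 where f: "\<forall>w. pastur_cubic a (of_real x) w = (w - r1) * (w - r2) * (w - r3)"
    and s: "r1 + r2 + r3 = of_real x"
    by (rule pastur_cubic_factor[of a "of_real x"])
  have mem: "u \<in> {r1, r2, r3}" if "pastur_cubic a (of_real x) u = 0" for u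
    using f that by auto
  have w0: "w0 \<in> {r1, r2, r3}" and c: "cnj w0 \<in> {r1, r2, r3}" and w: "w \<in> {r1, r2, r3}"
    using mem assms pastur_cubic_cnj[of a x w0] by auto
  have ne: "w0 \<noteq> cnj w0" using assms(2) by (simp add: complex_eq_iff)
  have "Im r1 + Im r2 + Im r3 = 0" using arg_cong[OF s, of Im] by simp
  then show ?thesis using w0 c w ne by (auto simp: complex_eq_iff)
qed

lemma pastur_density_nonneg: "pastur_density a x \<ge> 0"
  by (simp add: pastur_density_def)

lemma pastur_density_upper_root:
  assumes "pastur_cubic a (of_real x) w0 = 0" "Im w0 > 0"
  shows "pi * pastur_density a x = Im w0"
proof -
  have ex: "\<exists>w. pastur_equation a x w \<and> w \<notin> \<real>"
    using assms by (metis pastur_equation_iff_cubic complex_is_Real_iff less_irrefl)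
  define w where "w = (SOME w. pastur_equation a x w \<and> w \<notin> \<real>)"
  have "pastur_equation a x w \<and> w \<notin> \<real>" unfolding w_def by (rule someI_ex[OF ex])
  then have "w = w0 \<or> w = cnj w0"
    using pastur_nonreal_roots[OF assms] by (auto simp: pastur_equation_iff_cubic complex_is_Real_iff)
  then have "\<bar>Im w\<bar> = Im w0" using assms(2) by auto
  then show ?thesis using ex unfolding pastur_density_def w_def by simp
qed

lemma pastur_density_pos_root:
  assumes "pastur_density a x > 0"
  obtains w0 where "pastur_cubic a (of_real x) w0 = 0" "Im w0 = pi * pastur_density a x"
proof -
  obtain w where w: "pastur_cubic a (of_real x) w = 0" "Im w \<noteq> 0"
    using assms by (auto simp: pastur_density_def pastur_equation_iff_cubic complex_is_Real_iff split: if_splits)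
  define w0 where "w0 = (if Im w > 0 then w else cnj w)"
  have "pastur_cubic a (of_real x) w0 = 0" "Im w0 > 0"
    using w pastur_cubic_cnj[of a x w] unfolding w0_def by auto
  then show ?thesis using pastur_density_upper_root that by metis
qed

lemma pastur_root_Im_le:
  assumes "pastur_cubic a (of_real x) w = 0"
  shows "Im w \<le> pi * pastur_density a x"
proof (cases "Im w > 0")
  case True
  then show ?thesis using pastur_density_upper_root[OF assms True] by simp
next
  case False
  then show ?thesis using pastur_density_nonneg[of a x] by (smt (verit) mult_nonneg_nonneg pi_ge_zero)
qed

lemma pastur_upper_root_fixpoint:
  assumes "pastur_cubic a z w = 0" "Im w > 0"
  shows "w - z = source_stieltjes a w"
proof -
  have "w\<^sup>2 - of_real (a\<^sup>2) = (w - of_real a) * (w - (- of_real a))"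
    by (simp add: algebra_simps power2_eq_square)
  then have "w\<^sup>2 - of_real (a\<^sup>2) \<noteq> 0"
    using Im_pos_neq_real[OF assms(2), of a] by (metis mult_eq_0_iff eq_iff_diff_eq_0)
  then show ?thesis
    using pastur_cubic_eq[OF Im_pos_neq_real[OF assms(2)], of a z] assms(1) by simp
qed

text \<open>
  At a non-real root over a real point the average of \<open>1/|\<plusminus>a - w|\<^sup>2\<close> is \<open>1\<close>, while each term is at most
  \<open>1/(Im w)\<^sup>2\<close>.
\<close>

lemma pastur_density_le: "pi * pastur_density a x \<le> 1"
proof (cases "pastur_density a x > 0")
  case True
  then obtain w where w: "pastur_cubic a (of_real x) w = 0" "Im w = pi * pastur_density a x"
    by (rule pastur_density_pos_root)
  then have pos: "Im w > 0" using True by simp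
  define p where "p = 1 / cmod (of_real a - w)"
  define q where "q = 1 / cmod (- of_real a - w)"
  have "Im w = Im w * ((p\<^sup>2 + q\<^sup>2) / 2)"
    using upper_root_bound[OF _ pos pastur_upper_root_fixpoint[OF w(1) pos]] unfolding p_def q_def by simp
  then have 1: "(p\<^sup>2 + q\<^sup>2) / 2 = 1" using pos by simp
  have "Im w \<le> cmod (of_real a - w)" "Im w \<le> cmod (- of_real a - w)"
    using abs_Im_le_cmod[of "of_real a - w"] abs_Im_le_cmod[of "- of_real a - w"] by auto
  then have "p \<le> 1 / Im w" "q \<le> 1 / Im w" using pos unfolding p_def q_def by (auto intro!: divide_left_mono mult_pos_pos)
  moreover have "p \<ge> 0" "q \<ge> 0" by (auto simp: p_def q_def)
  ultimately have "p\<^sup>2 \<le> (1 / Im w)\<^sup>2" "q\<^sup>2 \<le> (1 / Im w)\<^sup>2" by (auto intro: power_mono)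
  then have "1 \<le> (1 / Im w)\<^sup>2" using 1 by argo
  then have "1\<^sup>2 \<le> (1 / Im w)\<^sup>2" by simp
  then have "1 \<le> 1 / Im w" by (rule power2_le_imp_le) (use pos in simp)
  then show ?thesis using pos w(2) by (simp add: field_simps)
next
  case False
  then show ?thesis using pastur_density_nonneg[of a x] by simp
qed

text \<open>
  Far out every approximate solution is almost real, on whichever branch it lies: if \<open>w\<close> is large then
  \<open>F(w)\<close> is small, and otherwise \<open>F(w) \<approx> w - z\<close> is large, which puts \<open>w\<close> next to one of the real points \<open>\<plusminus>a\<close>.
\<close>

lemma approx_root_outside:
  assumes "L \<ge> 4 * a" "L \<ge> 4" "a > 0" "\<bar>Re z\<bar> \<ge> L" "\<kappa> \<le> 1" "Im z \<ge> 0"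
    and w: "cmod (w - z - source_stieltjes a w) \<le> \<kappa>"
  shows "Im w \<le> Im z + \<kappa> + 4 / L"
proof (cases "cmod w \<ge> L / 2")
  case True
  have "cmod (of_real a - w) \<ge> L / 4" "cmod (- of_real a - w) \<ge> L / 4"
    using True assms(1,3) norm_triangle_ineq2[of w "of_real a"] norm_triangle_ineq2[of w "- of_real a"]
    by (auto simp: norm_minus_commute)
  then have "cmod (1 / (of_real a - w)) \<le> 4 / L" "cmod (1 / (- of_real a - w)) \<le> 4 / L"
    using assms(2) by (auto simp: norm_divide pos_divide_le_eq divide_le_eq mult.commute)
  then have "cmod (source_stieltjes a w) \<le> 4 / L"
    unfolding source_stieltjes_def using norm_triangle_ineq[of "1 / (of_real a - w)" "1 / (- of_real a - w)"]
    by (simp add: norm_divide)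
  then have "Im (source_stieltjes a w) \<le> 4 / L" using abs_Im_le_cmod[of "source_stieltjes a w"] by linarith
  moreover have "Im (w - z - source_stieltjes a w) \<le> \<kappa>" using abs_Im_le_cmod[of "w - z - source_stieltjes a w"] w by linarith
  ultimately show ?thesis by simp
next
  case False
  have "cmod z \<ge> L" using assms(4) abs_Re_le_cmod[of z] by linarith
  moreover have "cmod z \<le> cmod w + cmod (source_stieltjes a w) + \<kappa>"
  proof -
    have "cmod z = cmod (w - source_stieltjes a w - (w - z - source_stieltjes a w))" by simp
    also have "\<dots> \<le> cmod (w - source_stieltjes a w) + cmod (w - z - source_stieltjes a w)" by (rule norm_triangle_ineq4)
    also have "\<dots> \<le> cmod w + cmod (source_stieltjes a w) + \<kappa>" using w norm_triangle_ineq4[of w "source_stieltjes a w"] by linarith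
    finally show ?thesis .
  qed
  ultimately have "cmod (source_stieltjes a w) \<ge> L / 4" using False assms(2,5) by linarith
  then have "cmod (1 / (of_real a - w)) + cmod (1 / (- of_real a - w)) \<ge> L / 2"
    unfolding source_stieltjes_def norm_divide[of _ 2] using norm_triangle_ineq[of "1 / (of_real a - w)" "1 / (- of_real a - w)"]
    by simp
  then consider "1 / cmod (of_real a - w) \<ge> L / 4" | "1 / cmod (- of_real a - w) \<ge> L / 4"
    by (fastforce simp: norm_divide)
  then have "Im w \<le> 4 / L"
  proof cases
    case 1
    then have "cmod (of_real a - w) \<le> 4 / L" using assms(2) 
      by (cases "cmod (of_real a - w) = 0") (auto simp: field_simps)
    then show ?thesis using abs_Im_le_cmod[of "of_real a - w"] by simp
  next
    case 2
    then have "cmod (- of_real a - w) \<le> 4 / L" using assms(2) 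
      by (cases "cmod (- of_real a - w) = 0") (auto simp: field_simps)
    then show ?thesis using abs_Im_le_cmod[of "- of_real a - w"] by simp
  qed
  moreover have "\<kappa> \<ge> 0" using w norm_ge_zero order_trans by blast
  ultimately show ?thesis using assms(6) by linarith
qed

section \<open>Stability of the Pastur equation\<close>

lemma source_stieltjes_large:
  assumes "cmod w \<ge> 2 * a" "a \<ge> 1"
  shows "cmod (source_stieltjes a w) \<le> 1"
proof -
  have "cmod (of_real a - w) \<ge> 1" "cmod (- of_real a - w) \<ge> 1"
    using assms norm_triangle_ineq2[of w "of_real a"] norm_triangle_ineq2[of w "- of_real a"]
    by (auto simp: norm_minus_commute)
  then have "cmod (1 / (of_real a - w)) \<le> 1" "cmod (1 / (- of_real a - w)) \<le> 1"
    by (auto simp: norm_divide divide_le_eq)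
  then show ?thesis
    unfolding source_stieltjes_def norm_divide[of _ 2]
    using norm_triangle_ineq[of "1 / (of_real a - w)" "1 / (- of_real a - w)"] by simp
qed

lemma approx_root_bounded:
  assumes "cmod (w - z - source_stieltjes a w) \<le> 1" "cmod z \<le> L" "a \<ge> 1"
  shows "cmod w \<le> 2 * a + L + 2"
proof (cases "cmod w \<ge> 2 * a")
  case True
  have "w = z + source_stieltjes a w + (w - z - source_stieltjes a w)" by simp
  then have "cmod w \<le> cmod z + cmod (source_stieltjes a w) + cmod (w - z - source_stieltjes a w)"
    using norm_triangle_ineq[of "z + source_stieltjes a w" "w - z - source_stieltjes a w"]
      norm_triangle_ineq[of z "source_stieltjes a w"] by simp
  then show ?thesis using assms source_stieltjes_large[OF True assms(3)] by linarith
next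
  case False
  then show ?thesis using assms(2) norm_ge_zero[of z] by linarith
qed

text \<open>
  Close to a pole \<open>F(w)\<close> would be larger than \<open>w - z\<close> can be. In the continuity argument this says that a
  curve of approximate solutions cannot enter the zone between the excluded neighbourhood of a pole and
  this fixed distance.
\<close>

lemma approx_root_pole_gap:
  assumes "cmod (w - z - source_stieltjes a w) \<le> 1" "cmod z \<le> L" "a \<ge> 1" "Im w > 0"
  shows "cmod (w - of_real a) \<ge> 1 / (2 * (a + L + 4)) \<and> cmod (w + of_real a) \<ge> 1 / (2 * (a + L + 4))"
proof -
  define c where "c = 1 / (2 * (a + L + 4))"
  have L: "L \<ge> 0" using assms(2) norm_ge_zero order_trans by blast
  have c: "c \<le> 1 / 2" "c > 0" using L assms(3) unfolding c_def by (auto simp: field_simps)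
  have main: False if near: "cmod (w - b) < c" "Im b = 0" and sym: "cmod b = a"
     "source_stieltjes a w = (1 / (b - w) + 1 / (- b - w)) / 2" for b
  proof -
    have wb: "cmod w \<le> a + 1 / 2" using near sym c norm_triangle_ineq2[of w b] by linarith
    have "cmod (source_stieltjes a w) \<le> a + 1 / 2 + L + 1"
    proof -
      have "cmod (source_stieltjes a w) = cmod (w - (z + (w - z - source_stieltjes a w)))" by simp
      also have "\<dots> \<le> cmod w + (cmod z + cmod (w - z - source_stieltjes a w))"
        using norm_triangle_ineq4[of w "z + (w - z - source_stieltjes a w)"]
          norm_triangle_ineq[of z "w - z - source_stieltjes a w"] by linarith
      finally show ?thesis using wb assms by linarith
    qed
    moreover have "cmod (1 / (- b - w)) \<le> 1"
    proof -
      have "- b - w = - (2 * b + (w - b))" by simp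
      then have "cmod (- b - w) = cmod (2 * b + (w - b))" by (simp only: norm_minus_cancel)
      also have "\<dots> \<ge> 2 * a - c" using norm_diff_ineq[of "2 * b" "w - b"] near sym by (simp add: norm_mult)
      finally have "cmod (- b - w) \<ge> 1" using c assms(3) by linarith
      then show ?thesis by (simp add: norm_divide divide_le_eq)
    qed
    moreover have "cmod p \<le> cmod (p + q) + cmod q" for p q :: complex
      using norm_triangle_ineq4[of "p + q" q] by simp
    from this[of "1 / (b - w)" "1 / (- b - w)"]
    have "cmod (1 / (b - w)) \<le> cmod (1 / (b - w) + 1 / (- b - w)) + cmod (1 / (- b - w))" .
    moreover have "cmod (1 / (b - w) + 1 / (- b - w)) = 2 * cmod (source_stieltjes a w)"
      unfolding sym(2) norm_divide[of _ 2] by simp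
    moreover have "P \<le> 2 * U + 1" if "S \<le> U" "Q \<le> 1" "P \<le> T + Q" "T = 2 * S" for P Q S T U :: real
      using that by linarith
    ultimately have "cmod (1 / (b - w)) \<le> 2 * (a + 1 / 2 + L + 1) + 1" by blast
    then have le: "1 / cmod (b - w) \<le> 2 * (a + 1 / 2 + L + 1) + 1" by (simp only: norm_divide norm_one)
    have "b \<noteq> w" using assms(4) near(2) by auto
    then have "1 / c < 1 / cmod (b - w)"
      using near c by (intro divide_strict_left_mono mult_pos_pos) (auto simp: norm_minus_commute)
    moreover have "1 / c = 2 * (a + L + 4)" unfolding c_def by simp
    ultimately show False using le by simp
  qed
  have "source_stieltjes a w = (1 / (of_real a - w) + 1 / (- of_real a - w)) / 2"
    "source_stieltjes a w = (1 / ((- of_real a) - w) + 1 / (- (- of_real a) - w)) / 2"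
    unfolding source_stieltjes_def by (simp_all add: add.commute)
  note S = this
  have "\<not> cmod (w - of_real a) < c"
    by (rule notI, rule main[of "of_real a"]) (use S(1) assms(3) in simp_all)
  moreover have "\<not> cmod (w - (- of_real a)) < c"
    by (rule notI, rule main[of "- of_real a"]) (use assms(3) in simp, simp, use assms(3) in simp, rule S(2))
  ultimately show ?thesis unfolding c_def[symmetric] by simp
qed


lemma pastur_cubic_shift:
  "pastur_cubic a z w - pastur_cubic a z' w = (z' - z) * (w\<^sup>2 - of_real (a\<^sup>2))"
  by (simp add: pastur_cubic_def algebra_simps)

lemma norm_square_diff_le:
  assumes "cmod w \<le> R"
  shows "cmod (w\<^sup>2 - of_real (a\<^sup>2)) \<le> R\<^sup>2 + a\<^sup>2"
proof -
  have "cmod (w\<^sup>2 - of_real (a\<^sup>2)) \<le> (cmod w)\<^sup>2 + a\<^sup>2"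
    using norm_triangle_ineq4[of "w\<^sup>2" "of_real (a\<^sup>2)"] by (simp add: norm_power)
  moreover have "(cmod w)\<^sup>2 \<le> R\<^sup>2" using assms by (intro power_mono) auto
  ultimately show ?thesis by linarith
qed

lemma pastur_upper_root_bounded:
  assumes "pastur_cubic a (of_real x) w = 0" "Im w > 0" "\<bar>x\<bar> \<le> L" "a \<ge> 1"
  shows "cmod w \<le> 2 * a + L + 2"
  by (rule approx_root_bounded[where z = "of_real x"]) (use assms pastur_upper_root_fixpoint[OF assms(1,2)] in auto)

text \<open>
  A non-real root at \<open>x\<close> nearly solves the cubic at \<open>y\<close>, hence has a root at \<open>y\<close> nearby, whose imaginary part
  cannot exceed \<open>\<pi> \<rho>(y)\<close>.
\<close>

lemma pastur_density_holder:
  assumes "\<bar>x\<bar> \<le> L" "\<bar>y\<bar> \<le> L" "a \<ge> 1" "m \<ge> 0"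
    and small: "\<bar>x - y\<bar> * ((2 * a + L + 2)\<^sup>2 + a\<^sup>2) \<le> m ^ 3"
  shows "pi * pastur_density a x \<le> pi * pastur_density a y + m"
proof (cases "pastur_density a x > 0")
  case True
  then obtain w where w: "pastur_cubic a (of_real x) w = 0" "Im w = pi * pastur_density a x"
    by (rule pastur_density_pos_root)
  then have pos: "Im w > 0" using True by simp
  have "cmod (pastur_cubic a (of_real y) w) = cmod ((of_real x - of_real y) * (w\<^sup>2 - of_real (a\<^sup>2)))"
    using pastur_cubic_shift[of a "of_real y" w "of_real x"] w(1) by simp
  also have "\<dots> = \<bar>x - y\<bar> * cmod (w\<^sup>2 - of_real (a\<^sup>2))"
    by (simp only: norm_mult norm_of_real flip: of_real_diff)
  also have "\<dots> \<le> \<bar>x - y\<bar> * ((2 * a + L + 2)\<^sup>2 + a\<^sup>2)"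
    by (intro mult_left_mono norm_square_diff_le pastur_upper_root_bounded[OF w(1) pos assms(1,3)]) auto
  also have "\<dots> \<le> m ^ 3" by (rule small)
  finally obtain r where r: "pastur_cubic a (of_real y) r = 0" "cmod (w - r) \<le> m"
    using pastur_cubic_near_root assms(4) by blast
  have "Im w - Im r \<le> m" using abs_Im_le_cmod[of "w - r"] r(2) by simp
  then show ?thesis using pastur_root_Im_le[OF r(1)] w(2) by linarith
next
  case False
  then show ?thesis using pastur_density_nonneg[of a x] pastur_density_nonneg[of a y] assms(4) by simp
qed

lemma continuous_pastur_density:
  assumes "a \<ge> 1"
  shows "continuous_on UNIV (pastur_density a)"
proof -
  have "isCont (\<lambda>x. pi * pastur_density a x) x" for x
    unfolding continuous_at_eps_delta
  proof (intro allI impI)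
    fix e :: real assume e: "e > 0"
    define L where "L = \<bar>x\<bar> + 1"
    define C where "C = (2 * a + L + 2)\<^sup>2 + a\<^sup>2"
    have C: "C > 0" using assms unfolding C_def by (simp add: add_nonneg_pos)
    define d where "d = min 1 ((e / 2) ^ 3 / C)"
    have "d > 0" using C e unfolding d_def by simp
    moreover have "dist (pi * pastur_density a y) (pi * pastur_density a x) < e" if "dist y x < d" for y
    proof -
      have y: "\<bar>y\<bar> \<le> L" "\<bar>x\<bar> \<le> L" using that unfolding d_def L_def dist_real_def by auto
      have "\<bar>x - y\<bar> \<le> (e / 2) ^ 3 / C" using that unfolding d_def dist_real_def by auto
      then have le: "\<bar>x - y\<bar> * C \<le> (e / 2) ^ 3" using C by (simp add: pos_le_divide_eq)
      have "pi * pastur_density a x \<le> pi * pastur_density a y + e / 2"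
        using le e unfolding C_def by (intro pastur_density_holder[OF y(2,1) assms]) auto
      moreover have "pi * pastur_density a y \<le> pi * pastur_density a x + e / 2"
        using le e unfolding C_def by (intro pastur_density_holder[OF y(1,2) assms]) (auto simp: abs_minus_commute)
      ultimately show ?thesis using e unfolding dist_real_def by linarith
    qed
    ultimately show "\<exists>d>0. \<forall>y. dist y x < d \<longrightarrow> dist (pi * pastur_density a y) (pi * pastur_density a x) < e" by blast
  qed
  then have c: "continuous_on UNIV (\<lambda>x. pi * pastur_density a x)"
    by (simp add: continuous_at_imp_continuous_on)
  have "continuous_on UNIV (\<lambda>x. (1 / pi) * (pi * pastur_density a x))"
    by (rule continuous_on_mult[OF continuous_on_const c])
  then show ?thesis by simp
qed

lemma pastur_density_outside:
  assumes "L \<ge> 4 * a" "L \<ge> 4" "a > 0" "\<bar>x\<bar> \<ge> L"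
  shows "pi * pastur_density a x \<le> 4 / L"
proof (cases "pastur_density a x > 0")
  case True
  then obtain w where w: "pastur_cubic a (of_real x) w = 0" "Im w = pi * pastur_density a x"
    by (rule pastur_density_pos_root)
  then have pos: "Im w > 0" using True by simp
  show ?thesis
    using approx_root_outside[of a L "of_real x" 0 w] assms pastur_upper_root_fixpoint[OF w(1) pos] w(2) by simp
next
  case False
  then show ?thesis using pastur_density_nonneg[of a x] assms(2) by simp
qed

text \<open>
  All estimates are made for the cubic at the real point \<open>E\<close>. Along the lower part \<open>y \<le> t\<close> of the segment
  \<open>w(y)\<close> lies within \<open>m\<close> of a root at \<open>E\<close>. If \<open>\<pi> \<rho>(E)\<close> is small, every root has small imaginary part and nothing
  more has to be shown. Otherwise the roots are \<open>w\<^sub>0\<close>, its conjugate and a real one, so that \<open>Im w(y)\<close> is either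
  close to \<open>Im w\<^sub>0\<close> or at most \<open>m\<close>; by continuity the alternative is decided at \<open>y = t\<close>. There the error \<open>k\<close> is
  smaller than the height, so \<open>w(t)\<close> is the exact solution for a parameter in the open upper half plane, and
  uniqueness identifies it with the root near \<open>w\<^sub>0\<close>.
\<close>

lemma stability_inside:
  fixes w :: "real \<Rightarrow> complex"
  assumes a: "a \<ge> 1" and E: "\<bar>E\<bar> \<le> L" and t: "0 < t0" "t0 \<le> t" "t \<le> 1" and m: "m > 0"
    and k: "0 < k" "k < t" "k < 1 / (2 * (a + L + 5))"
    and small: "2 * t * ((2 * a + L + 3)\<^sup>2 + a\<^sup>2) \<le> m ^ 3"
    and cont: "continuous_on {t0..1} w"
    and pos: "\<And>y. y \<in> {t0..1} \<Longrightarrow> Im (w y) > y"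
    and approx: "\<And>y. y \<in> {t0..1} \<Longrightarrow> k \<le> cmod (w y - of_real a) \<Longrightarrow> k \<le> cmod (w y + of_real a) \<Longrightarrow>
       cmod (w y - Complex E y - source_stieltjes a (w y)) \<le> k"
  shows "\<bar>Im (w t0) - pi * pastur_density a E\<bar> \<le> 4 * m"
proof -
  have k1: "k \<le> 1" using k t by simp
  have ip: "Im (w y) > 0" if "y \<in> {t0..1}" for y using pos[OF that] that t by simp
  have zL: "cmod (Complex E y) \<le> L + 1" if "y \<in> {t0..1}" for y
    using cmod_le[of "Complex E y"] that t E by simp
  define d where "d y = min (cmod (w y - of_real a)) (cmod (w y + of_real a))" for y
  have dcont: "continuous_on {t0..1} d" unfolding d_def by (intro continuous_intros cont)
  \<comment> \<open>Height 1 keeps the top end away from the poles, and a curve coming near a pole lower down would pass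
    through distance exactly k, which the pole gap forbids.\<close>
  have far: "k \<le> d y" if y: "y \<in> {t0..1}" for y
  proof (rule ccontr)
    assume "\<not> k \<le> d y"
    then have 1: "d y \<le> k" by simp
    have "Im (w 1) > 1" using pos[of 1] t by simp
    then have "cmod (w 1 - of_real a) \<ge> 1" "cmod (w 1 + of_real a) \<ge> 1"
      using abs_Im_le_cmod[of "w 1 - of_real a"] abs_Im_le_cmod[of "w 1 + of_real a"] by auto
    then have 2: "k \<le> d 1" using k1 unfolding d_def by simp
    have "continuous_on {y..1} d" using y by (intro continuous_on_subset[OF dcont]) auto
    then obtain u where u: "y \<le> u" "u \<le> 1" "d u = k" using IVT'[of d y k 1, OF 1 2] y by auto
    then have ui: "u \<in> {t0..1}" using y by simp
    have "cmod (w u - Complex E u - source_stieltjes a (w u)) \<le> 1"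
      using approx[OF ui] u(3) k1 unfolding d_def by (simp add: min_def split: if_splits)
    from approx_root_pole_gap[OF this zL[OF ui] a ip[OF ui]]
    have "1 / (2 * (a + (L + 1) + 4)) \<le> d u" unfolding d_def by simp
    then show False using u(3) k(3) by (simp add: add.assoc)
  qed
  have app: "cmod (w y - Complex E y - source_stieltjes a (w y)) \<le> k" if "y \<in> {t0..1}" for y
    using approx[OF that] far[OF that] unfolding d_def by simp
  define R where "R = 2 * a + L + 3"
  have wR: "cmod (w y) \<le> R" if y: "y \<in> {t0..1}" for y
    using approx_root_bounded[OF order_trans[OF app[OF y] k1] zL[OF y] a] unfolding R_def by simp
  have root: "\<exists>r. pastur_cubic a (of_real E) r = 0 \<and> cmod (w y - r) \<le> m" if y: "y \<in> {t0..t}" for y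
  proof -
    have yi: "y \<in> {t0..1}" using y t by auto
    have "Complex E y = of_real E + \<i> * of_real y" by (simp add: complex_eq_iff)
    then have eq: "w y - of_real E - source_stieltjes a (w y)
        = (w y - Complex E y - source_stieltjes a (w y)) + \<i> * of_real y" by simp
    have "cmod (w y - of_real E - source_stieltjes a (w y)) \<le> k + y"
      unfolding eq using norm_triangle_ineq[of "w y - Complex E y - source_stieltjes a (w y)" "\<i> * of_real y"] app[OF yi] y t
      by (simp add: norm_mult)
    then have 1: "cmod (w y - of_real E - source_stieltjes a (w y)) \<le> 2 * t" using y k by auto
    have "cmod (pastur_cubic a (of_real E) (w y)) = cmod ((w y)\<^sup>2 - of_real (a\<^sup>2)) * cmod (w y - of_real E - source_stieltjes a (w y))"
      by (subst pastur_cubic_eq) (use Im_pos_neq_real[OF ip[OF yi]] in \<open>auto simp: norm_mult\<close>)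
    also have "\<dots> \<le> (R\<^sup>2 + a\<^sup>2) * (2 * t)"
      by (intro mult_mono 1 norm_square_diff_le wR yi) auto
    also have "\<dots> \<le> m ^ 3" using small unfolding R_def by (simp add: mult.commute)
    finally show ?thesis using pastur_cubic_near_root m by (metis less_imp_le)
  qed
  show ?thesis
  proof (cases "pi * pastur_density a E \<le> 3 * m")
    case True
    obtain r where r: "pastur_cubic a (of_real E) r = 0" "cmod (w t0 - r) \<le> m" using root[of t0] t by auto
    have "Im (w t0) \<le> Im r + m" using abs_Im_le_cmod[of "w t0 - r"] r(2) by simp
    then have "Im (w t0) \<le> 4 * m" using pastur_root_Im_le[OF r(1)] True by linarith
    moreover have "Im (w t0) > 0" using ip[of t0] t by simp
    moreover have "pi * pastur_density a E \<ge> 0" using pastur_density_nonneg[of a E] by simp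
    ultimately show ?thesis using True m by linarith
  next
    case False
    then have "pastur_density a E > 0" using m by (smt (verit) pi_gt_zero mult_nonneg_nonpos zero_le_mult_iff)
    then obtain w0 where w0: "pastur_cubic a (of_real E) w0 = 0" "Im w0 = pi * pastur_density a E"
      by (rule pastur_density_pos_root)
    have y: "Im w0 > 3 * m" using False w0(2) by simp
    \<comment> \<open>The conjugate of w0 is excluded because w stays in the upper half plane.\<close>
  have dich: "\<bar>Im (w u) - Im w0\<bar> \<le> m \<or> Im (w u) \<le> m" if u: "u \<in> {t0..t}" for u
    proof -
      obtain r where r: "pastur_cubic a (of_real E) r = 0" "cmod (w u - r) \<le> m" using root[OF u] by blast
      have *: "\<bar>Im (w u) - Im r\<bar> \<le> m" using abs_Im_le_cmod[of "w u - r"] r(2) by simp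
      have "r = w0 \<or> r = cnj w0 \<or> Im r = 0" using pastur_nonreal_roots[OF w0(1) _ r(1)] y m by simp
      then show ?thesis using * y m by auto
    qed
    have ti: "t \<in> {t0..1}" using t by simp
    have top: "cmod (w t - w0) \<le> m"
    proof -
      \<comment> \<open>The parameter for which w t is an exact solution.\<close>
      define \<zeta> where "\<zeta> = w t - source_stieltjes a (w t)"
      have d\<zeta>: "cmod (\<zeta> - Complex E t) \<le> k" using app[OF ti] unfolding \<zeta>_def by (simp add: algebra_simps)
      then have I\<zeta>: "Im \<zeta> > 0" using abs_Im_le_cmod[of "\<zeta> - Complex E t"] k(2) by simp
      have c0: "pastur_cubic a \<zeta> (w t) = 0"
        by (subst pastur_cubic_eq) (use Im_pos_neq_real[OF ip[OF ti]] in \<open>auto simp: \<zeta>_def\<close>)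
      have "cmod (of_real E - \<zeta>) \<le> 2 * t"
      proof -
        have "of_real E - \<zeta> = - (\<zeta> - Complex E t) - \<i> * of_real t" by (simp add: complex_eq_iff)
        then have "cmod (of_real E - \<zeta>) \<le> cmod (\<zeta> - Complex E t) + cmod (\<i> * of_real t)"
          using norm_triangle_ineq4[of "- (\<zeta> - Complex E t)" "\<i> * of_real t"] by (simp only: norm_minus_cancel)
        then show ?thesis using d\<zeta> k t by (simp add: norm_mult)
      qed
      moreover have "cmod w0 \<le> R" using pastur_upper_root_bounded[OF w0(1) _ E a] y m unfolding R_def by simp
      ultimately have "cmod (of_real E - \<zeta>) * cmod (w0\<^sup>2 - of_real (a\<^sup>2)) \<le> 2 * t * (R\<^sup>2 + a\<^sup>2)"
        using t by (intro mult_mono norm_square_diff_le) auto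
      also have "\<dots> \<le> m ^ 3" using small unfolding R_def .
      finally have "cmod (pastur_cubic a \<zeta> w0) \<le> m ^ 3"
        using pastur_cubic_shift[of a \<zeta> w0 "of_real E"] w0(1) by (simp add: norm_mult)
      then obtain r where r: "pastur_cubic a \<zeta> r = 0" "cmod (w0 - r) \<le> m"
        using pastur_cubic_near_root m by (metis less_imp_le)
      have "Im r > 0" using abs_Im_le_cmod[of "w0 - r"] r(2) y m by simp
      then have "r = w t" using upper_root_unique[OF I\<zeta> _ ip[OF ti] r(1) c0] by simp
      then show ?thesis using r(2) by (simp add: norm_minus_commute)
    qed
    have It: "Im (w t) \<ge> 2 * m" using abs_Im_le_cmod[of "w t - w0"] top y by simp
    have "\<not> Im (w t0) \<le> m"
    proof
      assume 1: "Im (w t0) \<le> m"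
      have "continuous_on {t0..t} (\<lambda>u. Im (w u))"
        using t by (intro continuous_intros continuous_on_subset[OF cont]) auto
      then obtain u where u: "t0 \<le> u" "u \<le> t" "Im (w u) = 2 * m"
        using IVT'[of "\<lambda>u. Im (w u)" t0 "2 * m" t] 1 It m t by auto
      then show False using dich[of u] y m by auto
    qed
    then have "\<bar>Im (w t0) - Im w0\<bar> \<le> m" using dich[of t0] t by auto
    then show ?thesis using w0(2) m by linarith
  qed
qed

text \<open>
  The equation is assumed along a curve over a vertical segment that reaches height \<open>1\<close>, since at a single
  point near the real axis the wrong root also solves it. It is assumed at distance \<open>k\<close> from the poles of \<open>F\<close>
  only, because the random error is amplified near them.
\<close>

definition pastur_stable :: "real \<Rightarrow> real \<Rightarrow> real \<Rightarrow> real \<Rightarrow> bool" where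
  "pastur_stable a e k t \<longleftrightarrow> (\<forall>E t0 w. 0 < t0 \<longrightarrow> t0 \<le> t \<longrightarrow> continuous_on {t0..1} w \<longrightarrow>
       (\<forall>y\<in>{t0..1}. Im (w y) > y) \<longrightarrow>
       (\<forall>y\<in>{t0..1}. k \<le> cmod (w y - of_real a) \<longrightarrow> k \<le> cmod (w y + of_real a) \<longrightarrow>
          cmod (w y - Complex E y - source_stieltjes a (w y)) \<le> k) \<longrightarrow>
       \<bar>(Im (w t0) - t0) - pi * pastur_density a E\<bar> \<le> e)"

text \<open>
  Bounded \<open>E\<close> are covered by \<open>stability_inside\<close> and large \<open>E\<close> by \<open>approx_root_outside\<close>, so the tolerance \<open>k\<close>
  and the height \<open>t\<close> do not depend on \<open>E\<close>.
\<close>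

theorem pastur_stability:
  assumes a: "a > 1" and e: "e > 0"
  obtains k t where "0 < k" "k \<le> 1" "0 < t" "t \<le> 1" "pastur_stable a e k t"
proof -
  define L where "L = max (max (4 * a) 4) (16 / e)"
  have L: "L \<ge> 4 * a" "L \<ge> 4" "4 / L \<le> e / 4"
  proof -
    have "16 / e \<le> L" "L > 0" unfolding L_def by auto
    then show "4 / L \<le> e / 4" using e by (simp add: field_simps)
  qed (auto simp: L_def)
  define m where "m = e / 8"
  define C where "C = (2 * a + L + 3)\<^sup>2 + a\<^sup>2"
  have C: "C > 0" using a unfolding C_def by (simp add: add_nonneg_pos)
  define t where "t = Min {1, e / 4, m ^ 3 / (2 * C)}"
  have t: "t > 0" "t \<le> 1" "t \<le> e / 4" "t \<le> m ^ 3 / (2 * C)"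
    using e C unfolding t_def m_def by auto
  define k where "k = min (t / 2) (1 / (4 * (a + L + 5)))"
  have aL: "a + L + 5 > 0" using a L by linarith
  have "1 / (4 * (a + L + 5)) < 1 / (2 * (a + L + 5))" using aL by (simp add: field_simps)
  then have k: "0 < k" "k < t" "k < 1 / (2 * (a + L + 5))" "k \<le> e / 4" "k \<le> 1"
    using t aL unfolding k_def by auto
  have small: "2 * t * ((2 * a + L + 3)\<^sup>2 + a\<^sup>2) \<le> m ^ 3"
    using t(4) C unfolding C_def[symmetric] by (simp add: pos_le_divide_eq mult.commute mult.left_commute)
  have "\<bar>(Im (w t0) - t0) - pi * pastur_density a E\<bar> \<le> e"
    if t0: "0 < t0" "t0 \<le> t" and cont: "continuous_on {t0..1} w"
    and pos: "\<And>y. y \<in> {t0..1} \<Longrightarrow> Im (w y) > y"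
    and app: "\<And>y. y \<in> {t0..1} \<Longrightarrow> k \<le> cmod (w y - of_real a) \<Longrightarrow> k \<le> cmod (w y + of_real a) \<Longrightarrow>
          cmod (w y - Complex E y - source_stieltjes a (w y)) \<le> k"
    for E t0 w
  proof (cases "\<bar>E\<bar> \<le> L")
    case True
    have "\<bar>Im (w t0) - pi * pastur_density a E\<bar> \<le> 4 * m"
      by (rule stability_inside[OF _ True t0 t(2) _ k(1-3) small cont pos app]) (use a e in \<open>auto simp: m_def\<close>)
    then show ?thesis using t0 t(3) unfolding m_def by linarith
  next
    case False
    have i: "t0 \<in> {t0..1}" using t0 t by simp
    have "Im (w t0) - t0 \<le> e"
    proof (cases "k \<le> cmod (w t0 - of_real a) \<and> k \<le> cmod (w t0 + of_real a)")
      case True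
      then have "Im (w t0) \<le> Im (Complex E t0) + k + 4 / L"
        using app[OF i] a False t0 k
        by (intro approx_root_outside[OF L(1,2)]) auto
      then show ?thesis using k(4) L(3) t(3) t0 e by simp
    next
      case False
      then have "Im (w t0) \<le> k"
        using abs_Im_le_cmod[of "w t0 - of_real a"] abs_Im_le_cmod[of "w t0 + of_real a"] by auto
      then show ?thesis using k(4) t0 e by simp
    qed
    moreover have "pi * pastur_density a E \<le> e"
      using pastur_density_outside[OF L(1,2), of E] a False L(3) e by simp
    moreover have "pi * pastur_density a E \<ge> 0" using pastur_density_nonneg[of a E] by simp
    ultimately show ?thesis using pos[OF i] by simp
  qed
  then have "pastur_stable a e k t" unfolding pastur_stable_def by simp
  then show ?thesis using that[of k t] k(1,5) t(1,2) by simp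
qed

section \<open>Counting points with Poisson kernels\<close>

lemma is_interval_bounded_sandwich:
  fixes I :: "real set"
  assumes "is_interval I" "bounded I" "I \<noteq> {}"
  shows "{Inf I<..<Sup I} \<subseteq> I" "I \<subseteq> {Inf I..Sup I}" "Inf I \<le> Sup I"
proof -
  have b: "bdd_above I" "bdd_below I" using assms(2) by (auto simp: bounded_imp_bdd_above bounded_imp_bdd_below)
  show "I \<subseteq> {Inf I..Sup I}" using b by (auto intro: cInf_lower cSup_upper)
  show "{Inf I<..<Sup I} \<subseteq> I"
  proof
    fix x assume "x \<in> {Inf I<..<Sup I}"
    then obtain u v where "u \<in> I" "u < x" "v \<in> I" "x < v"
      using cInf_less_iff[OF assms(3) b(2)] less_cSup_iff[OF assms(3) b(1)] by auto
    then show "x \<in> I" using assms(1) by (meson is_interval_1 less_imp_le)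
  qed
  show "Inf I \<le> Sup I" using assms(3) b by (rule cInf_le_cSup)
qed

definition poisson :: "real \<Rightarrow> real \<Rightarrow> real" where
  "poisson y x = y / (x\<^sup>2 + y\<^sup>2)"

lemma poisson_nonneg: "y \<ge> 0 \<Longrightarrow> poisson y x \<ge> 0"
  by (simp add: poisson_def)

lemma continuous_on_poisson: "y > 0 \<Longrightarrow> continuous_on S (\<lambda>E. poisson y (v - E))"
  unfolding poisson_def
  by (intro continuous_intros) (auto simp: add_nonneg_eq_0_iff sum_power2_gt_zero_iff less_le)

lemma poisson_integral:
  assumes "y > 0" "l \<le> u"
  shows "((\<lambda>E. poisson y (v - E)) has_integral (arctan ((u - v) / y) - arctan ((l - v) / y))) {l..u}"
proof -
  have "((\<lambda>E. arctan ((E - v) / y)) has_vector_derivative poisson y (v - E)) (at E within {l..u})" for E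
  proof -
    have "((\<lambda>E. arctan ((E - v) / y)) has_real_derivative (1 / (1 + ((E - v) / y)\<^sup>2)) * (1 / y)) (at E within {l..u})"
      using assms(1) by (auto intro!: derivative_eq_intros simp: field_simps)
    moreover have "(1 / (1 + ((E - v) / y)\<^sup>2)) * (1 / y) = poisson y (v - E)"
    proof -
      have "1 + ((E - v) / y)\<^sup>2 = ((v - E)\<^sup>2 + y\<^sup>2) / y\<^sup>2"
        using assms(1) by (simp add: field_simps power2_commute)
      then show ?thesis unfolding poisson_def using assms(1) by (simp add: power2_eq_square)
    qed
    ultimately show ?thesis by (simp add: has_real_derivative_iff_has_vector_derivative)
  qed
  then show ?thesis using assms(2) by (intro fundamental_theorem_of_calculus) auto
qed

lemma arctan_ge:
  assumes "x > 0"
  shows "arctan x \<ge> pi / 2 - 1 / x"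
proof -
  have "arctan (1 / x) \<le> 1 / x" using abs_arctan_le[of "1 / x"] assms by simp
  then show ?thesis using arctan_inverse[of "x"] assms by (simp add: inverse_eq_divide)
qed

lemma poisson_integral_le:
  assumes "y > 0" "l \<le> u"
  shows "integral {l..u} (\<lambda>E. poisson y (v - E)) \<le> pi"
  using integral_unique[OF poisson_integral[OF assms, of v]]
    arctan_bounded[of "(u - v) / y"] arctan_bounded[of "(l - v) / y"] by simp

lemma poisson_integral_ge:
  assumes "y > 0" "l + d \<le> v" "v + d \<le> u" "d > 0"
  shows "integral {l..u} (\<lambda>E. poisson y (v - E)) \<ge> pi - 2 * (y / d)"
proof -
  have "arctan (d / y) \<le> arctan ((u - v) / y)" "arctan (d / y) \<le> arctan ((v - l) / y)"
    using assms by (auto intro!: arctan_monotone' divide_right_mono)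
  moreover have "arctan ((l - v) / y) = - arctan ((v - l) / y)"
    by (metis arctan_minus minus_diff_eq minus_divide_left)
  moreover have "arctan (d / y) \<ge> pi / 2 - y / d" using arctan_ge[of "d / y"] assms by simp
  ultimately show ?thesis
    using integral_unique[OF poisson_integral[OF assms(1), of l u v]] assms by simp
qed

text \<open>
  For \<open>v\<close> outside the interval and \<open>E\<close> in the interval shrunk by \<open>\<tau>\<close> on both sides, \<open>|v - E|\<close> is at least \<open>2\<tau>\<close>
  times the distance of \<open>v\<close> to the midpoint. Thus a narrow Poisson kernel is dominated by a small multiple of
  the kernel of width \<open>(u - l)/2\<close> at the midpoint, and one value of the Stieltjes transform controls the
  contribution of all far points.
\<close>

lemma poisson_far:
  assumes y: "y > 0" and ln: "l < u" and tau: "0 < \<tau>" "\<tau> < 1 / 2"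
    and v: "v \<notin> {l<..<u}" and E: "E \<in> {l + \<tau> * (u - l)..u - \<tau> * (u - l)}"
  shows "poisson y (v - E) \<le> y / (\<tau>\<^sup>2 * (u - l)) * poisson ((u - l) / 2) (v - (l + u) / 2)"
proof -
  define h where "h = (u - l) / 2"
  define d where "d = \<bar>v - (l + u) / 2\<bar>"
  have h: "h > 0" using ln unfolding h_def by simp
  have dh: "d \<ge> h" using v unfolding d_def h_def by (auto simp: abs_if field_simps)
  have "\<bar>E - (l + u) / 2\<bar> \<le> h - 2 * \<tau> * h"
  proof -
    define s where "s = \<tau> * (u - l)"
    have "h - 2 * \<tau> * h = (u - l) / 2 - s" unfolding h_def s_def by (simp add: field_simps)
    moreover have "l + s \<le> E" "E \<le> u - s" using E unfolding s_def by auto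
    ultimately show ?thesis by (simp add: abs_le_iff) argo
  qed
  then have "\<bar>v - E\<bar> \<ge> d - (1 - 2 * \<tau>) * h" unfolding d_def by (simp add: algebra_simps)
  moreover have "(1 - 2 * \<tau>) * h \<le> (1 - 2 * \<tau>) * d" using dh tau by (intro mult_left_mono) auto
  ultimately have ge: "\<bar>v - E\<bar> \<ge> 2 * \<tau> * d" by (simp add: algebra_simps)
  have dpos: "d > 0" using dh h by simp
  have sq: "(2 * \<tau> * d)\<^sup>2 \<le> (v - E)\<^sup>2"
    using ge tau dpos by (metis power2_abs power_mono mult_nonneg_nonneg less_imp_le zero_le_numeral)
  have hd: "h\<^sup>2 \<le> d\<^sup>2" using dh h by (intro power_mono) auto
  have "2 * \<tau>\<^sup>2 * (d\<^sup>2 + h\<^sup>2) \<le> 2 * \<tau>\<^sup>2 * (d\<^sup>2 + d\<^sup>2)"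
    using hd by (intro mult_left_mono) auto
  also have "\<dots> = (2 * \<tau> * d)\<^sup>2" by (simp add: power_mult_distrib)
  also have "\<dots> \<le> (v - E)\<^sup>2 + y\<^sup>2" using sq zero_le_power2[of y] by linarith
  finally have den: "2 * \<tau>\<^sup>2 * (d\<^sup>2 + h\<^sup>2) \<le> (v - E)\<^sup>2 + y\<^sup>2" .
  have pos: "2 * \<tau>\<^sup>2 * (d\<^sup>2 + h\<^sup>2) > 0" using tau dpos h by (simp add: add_pos_pos)
  have "poisson y (v - E) \<le> y / (2 * \<tau>\<^sup>2 * (d\<^sup>2 + h\<^sup>2))"
    unfolding poisson_def
    by (rule divide_left_mono[OF den less_imp_le[OF y] mult_pos_pos[OF less_le_trans[OF pos den] pos]])
  also have "\<dots> = y / (\<tau>\<^sup>2 * (2 * h)) * (h / (d\<^sup>2 + h\<^sup>2))"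
  proof -
    have "y / (2 * T * D) = y / (T * (2 * h)) * (h / D)" for T D using h by simp
    then show ?thesis by blast
  qed
  also have "\<dots> = y / (\<tau>\<^sup>2 * (u - l)) * poisson h (v - (l + u) / 2)"
  proof -
    have "poisson h (v - (l + u) / 2) = h / (d\<^sup>2 + h\<^sup>2)" unfolding poisson_def d_def by simp
    moreover have "2 * h = u - l" unfolding h_def by simp
    ultimately show ?thesis by simp
  qed
  finally show ?thesis unfolding h_def .
qed

text \<open>
  Up to the factor \<open>\<pi>\<close>, the integral of the narrow kernels over a slightly enlarged interval is almost \<open>1\<close> at
  each point of \<open>I\<close>, which gives the upper bound; over a slightly shrunk interval it is at most \<open>1\<close> on \<open>I\<close> and
  small outside by \<open>poisson_far\<close>, which gives the lower bound. Both integrals are compared with \<open>q\<close> through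
  the assumed closeness.
\<close>

theorem poisson_counting:
  fixes lam :: "nat \<Rightarrow> real"
  assumes y: "y > 0" and ln: "l < u" and tau: "0 < \<tau>" "\<tau> < 1 / 2"
    and I: "{l<..<u} \<subseteq> I" "I \<subseteq> {l..u}"
    and q: "continuous_on UNIV q" "\<And>x. 0 \<le> q x" "\<And>x. q x \<le> 1"
    and e: "0 \<le> e" "e \<le> 1"
    and close: "\<And>E. E \<in> {l - \<tau> * (u - l)..u + \<tau> * (u - l)} \<Longrightarrow>
        \<bar>(\<Sum>i<n. poisson y (lam i - E)) - real n * (pi * q E)\<bar> \<le> e * real n"
    and mid: "(\<Sum>i<n. poisson ((u - l) / 2) (lam i - (l + u) / 2)) \<le> 2 * real n"
    and ysmall: "y / (\<tau>\<^sup>2 * (u - l)) \<le> 1 / 2"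
  shows "\<bar>real (card {i. i < n \<and> lam i \<in> I}) - real n * integral {l..u} q\<bar>
     \<le> (2 * \<tau> + e + 7 * (y / (\<tau>\<^sup>2 * (u - l)))) * (real n * (u - l))"
proof -
  define len where "len = u - l"
  define g where "g = y / (\<tau>\<^sup>2 * len)"
  define N where "N = real (card {i. i < n \<and> lam i \<in> I})"
  have len: "len > 0" using ln unfolding len_def by simp
  have g: "0 < g" "g \<le> 1 / 2" using y len tau ysmall unfolding g_def len_def by auto
  have tl: "\<tau> * len > 0" "\<tau> * len < len / 2" using tau len by (simp_all add: field_simps)
  have qi: "q integrable_on {b..c}" for b c
    by (intro integrable_continuous_interval continuous_on_subset[OF q(1)]) auto
  have pint: "(\<lambda>E. poisson y (v - E)) integrable_on {b..c}" for v b c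
    by (intro integrable_continuous_interval continuous_on_poisson y)
  have sint: "(\<lambda>E. \<Sum>i<n. poisson y (lam i - E)) integrable_on {b..c}" for b c
    by (intro integrable_sum pint) auto
  have sumint: "integral {b..c} (\<lambda>E. \<Sum>i<n. poisson y (lam i - E)) = (\<Sum>i<n. integral {b..c} (\<lambda>E. poisson y (lam i - E)))" for b c
    by (intro integral_sum pint) auto
  have qle: "integral {b..c} q \<le> c - b" if "b \<le> c" for b c
    using integral_le[OF qi integrable_const_ivl, of b c 1] q(3) that by simp
  have qsplit: "integral {b..c} q + integral {c..d} q = integral {b..d} q" if "b \<le> c" "c \<le> d" for b c d
    by (rule Henstock_Kurzweil_Integration.integral_combine[OF that qi])
  have pi1: "2 \<le> pi" using pi_ge_two .
  let ?b = "l - \<tau> * len" and ?c = "u + \<tau> * len"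
  have "N * (pi - 2 * (y / (\<tau> * len))) = (\<Sum>i | i < n \<and> lam i \<in> I. pi - 2 * (y / (\<tau> * len)))"
    unfolding N_def by simp
  also have "\<dots> \<le> (\<Sum>i | i < n \<and> lam i \<in> I. integral {?b..?c} (\<lambda>E. poisson y (lam i - E)))"
    by (intro sum_mono poisson_integral_ge y tl(1)) (use I in auto)
  also have "\<dots> \<le> (\<Sum>i<n. integral {?b..?c} (\<lambda>E. poisson y (lam i - E)))"
    by (intro sum_mono2 integral_nonneg pint poisson_nonneg) (use y in auto)
  also have "\<dots> = integral {?b..?c} (\<lambda>E. \<Sum>i<n. poisson y (lam i - E))" by (rule sumint[symmetric])
  also have "\<dots> \<le> integral {?b..?c} (\<lambda>E. real n * pi * q E + e * real n)"
  proof (rule integral_le[OF sint])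
    show "(\<lambda>E. real n * pi * q E + e * real n) integrable_on {?b..?c}"
      by (intro integrable_add integrable_on_mult_right qi integrable_const_ivl)
    show "(\<Sum>i<n. poisson y (lam i - E)) \<le> real n * pi * q E + e * real n" if "E \<in> {?b..?c}" for E
      using close[of E] that unfolding len_def by (simp add: abs_le_iff)
  qed
  also have "\<dots> = real n * pi * integral {?b..?c} q + e * real n * (?c - ?b)"
    using tl len by (subst Henstock_Kurzweil_Integration.integral_add) (auto intro!: integrable_on_mult_right qi integrable_const_ivl simp: len_def)
  also have "integral {?b..?c} q \<le> integral {l..u} q + 2 * (\<tau> * len)"
    using qsplit[of ?b l ?c] qsplit[of l u ?c] qle[of ?b l] qle[of u ?c] ln tl by simp
  finally have up1: "N * (pi - 2 * (y / (\<tau> * len))) \<le> real n * pi * (integral {l..u} q + 2 * (\<tau> * len)) + e * real n * (?c - ?b)"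
    by (simp add: mult_left_mono)
  have bg: "y / (\<tau> * len) \<le> g"
  proof -
    have "\<tau>\<^sup>2 * len \<le> \<tau> * len" using tau len by (simp add: power2_eq_square)
    then show ?thesis unfolding g_def using y tau len by (intro divide_left_mono) auto
  qed
  have N0: "N \<ge> 0" unfolding N_def by simp
  have up2: "N * (1 - g) \<le> real n * (integral {l..u} q + 2 * (\<tau> * len)) + e * real n * len"
  proof -
    have "pi * (N * (1 - g)) = N * (pi - pi * g)" by (simp add: algebra_simps)
    also have "\<dots> \<le> N * (pi - 2 * (y / (\<tau> * len)))"
    proof -
      have "2 * (y / (\<tau> * len)) \<le> 2 * g" using bg by simp
      also have "\<dots> \<le> pi * g" using pi1 g by (intro mult_right_mono) auto
      finally show ?thesis using N0 by (intro mult_left_mono) auto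
    qed
    also have "\<dots> \<le> real n * pi * (integral {l..u} q + 2 * (\<tau> * len)) + e * real n * (2 * len)"
    proof -
      have "?c - ?b \<le> 2 * len" using tl unfolding len_def by simp
      then have "e * real n * (?c - ?b) \<le> e * real n * (2 * len)" using e by (intro mult_left_mono) auto
      then show ?thesis using up1 by linarith
    qed
    also have "\<dots> \<le> pi * (real n * (integral {l..u} q + 2 * (\<tau> * len)) + e * real n * len)"
    proof -
      have "2 * (e * real n * len) \<le> pi * (e * real n * len)" using pi1 e len by (intro mult_right_mono) auto
      then show ?thesis by (simp add: algebra_simps)
    qed
    finally show ?thesis by simp
  qed
  have up3: "N \<le> real n * integral {l..u} q + (2 * \<tau> + e + 6 * g) * (real n * len)"
  proof -
    have "N * (1 - g) \<ge> N * (1 / 2)" using g N0 by (intro mult_left_mono) auto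
    moreover have "integral {l..u} q \<le> len" using qle[of l u] ln unfolding len_def by simp
    then have "real n * (integral {l..u} q + 2 * (\<tau> * len)) \<le> real n * (len + len)"
      using tl(2) by (intro mult_left_mono) linarith+
    moreover have "e * real n * len \<le> 1 * real n * len" using e len by (intro mult_right_mono) auto
    ultimately have "N \<le> 6 * (real n * len)" using up2 by (simp add: algebra_simps)
    then have "N * g \<le> 6 * (real n * len) * g" using g by (intro mult_right_mono) auto
    then show ?thesis using up2 by (simp add: algebra_simps)
  qed
  let ?b' = "l + \<tau> * len" and ?c' = "u - \<tau> * len"
  have bc': "?b' \<le> ?c'" using tl unfolding len_def by simp
  have "real n * pi * (integral {l..u} q - 2 * (\<tau> * len)) - e * real n * len
      \<le> real n * pi * integral {?b'..?c'} q - e * real n * (?c' - ?b')"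
  proof -
    have "integral {l..u} q - 2 * (\<tau> * len) \<le> integral {?b'..?c'} q"
      using qsplit[of l ?b' u] qsplit[of ?b' ?c' u] qle[of l ?b'] qle[of ?c' u] bc' tl by simp
    then have "real n * pi * (integral {l..u} q - 2 * (\<tau> * len)) \<le> real n * pi * integral {?b'..?c'} q"
      by (intro mult_left_mono) auto
    moreover have "e * real n * (?c' - ?b') \<le> e * real n * len"
      using e tl unfolding len_def by (intro mult_left_mono) auto
    ultimately show ?thesis by linarith
  qed
  also have "\<dots> = integral {?b'..?c'} (\<lambda>E. real n * pi * q E - e * real n)"
    using bc' by (subst Henstock_Kurzweil_Integration.integral_diff) (auto intro!: integrable_on_mult_right qi integrable_const_ivl)
  also have "\<dots> \<le> integral {?b'..?c'} (\<lambda>E. \<Sum>i<n. poisson y (lam i - E))"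
  proof (rule integral_le[OF _ sint])
    show "(\<lambda>E. real n * pi * q E - e * real n) integrable_on {?b'..?c'}"
      by (intro integrable_diff integrable_on_mult_right qi integrable_const_ivl)
    show "real n * pi * q E - e * real n \<le> (\<Sum>i<n. poisson y (lam i - E))" if "E \<in> {?b'..?c'}" for E
      using close[of E] that tl unfolding len_def by (simp add: abs_le_iff)
  qed
  also have "\<dots> = (\<Sum>i<n. integral {?b'..?c'} (\<lambda>E. poisson y (lam i - E)))" by (rule sumint)
  also have "\<dots> \<le> (\<Sum>i<n. (if lam i \<in> I then pi else 0) + g * len * poisson (len / 2) (lam i - (l + u) / 2))"
  proof (intro sum_mono)
    fix i
    have P0: "poisson (len / 2) (lam i - (l + u) / 2) \<ge> 0" using len by (intro poisson_nonneg) auto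
    show "integral {?b'..?c'} (\<lambda>E. poisson y (lam i - E))
      \<le> (if lam i \<in> I then pi else 0) + g * len * poisson (len / 2) (lam i - (l + u) / 2)"
    proof (cases "lam i \<in> I")
      case True
      then show ?thesis using poisson_integral_le[OF y bc', of "lam i"] P0 g len by (simp add: add_increasing2)
    next
      case False
      then have v: "lam i \<notin> {l<..<u}" using I by auto
      have "integral {?b'..?c'} (\<lambda>E. poisson y (lam i - E)) \<le> integral {?b'..?c'} (\<lambda>E. g * poisson (len / 2) (lam i - (l + u) / 2))"
        using poisson_far[OF y ln tau v] unfolding g_def len_def
        by (intro integral_le pint[unfolded len_def] integrable_const_ivl) auto
      also have "\<dots> = g * poisson (len / 2) (lam i - (l + u) / 2) * (?c' - ?b')" using bc' by simp
      also have "\<dots> \<le> g * poisson (len / 2) (lam i - (l + u) / 2) * len"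
        using P0 g tl unfolding len_def by (intro mult_left_mono) auto
      finally show ?thesis using False by (simp add: algebra_simps)
    qed
  qed
  also have "\<dots> = pi * N + g * len * (\<Sum>i<n. poisson (len / 2) (lam i - (l + u) / 2))"
  proof -
    have "(\<Sum>i<n. if lam i \<in> I then pi else 0) = (\<Sum>i\<in>{i\<in>{..<n}. lam i \<in> I}. pi)"
      by (rule sum.inter_filter[symmetric]) simp
    then show ?thesis unfolding N_def by (simp add: sum.distrib sum_distrib_left)
  qed
  also have "\<dots> \<le> pi * N + g * len * (2 * real n)"
    using mid g len unfolding len_def by (intro add_left_mono mult_left_mono) auto
  finally have lo1: "real n * pi * (integral {l..u} q - 2 * (\<tau> * len)) - e * real n * len \<le> pi * N + g * len * (2 * real n)" .
  have lo2: "real n * integral {l..u} q - (2 * \<tau> + e + g) * (real n * len) \<le> N"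
  proof -
    have "2 * (e * real n * len) \<le> pi * (e * real n * len)" "e * real n * len \<ge> 0" 
      using pi1 e len by (auto intro!: mult_right_mono)
    moreover have "g * len * (2 * real n) \<le> pi * (g * (real n * len))"
    proof -
      have "2 * (g * (real n * len)) \<le> pi * (g * (real n * len))" using pi1 g len by (intro mult_right_mono) auto
      then show ?thesis by (simp add: algebra_simps)
    qed
    ultimately have "pi * (real n * integral {l..u} q - (2 * \<tau> + e + g) * (real n * len)) \<le> pi * N"
      using lo1 by (simp add: algebra_simps)
    then show ?thesis by simp
  qed
  have "g * (real n * len) \<ge> 0" using g len by simp
  then show ?thesis using up3 lo2 g
    unfolding N_def[symmetric] len_def[symmetric] g_def[symmetric] abs_le_iff
    by (auto simp: algebra_simps)
qed

section \<open>Resolvents of Hermitian matrices\<close>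

text \<open>
  Matrices appear as functions of two indices restricted to \<open>{..<n}\<close>: in this form rows and columns
  can be removed without changing dimensions.
\<close>

definition hermitian_on :: "nat \<Rightarrow> (nat \<Rightarrow> nat \<Rightarrow> complex) \<Rightarrow> bool" where
  "hermitian_on n W \<longleftrightarrow> (\<forall>j<n. \<forall>k<n. W k j = cnj (W j k))"

definition is_resolvent :: "nat \<Rightarrow> (nat \<Rightarrow> nat \<Rightarrow> complex) \<Rightarrow> complex \<Rightarrow> (nat \<Rightarrow> nat \<Rightarrow> complex) \<Rightarrow> bool" where
  "is_resolvent n W z G \<longleftrightarrow> (\<forall>j<n. \<forall>k<n.
     (\<Sum>l<n. W j l * G l k) = z * G j k + (if j = k then 1 else 0) \<and>
     (\<Sum>l<n. G j l * W l k) = z * G j k + (if j = k then 1 else 0))"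

lemma cnj_self_Im: "cnj s = s \<Longrightarrow> Im s = 0"
  by (metis Reals_cnj_iff complex_is_Real_iff)

lemma hermitian_onD: "hermitian_on n W \<Longrightarrow> j < n \<Longrightarrow> k < n \<Longrightarrow> cnj (W j k) = W k j"
  by (metis hermitian_on_def)

lemma hermitian_form_real:
  assumes "hermitian_on n W"
  shows "Im (\<Sum>j<n. cnj (v j) * (\<Sum>l<n. W j l * v l)) = 0"
proof -
  let ?s = "\<Sum>j<n. cnj (v j) * (\<Sum>l<n. W j l * v l)"
  have "cnj ?s = (\<Sum>j<n. \<Sum>l<n. v j * (cnj (W j l) * cnj (v l)))"
    by (simp add: sum_distrib_left)
  also have "\<dots> = (\<Sum>l<n. \<Sum>j<n. v j * (cnj (W j l) * cnj (v l)))" by (rule sum.swap)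
  also have "\<dots> = (\<Sum>l<n. \<Sum>j<n. cnj (v l) * (W l j * v j))"
    by (intro sum.cong refl) (simp add: hermitian_onD[OF assms] mult_ac)
  also have "\<dots> = ?s" by (simp add: sum_distrib_left)
  finally show ?thesis by (rule cnj_self_Im)
qed

text \<open>
  If \<open>(W - z) v = u\<close> then \<open>\<langle>u, v\<rangle> = \<langle>Wv, v\<rangle> - cnj z |v|\<^sup>2\<close>, and \<open>\<langle>Wv, v\<rangle>\<close> is real.
\<close>

lemma ward_vector:
  assumes h: "hermitian_on n W" and u: "\<And>j. j < n \<Longrightarrow> (\<Sum>l<n. W j l * v l) = z * v j + u j"
  shows "Im (\<Sum>j<n. cnj (u j) * v j) = Im z * (\<Sum>j<n. (cmod (v j))\<^sup>2)"
proof -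
  define S where "S = (\<Sum>j<n. cnj (v j) * (\<Sum>l<n. W j l * v l))"
  have "S = (\<Sum>j<n. cnj (v j) * (z * v j + u j))" unfolding S_def by (intro sum.cong refl) (simp add: u)
  also have "\<dots> = z * (\<Sum>j<n. of_real ((cmod (v j))\<^sup>2)) + (\<Sum>j<n. cnj (v j) * u j)"
    unfolding sum_distrib_left sum.distrib[symmetric] complex_norm_square
    by (intro sum.cong refl) (simp add: algebra_simps)
  finally have "S = z * of_real (\<Sum>j<n. (cmod (v j))\<^sup>2) + (\<Sum>j<n. cnj (v j) * u j)"
    by (simp only: of_real_sum)
  then have "Im S = Im z * (\<Sum>j<n. (cmod (v j))\<^sup>2) + Im (\<Sum>j<n. cnj (v j) * u j)"
    by (simp only: plus_complex.sel Im_complex_of_real Re_complex_of_real times_complex.sel)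
  moreover have "Im S = 0" unfolding S_def by (rule hermitian_form_real[OF h])
  moreover have "(\<Sum>j<n. cnj (v j) * u j) = cnj (\<Sum>j<n. cnj (u j) * v j)" by (simp add: mult.commute)
  moreover have "Im (\<Sum>j<n. cnj (v j) * u j) = - Im (\<Sum>j<n. cnj (u j) * v j)"
    unfolding \<open>(\<Sum>j<n. cnj (v j) * u j) = cnj (\<Sum>j<n. cnj (u j) * v j)\<close> by (rule cnj.sel(2))
  ultimately show ?thesis by linarith
qed

text \<open>
  The Ward identity: \<open>ward_vector\<close> for a column of the resolvent, where \<open>u\<close> is a unit vector.
\<close>

lemma ward_column:
  assumes h: "hermitian_on n W" and G: "is_resolvent n W z G" and k: "k < n"
  shows "Im (G k k) = Im z * (\<Sum>j<n. (cmod (G j k))\<^sup>2)"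
proof -
  have "Im (\<Sum>j<n. cnj (if j = k then 1 else 0) * G j k) = Im z * (\<Sum>j<n. (cmod (G j k))\<^sup>2)"
    by (rule ward_vector[OF h]) (use G k in \<open>auto simp: is_resolvent_def\<close>)
  moreover have "(\<Sum>j<n. cnj (if j = k then 1 else 0) * G j k) = (\<Sum>j<n. if j = k then G j k else 0)"
    by (intro sum.cong) auto
  ultimately show ?thesis using k by simp
qed

lemma ward_row:
  assumes h: "hermitian_on n W" and G: "is_resolvent n W z G" and k: "k < n"
  shows "Im (G k k) = Im z * (\<Sum>j<n. (cmod (G k j))\<^sup>2)"
proof -
  have "hermitian_on n (\<lambda>j l. W l j)" unfolding hermitian_on_def
    by (simp add: hermitian_onD[OF h])
  moreover have "is_resolvent n (\<lambda>j l. W l j) z (\<lambda>j l. G l j)"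
    unfolding is_resolvent_def
  proof (intro allI impI)
    fix j k assume jk: "j < n" "k < n"
    have "(\<Sum>l<n. W k l * G l j) = z * G k j + (if j = k then 1 else 0)"
      "(\<Sum>l<n. G k l * W l j) = z * G k j + (if j = k then 1 else 0)"
      using G jk unfolding is_resolvent_def by (cases "j = k"; simp)+
    then show "(\<Sum>l<n. W l j * G k l) = z * G k j + (if j = k then 1 else 0) \<and>
        (\<Sum>l<n. G l j * W k l) = z * G k j + (if j = k then 1 else 0)"
      by (simp only: mult.commute[of "W _ j"] mult.commute[of "G _ j"])
  qed
  ultimately show ?thesis using ward_column[of n "\<lambda>j l. W l j" z "\<lambda>j l. G l j" k] k by simp
qed

text \<open>
  The Ward identity bounds the squared norm of a row by \<open>|G\<^sub>k\<^sub>k| / Im z\<close>, and \<open>|G\<^sub>k\<^sub>k|\<close> by that norm.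
\<close>

lemma resolvent_row_bound:
  assumes h: "hermitian_on n W" and G: "is_resolvent n W z G" and k: "k < n" and z: "Im z > 0"
  shows "(\<Sum>j<n. (cmod (G k j))\<^sup>2) \<le> (1 / Im z)\<^sup>2" "(\<Sum>j<n. (cmod (G j k))\<^sup>2) \<le> (1 / Im z)\<^sup>2"
proof -
  define S where "S = (\<Sum>j<n. (cmod (G k j))\<^sup>2)"
  have S: "Im (G k k) = Im z * S" using ward_row[OF h G k] unfolding S_def .
  have S2: "(\<Sum>j<n. (cmod (G j k))\<^sup>2) = S"
    using ward_column[OF h G k] S z by simp
  have "(cmod (G k k))\<^sup>2 \<le> S" unfolding S_def
    using k by (intro member_le_sum) auto
  moreover have "Im z * S \<le> cmod (G k k)" using S abs_Im_le_cmod[of "G k k"] by linarith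
  moreover have "S \<ge> 0" unfolding S_def by (simp add: sum_nonneg)
  ultimately have "(Im z * S)\<^sup>2 \<le> S" using z by (smt (verit) power_mono mult_nonneg_nonneg)
  then have "S * ((Im z)\<^sup>2 * S) \<le> S * 1" by (simp add: power2_eq_square algebra_simps)
  then have "(Im z)\<^sup>2 * S \<le> 1 \<or> S = 0" using \<open>S \<ge> 0\<close> by (metis mult_le_cancel_left_pos order_le_less)
  then have "S \<le> (1 / Im z)\<^sup>2" using z by (auto simp: power_divide field_simps)
  then show "(\<Sum>j<n. (cmod (G k j))\<^sup>2) \<le> (1 / Im z)\<^sup>2" "(\<Sum>j<n. (cmod (G j k))\<^sup>2) \<le> (1 / Im z)\<^sup>2"
    using S2 unfolding S_def by auto
qed

lemma resolvent_diag_Im_pos: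
  assumes h: "hermitian_on n W" and G: "is_resolvent n W z G" and k: "k < n" and z: "Im z > 0"
  shows "Im (G k k) > 0"
proof -
  have "(\<Sum>j<n. (cmod (G j k))\<^sup>2) \<noteq> 0"
  proof
    assume "(\<Sum>j<n. (cmod (G j k))\<^sup>2) = 0"
    then have "G j k = 0" if "j < n" for j using that by (simp add: sum_nonneg_eq_0_iff)
    moreover have "(\<Sum>l<n. W k l * G l k) = z * G k k + 1" using G k by (auto simp: is_resolvent_def)
    ultimately show False using k by simp
  qed
  then have "(\<Sum>j<n. (cmod (G j k))\<^sup>2) > 0" by (metis order_le_less sum_nonneg zero_le_power2)
  then show ?thesis using ward_column[OF h G k] z by simp
qed

lemma resolvent_identity:
  assumes G: "is_resolvent n W z G" and B: "is_resolvent n V z B" and j: "j < n" and k: "k < n"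
  shows "G j k = B j k - (\<Sum>l<n. \<Sum>m<n. B j l * (W l m - V l m) * G m k)"
proof -
  have 1: "(\<Sum>l<n. B j l * (\<Sum>m<n. W l m * G m k)) = z * (\<Sum>l<n. B j l * G l k) + B j k"
  proof -
    have "(\<Sum>l<n. B j l * (\<Sum>m<n. W l m * G m k)) = (\<Sum>l<n. z * (B j l * G l k) + (if l = k then B j l else 0))"
      using G k unfolding is_resolvent_def by (intro sum.cong refl) (auto simp: algebra_simps)
    then show ?thesis using k by (simp add: sum.distrib sum_distrib_left)
  qed
  have 2: "(\<Sum>m<n. (\<Sum>l<n. B j l * V l m) * G m k) = z * (\<Sum>m<n. B j m * G m k) + G j k"
  proof -
    have "(\<Sum>m<n. (\<Sum>l<n. B j l * V l m) * G m k) = (\<Sum>m<n. z * (B j m * G m k) + (if m = j then G m k else 0))"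
      using B j unfolding is_resolvent_def by (intro sum.cong refl) (auto simp: algebra_simps)
    then show ?thesis using j by (simp add: sum.distrib sum_distrib_left)
  qed
  have "(\<Sum>l<n. \<Sum>m<n. B j l * (W l m - V l m) * G m k)
     = (\<Sum>l<n. B j l * (\<Sum>m<n. W l m * G m k)) - (\<Sum>l<n. \<Sum>m<n. B j l * V l m * G m k)"
    unfolding sum_subtractf[symmetric] sum_distrib_left by (intro sum.cong refl) (simp add: algebra_simps)
  also have "(\<Sum>l<n. \<Sum>m<n. B j l * V l m * G m k) = (\<Sum>m<n. (\<Sum>l<n. B j l * V l m) * G m k)"
    by (subst sum.swap) (simp add: sum_distrib_right)
  finally show ?thesis using 1 2 by simp
qed

text \<open>
  In the following context \<open>V\<close> is \<open>W\<close> with the off-diagonal entries of row and column \<open>i\<close> removed. Its resolvent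
  \<open>B\<close> then decouples as well, and on the other indices it is the resolvent of the principal minor.
\<close>

context
  fixes n i :: nat and W V :: "nat \<Rightarrow> nat \<Rightarrow> complex" and z :: complex and G B
  assumes h: "hermitian_on n W" and hV: "hermitian_on n V" and i: "i < n" and z: "Im z > 0"
    and G: "is_resolvent n W z G" and B: "is_resolvent n V z B"
    and V: "\<And>j k. j < n \<Longrightarrow> k < n \<Longrightarrow> j \<noteq> i \<Longrightarrow> k \<noteq> i \<Longrightarrow> V j k = W j k"
    and V0: "\<And>j. j < n \<Longrightarrow> j \<noteq> i \<Longrightarrow> V j i = 0"
begin

text \<open>
  Column \<open>i\<close> of \<open>V\<close> is a multiple of the unit vector, and its diagonal entry is real, hence different from \<open>z\<close>.
\<close>

lemma decoupled_resolvent_zero: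
  assumes j: "j < n" "j \<noteq> i"
  shows "B j i = 0"
proof -
  have "(\<Sum>l<n. B j l * V l i) = z * B j i" using B j i by (auto simp: is_resolvent_def)
  moreover have "(\<Sum>l<n. B j l * V l i) = (\<Sum>l<n. if l = i then B j i * V i i else 0)"
    by (intro sum.cong refl) (auto simp: V0)
  ultimately have "B j i * V i i = z * B j i" using i by simp
  moreover have "V i i \<noteq> z"
  proof -
    have "cnj (V i i) = V i i" using hermitian_onD[OF hV i i] .
    then have "Im (V i i) = 0" by (rule cnj_self_Im)
    then show ?thesis using z by auto
  qed
  ultimately show ?thesis by (metis mult.commute mult_cancel_right)
qed

text \<open>
  The resolvent identity for \<open>W\<close> and \<open>V\<close>: they differ in row and column \<open>i\<close> only, and the terms of row \<open>i\<close>
  are annihilated by \<open>B\<^sub>j\<^sub>i = 0\<close>.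
\<close>

lemma decoupled_expand:
  assumes j: "j < n" "j \<noteq> i" and k: "k < n"
  shows "G j k = B j k - (\<Sum>l\<in>{..<n}-{i}. B j l * W l i) * G i k"
proof -
  have "(\<Sum>l<n. \<Sum>m<n. B j l * (W l m - V l m) * G m k)
     = (\<Sum>l\<in>{..<n}-{i}. \<Sum>m<n. B j l * (W l m - V l m) * G m k)"
    using i by (subst sum.remove[of _ i]) (auto simp: decoupled_resolvent_zero[OF j])
  also have "\<dots> = (\<Sum>l\<in>{..<n}-{i}. B j l * W l i * G i k)"
  proof (intro sum.cong refl)
    fix l assume l: "l \<in> {..<n} - {i}"
    have "(\<Sum>m<n. B j l * (W l m - V l m) * G m k) = (\<Sum>m<n. if m = i then B j l * W l i * G i k else 0)"
      using l by (intro sum.cong refl) (auto simp: V V0)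
    then show "(\<Sum>m<n. B j l * (W l m - V l m) * G m k) = B j l * W l i * G i k" using i by simp
  qed
  finally show ?thesis using resolvent_identity[OF G B j(1) k] by (simp add: sum_distrib_right)
qed

text \<open>
  Row \<open>i\<close> of \<open>(W - z) G = 1\<close>, with the off-diagonal entries of column \<open>i\<close> of \<open>G\<close> taken from
  \<open>decoupled_expand\<close>.
\<close>

lemma schur_complement:
  "1 / G i i = W i i - z - (\<Sum>j\<in>{..<n}-{i}. \<Sum>l\<in>{..<n}-{i}. W i j * B j l * W l i)"
proof -
  have g: "G i i \<noteq> 0" using resolvent_diag_Im_pos[OF h G i z] by auto
  define q where "q j = (\<Sum>l\<in>{..<n}-{i}. B j l * W l i)" for j
  have e: "G j i = - q j * G i i" if "j < n" "j \<noteq> i" for j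
    using decoupled_expand[OF that i] decoupled_resolvent_zero[OF that] unfolding q_def by simp
  have "z * G i i + 1 = (\<Sum>l<n. W i l * G l i)" using G i by (auto simp: is_resolvent_def)
  also have "\<dots> = W i i * G i i + (\<Sum>j\<in>{..<n}-{i}. W i j * G j i)"
    using i by (subst sum.remove[of _ i]) auto
  also have "(\<Sum>j\<in>{..<n}-{i}. W i j * G j i) = (\<Sum>j\<in>{..<n}-{i}. - (W i j * q j) * G i i)"
    by (intro sum.cong refl) (auto simp: e)
  also have "\<dots> = - (\<Sum>j\<in>{..<n}-{i}. W i j * q j) * G i i"
    by (simp add: sum_distrib_right sum_negf)
  finally have "1 = (W i i - z - (\<Sum>j\<in>{..<n}-{i}. W i j * q j)) * G i i" by (simp add: algebra_simps)
  then have "1 / G i i = W i i - z - (\<Sum>j\<in>{..<n}-{i}. W i j * q j)" using g by (metis eq_divide_imp)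
  then show ?thesis unfolding q_def by (simp add: sum_distrib_left mult.assoc)
qed

text \<open>
  \<open>G\<^sub>j\<^sub>j - B\<^sub>j\<^sub>j = G\<^sub>j\<^sub>i G\<^sub>i\<^sub>j / G\<^sub>i\<^sub>i\<close>, so the difference of the traces is a sum of products of entries of row and
  column \<open>i\<close>, which the Ward identity bounds by \<open>|G\<^sub>i\<^sub>i| / Im z\<close>.
\<close>

lemma decoupled_trace:
  "cmod ((\<Sum>j<n. G j j) - (\<Sum>j\<in>{..<n}-{i}. B j j)) \<le> 1 / Im z"
proof -
  have gp: "Im (G i i) > 0" by (rule resolvent_diag_Im_pos[OF h G i z])
  then have g: "G i i \<noteq> 0" by auto
  have e: "G j j - B j j = G j i * G i j / G i i" if "j < n" "j \<noteq> i" for j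
  proof -
    define q where "q = (\<Sum>l\<in>{..<n}-{i}. B j l * W l i)"
    have "G j i = - q * G i i"
      using decoupled_expand[OF that i] decoupled_resolvent_zero[OF that] unfolding q_def by simp
    moreover have "G j j = B j j - q * G i j" using decoupled_expand[OF that that(1)] unfolding q_def .
    ultimately show ?thesis using g by simp
  qed
  have "(\<Sum>j<n. G j j) - (\<Sum>j\<in>{..<n}-{i}. B j j) = G i i + (\<Sum>j\<in>{..<n}-{i}. G j j - B j j)"
    using i by (subst sum.remove[of _ i]) (auto simp: sum_subtractf)
  also have "\<dots> = G i i * G i i / G i i + (\<Sum>j\<in>{..<n}-{i}. G j i * G i j / G i i)"
    using g e by simp
  also have "\<dots> = (\<Sum>j<n. G j i * G i j / G i i)"
    using i by (subst (2) sum.remove[of _ i]) auto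
  also have "\<dots> = (\<Sum>j<n. G j i * G i j) / G i i" by (simp add: sum_divide_distrib)
  finally have eq: "(\<Sum>j<n. G j j) - (\<Sum>j\<in>{..<n}-{i}. B j j) = (\<Sum>j<n. G j i * G i j) / G i i" .
  have "cmod (\<Sum>j<n. G j i * G i j) \<le> (\<Sum>j<n. cmod (G j i) * cmod (G i j))"
    using norm_sum[of "\<lambda>j. G j i * G i j" "{..<n}"] by (simp add: norm_mult)
  also have "\<dots> \<le> (\<Sum>j<n. ((cmod (G j i))\<^sup>2 + (cmod (G i j))\<^sup>2) / 2)"
  proof (intro sum_mono)
    fix j show "cmod (G j i) * cmod (G i j) \<le> ((cmod (G j i))\<^sup>2 + (cmod (G i j))\<^sup>2) / 2"
      using sum_squares_bound[of "cmod (G j i)" "cmod (G i j)"] by simp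
  qed
  also have "\<dots> = ((\<Sum>j<n. (cmod (G j i))\<^sup>2) + (\<Sum>j<n. (cmod (G i j))\<^sup>2)) / 2"
    by (simp add: sum.distrib add_divide_distrib sum_divide_distrib)
  also have "\<dots> = Im (G i i) / Im z"
    using ward_row[OF h G i] ward_column[OF h G i] z by (simp add: field_simps)
  also have "\<dots> \<le> cmod (G i i) / Im z"
    using abs_Im_le_cmod[of "G i i"] z by (intro divide_right_mono) auto
  finally have "cmod (\<Sum>j<n. G j i * G i j) \<le> cmod (G i i) / Im z" .
  then show ?thesis unfolding eq using g by (simp add: norm_divide divide_le_eq)
qed

lemma decoupled_trace_frobenius:
  "Im z * (\<Sum>j\<in>{..<n}-{i}. \<Sum>k\<in>{..<n}-{i}. (cmod (B j k))\<^sup>2) \<le> Im (\<Sum>j\<in>{..<n}-{i}. B j j)"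
proof -
  have "Im z * (\<Sum>j\<in>{..<n}-{i}. \<Sum>k\<in>{..<n}-{i}. (cmod (B j k))\<^sup>2)
     \<le> Im z * (\<Sum>j\<in>{..<n}-{i}. \<Sum>k<n. (cmod (B j k))\<^sup>2)"
    using z by (intro mult_left_mono sum_mono sum_mono2) auto
  also have "\<dots> = (\<Sum>j\<in>{..<n}-{i}. Im (B j j))"
    by (subst sum_distrib_left, intro sum.cong refl) (auto simp: ward_row[OF hV B])
  finally show ?thesis by simp
qed

end

section \<open>Eigenvalues as measurable functions of the entries\<close>

text \<open>
  Written with the adjugate, which makes the entries explicit rational functions of those of the matrix; the
  sign belongs to the convention \<open>(W - z)\<^sup>-\<^sup>1\<close>, as \<open>- char_matrix W z = z - W\<close>.
\<close>

definition resolvent :: "complex mat \<Rightarrow> complex \<Rightarrow> nat \<Rightarrow> nat \<Rightarrow> complex" where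
  "resolvent W z j k = - (adj_mat (- char_matrix W z) $$ (j, k)) / Determinant.det (- char_matrix W z)"

lemma eigenvalue_hermitian_real:
  assumes W: "W \<in> carrier_mat n n" and h: "hermitian_on n (\<lambda>j k. W $$ (j, k))"
    and e: "eigenvalue W z"
  shows "Im z = 0"
proof -
  obtain v where v: "v \<in> carrier_vec n" "v \<noteq> 0\<^sub>v n" "W *\<^sub>v v = z \<cdot>\<^sub>v v"
    using e W unfolding eigenvalue_def eigenvector_def by auto
  have row: "(\<Sum>l<n. W $$ (j, l) * v $ l) = z * v $ j + 0" if "j < n" for j
  proof -
    have "(W *\<^sub>v v) $ j = z * v $ j" using v that by simp
    then show ?thesis using that W v(1) by (simp add: scalar_prod_def lessThan_atLeast0)
  qed
  have "Im (\<Sum>j<n. cnj 0 * v $ j) = Im z * (\<Sum>j<n. (cmod (v $ j))\<^sup>2)"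
    by (rule ward_vector[OF h row])
  then have 0: "Im z * (\<Sum>j<n. (cmod (v $ j))\<^sup>2) = 0" by simp
  have "(\<Sum>j<n. (cmod (v $ j))\<^sup>2) \<noteq> 0"
  proof
    assume "(\<Sum>j<n. (cmod (v $ j))\<^sup>2) = 0"
    then have "v $ j = 0" if "j < n" for j using that by (simp add: sum_nonneg_eq_0_iff)
    then have "v = 0\<^sub>v n" using v(1) by (intro eq_vecI) auto
    then show False using v(2) by simp
  qed
  then show ?thesis using 0 by simp
qed

lemma char_poly_nonzero_upper:
  assumes W: "W \<in> carrier_mat n n" and h: "hermitian_on n (\<lambda>j k. W $$ (j, k))" and z: "Im z \<noteq> 0"
  shows "poly (char_poly W) z \<noteq> 0"
  using eigenvalue_hermitian_real[OF W h] eigenvalue_root_char_poly[OF W] z by blast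

lemma is_resolvent_resolvent:
  assumes W: "W \<in> carrier_mat n n" and h: "hermitian_on n (\<lambda>j k. W $$ (j, k))" and z: "Im z \<noteq> 0"
  shows "is_resolvent n (\<lambda>j k. W $$ (j, k)) z (resolvent W z)"
  unfolding is_resolvent_def
proof (intro allI impI)
  fix j k assume j: "j < n" and k: "k < n"
  define R where "R = - char_matrix W z"
  define d where "d = Determinant.det R"
  have R: "R \<in> carrier_mat n n" using W unfolding R_def by auto
  have d: "d \<noteq> 0" using char_poly_nonzero_upper[OF assms] char_poly_matrix[OF W] unfolding d_def R_def by simp
  have Re: "R $$ (a, b) = (if a = b then z else 0) - W $$ (a, b)" if "a < n" "b < n" for a b
    using that W unfolding R_def char_matrix_def by auto
  note A = adj_mat[OF R]
  have r: "adj_mat R $$ (a, b) = - d * resolvent W z a b" for a b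
    using d unfolding resolvent_def R_def[symmetric] d_def by simp
  have "(R * adj_mat R) $$ (j, k) = (\<Sum>l<n. R $$ (j, l) * adj_mat R $$ (l, k))"
    using R A(1) j k by (simp add: scalar_prod_def lessThan_atLeast0)
  also have "\<dots> = (\<Sum>l<n. - d * ((if l = j then z * resolvent W z l k else 0) - W $$ (j, l) * resolvent W z l k))"
    using j by (intro sum.cong refl) (auto simp: Re r algebra_simps)
  also have "\<dots> = - d * (z * resolvent W z j k - (\<Sum>l<n. W $$ (j, l) * resolvent W z l k))"
    using j unfolding sum_distrib_left[symmetric] sum_subtractf by simp
  also have "(R * adj_mat R) $$ (j, k) = d * (if j = k then 1 else 0)"
    using A(2) j k unfolding d_def by simp
  finally have "d * (if j = k then 1 else 0) = d * ((\<Sum>l<n. W $$ (j, l) * resolvent W z l k) - z * resolvent W z j k)"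
    by (simp add: algebra_simps)
  then have 1: "(if j = k then 1 else 0) = (\<Sum>l<n. W $$ (j, l) * resolvent W z l k) - z * resolvent W z j k"
    using d by (simp only: mult_cancel_left) simp
  have "(adj_mat R * R) $$ (j, k) = (\<Sum>l<n. adj_mat R $$ (j, l) * R $$ (l, k))"
    using R A(1) j k by (simp add: scalar_prod_def lessThan_atLeast0)
  also have "\<dots> = (\<Sum>l<n. - d * ((if l = k then z * resolvent W z j l else 0) - resolvent W z j l * W $$ (l, k)))"
    using k by (intro sum.cong refl) (auto simp: Re r algebra_simps)
  also have "\<dots> = - d * (z * resolvent W z j k - (\<Sum>l<n. resolvent W z j l * W $$ (l, k)))"
    using k unfolding sum_distrib_left[symmetric] sum_subtractf by simp
  also have "(adj_mat R * R) $$ (j, k) = d * (if j = k then 1 else 0)"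
    using A(3) j k unfolding d_def by simp
  finally have "d * (if j = k then 1 else 0) = d * ((\<Sum>l<n. resolvent W z j l * W $$ (l, k)) - z * resolvent W z j k)"
    by (simp add: algebra_simps)
  then have 2: "(if j = k then 1 else 0) = (\<Sum>l<n. resolvent W z j l * W $$ (l, k)) - z * resolvent W z j k"
    using d by (simp only: mult_cancel_left) simp
  show "(\<Sum>l<n. W $$ (j, l) * resolvent W z l k) = z * resolvent W z j k + (if j = k then 1 else 0) \<and>
        (\<Sum>l<n. resolvent W z j l * W $$ (l, k)) = z * resolvent W z j k + (if j = k then 1 else 0)"
    unfolding 1 using 1 2 by (simp add: algebra_simps)
qed

text \<open>
  The diagonal cofactors of \<open>z - W\<close> are the characteristic polynomials of the principal minors, and these
  sum to the derivative of the characteristic polynomial.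
\<close>

lemma trace_resolvent_log_derivative:
  assumes W: "W \<in> carrier_mat n n"
  shows "(\<Sum>j<n. resolvent W z j j) = - poly (pderiv (char_poly W)) z / poly (char_poly W) z"
proof -
  have "adj_mat (- char_matrix W z) $$ (j, j) = poly (char_poly (mat_delete W j j)) z" if j: "j < n" for j
  proof -
    have c: "mat_delete W j j \<in> carrier_mat (n - 1) (n - 1)"
      using W by (rule mat_delete_carrier)
    have "adj_mat (- char_matrix W z) $$ (j, j) = Determinant.det (mat_delete (- char_matrix W z) j j)"
      using W j unfolding adj_mat_def by (simp add: cofactor_def char_matrix_def)
    also have "mat_delete (- char_matrix W z) j j = - char_matrix (mat_delete W j j) z"
      using W j by (intro eq_matI) (auto simp: mat_delete_def char_matrix_def)
    finally show ?thesis using char_poly_matrix[OF c] by simp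
  qed
  then have "(\<Sum>j<n. resolvent W z j j) = (\<Sum>j<n. - poly (char_poly (mat_delete W j j)) z / poly (char_poly W) z)"
    unfolding resolvent_def char_poly_matrix[OF W] by (intro sum.cong) auto
  also have "\<dots> = - (\<Sum>j<n. poly (char_poly (mat_delete W j j)) z) / poly (char_poly W) z"
    by (simp only: minus_divide_left[symmetric] sum_negf sum_divide_distrib)
  finally show ?thesis unfolding pderiv_char_poly[OF W] poly_sum .
qed

lemma log_derivative_linear_factors:
  fixes z :: complex
  assumes "\<forall>a\<in>set as. z \<noteq> a"
  shows "poly (pderiv (\<Prod>a\<leftarrow>as. [:- a, 1:])) z / poly (\<Prod>a\<leftarrow>as. [:- a, 1:]) z = (\<Sum>a\<leftarrow>as. 1 / (z - a))"
  using assms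
proof (induction as)
  case Nil
  then show ?case by simp
next
  case (Cons b as)
  define p where "p = (\<Prod>a\<leftarrow>as. [:- a, 1:])"
  have p: "poly p z \<noteq> 0" using Cons.prems unfolding p_def by (induction as) (auto simp: poly_prod_list)
  have b: "z - b \<noteq> 0" using Cons.prems by simp
  have "poly (pderiv ([:- b, 1:] * p)) z = poly p z + (z - b) * poly (pderiv p) z"
  proof -
    have "pderiv [:- b, 1:] = 1" by (simp add: pderiv_pCons)
    then show ?thesis unfolding pderiv_mult by (simp only: poly_add poly_mult) (simp add: algebra_simps)
  qed
  moreover have "poly ([:- b, 1:] * p) z = (z - b) * poly p z" by (simp add: algebra_simps)
  ultimately have "poly (pderiv ([:- b, 1:] * p)) z / poly ([:- b, 1:] * p) z = 1 / (z - b) + poly (pderiv p) z / poly p z"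
    using p b by (simp add: add_divide_distrib)
  then show ?case using Cons unfolding p_def by simp
qed

lemma hermitian_spectrum:
  assumes W: "W \<in> carrier_mat n n" and h: "hermitian_on n (\<lambda>j k. W $$ (j, k))"
  obtains lam :: "nat \<Rightarrow> real" where
    "\<And>J. num_eigenvalues_in W J = card {i. i < n \<and> lam i \<in> J}"
    "\<And>z. Im z \<noteq> 0 \<Longrightarrow> (\<Sum>j<n. resolvent W z j j) = (\<Sum>i<n. 1 / (of_real (lam i) - z))"
proof -
  obtain as where as: "char_poly W = (\<Prod>a\<leftarrow>as. [:- a, 1:])" "length as = n"
    using char_poly_factorized[OF W] by blast
  have real: "Im a = 0" if "a \<in> set as" for a
  proof -
    have "poly (char_poly W) a = 0" using that unfolding as(1) poly_prod_list by (auto simp: prod_list_zero_iff)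
    then show ?thesis using eigenvalue_hermitian_real[OF W h] eigenvalue_root_char_poly[OF W] by blast
  qed
  define lam where "lam i = Re (as ! i)" for i
  have lam: "of_real (lam i) = as ! i" if "i < n" for i
    using real[of "as ! i"] that as(2) unfolding lam_def by (simp add: complex_eq_iff)
  have pr: "proots (char_poly W) = mset as"
  proof -
    have "proots (\<Prod>a\<leftarrow>bs. [:- a, 1:]) = mset bs" for bs :: "complex list"
    proof (induction bs)
      case (Cons b bs)
      have "(\<Prod>a\<leftarrow>bs. [:- a, 1:]) \<noteq> 0" by (auto simp: prod_list_zero_iff)
      then have "proots ([:- b, 1:] * (\<Prod>a\<leftarrow>bs. [:- a, 1:])) = proots [:- b, 1:] + proots (\<Prod>a\<leftarrow>bs. [:- a, 1:])"
        by (intro proots_mult) auto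
      then show ?case using Cons by simp
    qed simp
    then show ?thesis unfolding as(1) .
  qed
  show ?thesis
  proof (rule that)
    fix J
    have "num_eigenvalues_in W J = length (filter (\<lambda>z. z \<in> complex_of_real ` J) as)"
      unfolding num_eigenvalues_in_def pr by (simp flip: mset_filter)
    also have "\<dots> = card {i. i < n \<and> as ! i \<in> complex_of_real ` J}"
      by (simp add: length_filter_conv_card as(2))
    also have "{i. i < n \<and> as ! i \<in> complex_of_real ` J} = {i. i < n \<and> lam i \<in> J}"
    proof -
      have "as ! i \<in> complex_of_real ` J \<longleftrightarrow> lam i \<in> J" if "i < n" for i
        unfolding lam[OF that, symmetric] by (auto simp: image_iff)
      then show ?thesis by blast
    qed
    finally show "num_eigenvalues_in W J = card {i. i < n \<and> lam i \<in> J}" .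
  next
    fix z :: complex assume z: "Im z \<noteq> 0"
    have "\<forall>a\<in>set as. z \<noteq> a" using real z by auto
    then have "(\<Sum>j<n. resolvent W z j j) = - (\<Sum>a\<leftarrow>as. 1 / (z - a))"
      unfolding trace_resolvent_log_derivative[OF W] as(1) minus_divide_left[symmetric]
      by (simp only: log_derivative_linear_factors)
    also have "(\<Sum>a\<leftarrow>as. 1 / (z - a)) = (\<Sum>i<n. 1 / (z - as ! i))"
      by (simp add: sum_list_sum_nth as(2) lessThan_atLeast0)
    also have "- \<dots> = (\<Sum>i<n. 1 / (of_real (lam i) - z))"
      unfolding sum_negf[symmetric]
      by (intro sum.cong refl) (simp add: lam minus_divide_right)
    finally show "(\<Sum>j<n. resolvent W z j j) = (\<Sum>i<n. 1 / (of_real (lam i) - z))" .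
  qed
qed


lemma borel_measurable_det:
  fixes X :: "'a \<Rightarrow> complex mat"
  assumes X: "\<And>x. x \<in> space M \<Longrightarrow> X x \<in> carrier_mat n n"
    and m: "\<And>i j. i < n \<Longrightarrow> j < n \<Longrightarrow> (\<lambda>x. X x $$ (i, j)) \<in> borel_measurable M"
  shows "(\<lambda>x. Determinant.det (X x)) \<in> borel_measurable M"
proof -
  have "(\<lambda>x. \<Sum>p | p permutes {0..<n}. signof p * (\<Prod>i = 0..<n. X x $$ (i, p i))) \<in> borel_measurable M"
  proof (intro borel_measurable_sum borel_measurable_times borel_measurable_const borel_measurable_prod)
    fix p i assume "p \<in> {p. p permutes {0..<n}}" "i \<in> {0..<n}"
    then have "p i < n" "i < n" using permutes_in_image[of p "{0..<n}" i] by auto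
    then show "(\<lambda>x. X x $$ (i, p i)) \<in> borel_measurable M" using m by blast
  qed
  then show ?thesis by (subst measurable_cong[OF det_def'[OF X]])
qed

lemma borel_measurable_resolvent:
  fixes X :: "'a \<Rightarrow> complex mat"
  assumes X: "\<And>x. x \<in> space M \<Longrightarrow> X x \<in> carrier_mat n n"
    and m: "\<And>i j. i < n \<Longrightarrow> j < n \<Longrightarrow> (\<lambda>x. X x $$ (i, j)) \<in> borel_measurable M"
    and jk: "j < n" "k < n"
  shows "(\<lambda>x. resolvent (X x) z j k) \<in> borel_measurable M"
proof -
  define R where "R x = - char_matrix (X x) z" for x
  have R: "R x \<in> carrier_mat n n" if "x \<in> space M" for x using X[OF that] unfolding R_def by auto
  have mR: "(\<lambda>x. R x $$ (i, l)) \<in> borel_measurable M" if "i < n" "l < n" for i l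
  proof -
    have eq: "R x $$ (i, l) = (if i = l then z else 0) - X x $$ (i, l)" if "x \<in> space M" for x
      using X[OF that] \<open>i < n\<close> \<open>l < n\<close> unfolding R_def char_matrix_def by auto
    have "(\<lambda>x. (if i = l then z else 0) - X x $$ (i, l)) \<in> borel_measurable M"
      using m[OF that] by (intro borel_measurable_diff borel_measurable_const)
    then show ?thesis by (subst measurable_cong[OF eq])
  qed
  have mdel: "(\<lambda>x. Determinant.det (mat_delete (R x) k j)) \<in> borel_measurable M"
  proof (rule borel_measurable_det)
    show "mat_delete (R x) k j \<in> carrier_mat (n - 1) (n - 1)" if "x \<in> space M" for x
      by (rule mat_delete_carrier[OF R[OF that]])
    fix i l assume il: "i < n - 1" "l < n - 1"
    have eq: "mat_delete (R x) k j $$ (i, l) = R x $$ (if i < k then i else Suc i, if l < j then l else Suc l)"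
      if "x \<in> space M" for x
      using R[OF that] il unfolding mat_delete_def by auto
    have "(\<lambda>x. R x $$ (if i < k then i else Suc i, if l < j then l else Suc l)) \<in> borel_measurable M"
      using il by (intro mR) auto
    then show "(\<lambda>x. mat_delete (R x) k j $$ (i, l)) \<in> borel_measurable M"
      by (subst measurable_cong[OF eq])
  qed
  have eq: "resolvent (X x) z j k = - ((-1) ^ (k + j) * Determinant.det (mat_delete (R x) k j)) / Determinant.det (R x)"
    if "x \<in> space M" for x
    using R[OF that] jk unfolding resolvent_def R_def[symmetric] adj_mat_def cofactor_def by simp
  have "(\<lambda>x. - ((-1) ^ (k + j) * Determinant.det (mat_delete (R x) k j)) / Determinant.det (R x)) \<in> borel_measurable M"
    using mdel borel_measurable_det[OF R mR] by measurable
  then show ?thesis by (subst measurable_cong[OF eq])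
qed

text \<open>
  The expansion of \<open>z/(z - l)\<close> in powers of \<open>l/z\<close>. As \<open>z \<rightarrow> i\<infinity>\<close> the right hand side tends to \<open>l\<^sup>k\<close>, which recovers
  the power sums of the eigenvalues recursively from the Stieltjes transform.
\<close>

lemma geometric_remainder:
  fixes l z :: complex
  assumes "z \<noteq> l" "z \<noteq> 0"
  shows "z ^ k * (z / (z - l) - (\<Sum>j<k. l ^ j / z ^ j)) = l ^ k * (z / (z - l))"
proof (induction k)
  case 0
  then show ?case by simp
next
  case (Suc k)
  have "z ^ Suc k * (z / (z - l) - (\<Sum>j<Suc k. l ^ j / z ^ j))
     = z * (z ^ k * (z / (z - l) - (\<Sum>j<k. l ^ j / z ^ j))) - z * l ^ k"
    using assms by (simp add: algebra_simps)
  also have "\<dots> = l ^ k * (z * (z / (z - l)) - z)" unfolding Suc by (simp add: algebra_simps)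
  also have "z * (z / (z - l)) - z = l * (z / (z - l))" using assms by (simp add: field_simps)
  finally show ?case by (simp add: mult_ac)
qed

text \<open>
  The class of functions \<open>g\<close> for which \<open>\<Sum> g(L\<^sub>i)\<close> is measurable is closed under linear combinations and
  pointwise limits. It contains the powers by \<open>geometric_remainder\<close>, hence the continuous functions by the
  Weierstrass theorem, hence indicators of half lines, hence indicators of Borel sets by Dynkin's lemma.
\<close>

theorem borel_measurable_linear_statistic:
  fixes X :: "'a \<Rightarrow> complex mat" and L :: "'a \<Rightarrow> nat \<Rightarrow> real"
  assumes S: "\<And>z. Im z \<noteq> 0 \<Longrightarrow> (\<lambda>x. \<Sum>i<n. 1 / (of_real (L x i) - z)) \<in> borel_measurable M"
    and J: "J \<in> sets borel"
  shows "(\<lambda>x. \<Sum>i<n. indicator J (L x i) :: real) \<in> borel_measurable M"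
proof -
  define P where "P g = ((\<lambda>x. \<Sum>i<n. g (L x i) :: real) \<in> borel_measurable M)" for g
  have powc: "(\<lambda>x. \<Sum>i<n. complex_of_real (L x i) ^ k) \<in> borel_measurable M" for k
  proof (induction k rule: less_induct)
    case (less k)
    \<comment> \<open>The m-th point of a sequence going to infinity along the imaginary axis.\<close>
    define z where "z m = \<i> * of_real (real m + 1)" for m
    have z: "Im (z m) \<noteq> 0" "z m \<noteq> 0" "z m \<noteq> of_real r" for m r
      unfolding z_def by (auto simp: complex_eq_iff)
    define F where "F m x = z m ^ k * (- z m * (\<Sum>i<n. 1 / (of_real (L x i) - z m))
        - (\<Sum>j<k. (\<Sum>i<n. complex_of_real (L x i) ^ j) / z m ^ j))" for m x
    have Fm: "F m \<in> borel_measurable M" for m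
      unfolding F_def
      by (intro borel_measurable_times borel_measurable_diff borel_measurable_const borel_measurable_sum S z
          borel_measurable_divide less) auto
    have Fe: "F m x = (\<Sum>i<n. complex_of_real (L x i) ^ k * (z m / (z m - of_real (L x i))))" for m x
    proof -
      have 1: "- z m * (1 / (of_real r - z m)) = z m / (z m - of_real r)" for r
      proof -
        define d where "d = of_real r - z m"
        have "z m - of_real r = - d" unfolding d_def by simp
        then show ?thesis unfolding d_def[symmetric] by simp
      qed
      have "F m x = z m ^ k * ((\<Sum>i<n. z m / (z m - of_real (L x i))) - (\<Sum>i<n. \<Sum>j<k. complex_of_real (L x i) ^ j / z m ^ j))"
        unfolding F_def sum_distrib_left 1 sum_divide_distrib by (subst (2) sum.swap) simp
      also have "\<dots> = (\<Sum>i<n. z m ^ k * (z m / (z m - of_real (L x i)) - (\<Sum>j<k. complex_of_real (L x i) ^ j / z m ^ j)))"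
        unfolding sum_subtractf[symmetric] sum_distrib_left ..
      also have "\<dots> = (\<Sum>i<n. complex_of_real (L x i) ^ k * (z m / (z m - of_real (L x i))))"
        by (intro sum.cong refl geometric_remainder z)
      finally show ?thesis .
    qed
    have lim1: "(\<lambda>m. z m / (z m - of_real r)) \<longlonglongrightarrow> 1" for r
    proof -
      have "(\<lambda>m. of_real r / z m) \<longlonglongrightarrow> 0"
      proof (rule Lim_null_comparison)
        have "cmod (z m) = real (Suc m)" for m
          unfolding z_def norm_mult norm_of_real by simp
        then have "norm (of_real r / z m) = \<bar>r\<bar> / real (Suc m)" for m
          by (simp only: norm_divide norm_of_real)
        then have "norm (of_real r / z m) = \<bar>r\<bar> * inverse (real (Suc m))" for m
          by (simp only: divide_inverse)
        then show "\<forall>\<^sub>F m in sequentially. norm (of_real r / z m) \<le> \<bar>r\<bar> * inverse (real (Suc m))"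
          by (intro always_eventually allI) (simp only: order_refl)
        show "(\<lambda>m. \<bar>r\<bar> * inverse (real (Suc m))) \<longlonglongrightarrow> 0"
          using tendsto_mult[OF tendsto_const LIMSEQ_inverse_real_of_nat, of "\<bar>r\<bar>"] by simp
      qed
      then have "(\<lambda>m. 1 / (1 - of_real r / z m)) \<longlonglongrightarrow> 1 / (1 - 0)"
        by (intro tendsto_intros) auto
      moreover have "1 / (1 - of_real r / z m) = z m / (z m - of_real r)" for m
        using z[of m] by (simp add: field_simps)
      ultimately show ?thesis by simp
    qed
    show ?case
    proof (rule borel_measurable_LIMSEQ_metric[OF Fm])
      fix x
      have "(\<lambda>m. \<Sum>i<n. complex_of_real (L x i) ^ k * (z m / (z m - of_real (L x i)))) \<longlonglongrightarrow> (\<Sum>i<n. complex_of_real (L x i) ^ k * 1)"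
        by (intro tendsto_sum tendsto_mult tendsto_const lim1)
      then show "(\<lambda>m. F m x) \<longlonglongrightarrow> (\<Sum>i<n. complex_of_real (L x i) ^ k)" unfolding Fe by simp
    qed
  qed
  have pow: "P (\<lambda>t. t ^ k)" for k
  proof -
    have "(\<lambda>x. Re (\<Sum>i<n. complex_of_real (L x i) ^ k)) \<in> borel_measurable M" using powc by measurable
    then show ?thesis unfolding P_def by (simp flip: of_real_power)
  qed
  have lim: "P g" if "\<And>m. P (f m)" "\<And>t. (\<lambda>m. f m t) \<longlonglongrightarrow> g t" for f and g :: "real \<Rightarrow> real"
    unfolding P_def
    by (rule borel_measurable_LIMSEQ_metric[where f = "\<lambda>m x. \<Sum>i<n. f m (L x i)"])
      (use that in \<open>auto simp: P_def intro!: tendsto_sum\<close>)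
  have poly: "P g" if g: "real_polynomial_function g" for g
  proof -
    obtain a N where gN: "g = (\<lambda>t. \<Sum>j\<le>N. a j * t ^ j)"
      using g unfolding real_polynomial_function_iff_sum by (elim exE)
    have "(\<lambda>x. \<Sum>j\<le>N. a j * (\<Sum>i<n. L x i ^ j)) \<in> borel_measurable M"
      by (rule borel_measurable_sum, rule borel_measurable_times[OF borel_measurable_const], rule pow[unfolded P_def])
    moreover have "(\<Sum>j\<le>N. a j * (\<Sum>i<n. L x i ^ j)) = (\<Sum>i<n. g (L x i))" for x
      unfolding gN sum_distrib_left by (rule sum.swap)
    ultimately show ?thesis unfolding P_def by simp
  qed
  have cont: "P g" if g: "continuous_on UNIV g" for g :: "real \<Rightarrow> real"
  proof -
    have "\<exists>p. real_polynomial_function p \<and> (\<forall>t\<in>{- real m..real m}. \<bar>g t - p t\<bar> < 1 / real (Suc m))" for m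
    proof -
      have "0 < 1 / real (Suc m)" by simp
      from Stone_Weierstrass_real_polynomial_function[OF compact_Icc continuous_on_subset[OF g subset_UNIV] this]
      obtain p where "real_polynomial_function p" "\<And>t. t \<in> {- real m..real m} \<Longrightarrow> \<bar>g t - p t\<bar> < 1 / real (Suc m)"
        by metis
      then show ?thesis by auto
    qed
    then obtain p where p: "\<And>m. real_polynomial_function (p m)"
      "\<And>m t. t \<in> {- real m..real m} \<Longrightarrow> \<bar>g t - p m t\<bar> < 1 / real (Suc m)" by metis
    show ?thesis
    proof (rule lim[of p])
      fix t
      have "(\<lambda>m. p m t - g t) \<longlonglongrightarrow> 0"
      proof (rule Lim_null_comparison)
        obtain m0 where m0: "\<bar>t\<bar> \<le> real m0" using real_arch_simple by blast
        show "\<forall>\<^sub>F m in sequentially. norm (p m t - g t) \<le> inverse (real (Suc m))"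
          using eventually_ge_at_top[of m0]
        proof eventually_elim
          case (elim m)
          then have "t \<in> {- real m..real m}" using m0 by auto
          then show ?case using p(2)[of t m] by (simp add: abs_minus_commute inverse_eq_divide less_imp_le)
        qed
        show "(\<lambda>m. inverse (real (Suc m))) \<longlonglongrightarrow> 0" by (rule LIMSEQ_inverse_real_of_nat)
      qed
      then show "(\<lambda>m. p m t) \<longlonglongrightarrow> g t" using LIM_zero_iff by blast
    qed (use p poly in auto)
  qed
  have atMost: "P (indicator {..u})" for u
  proof (rule lim[of "\<lambda>m t. max 0 (min 1 (1 - real m * (t - u)))"])
    show "P (\<lambda>t. max 0 (min 1 (1 - real m * (t - u))))" for m
      by (intro cont continuous_intros)
    fix t
    show "(\<lambda>m. max 0 (min 1 (1 - real m * (t - u)))) \<longlonglongrightarrow> indicator {..u} t"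
    proof (cases "t \<le> u")
      case True
      then have "1 - real m * (t - u) \<ge> 1" for m by (simp add: mult_nonneg_nonpos)
      then have "max 0 (min 1 (1 - real m * (t - u))) = 1" for m by (simp add: min_absorb1)
      then show ?thesis using True by simp
    next
      case False
      obtain m0 where m0: "1 / (t - u) \<le> real m0" using real_arch_simple by blast
      have "\<forall>\<^sub>F m in sequentially. max 0 (min 1 (1 - real m * (t - u))) = 0"
        using eventually_ge_at_top[of m0]
      proof eventually_elim
        case (elim m)
        have "1 / (t - u) \<le> real m" using m0 elim by linarith
        then have "1 \<le> real m * (t - u)" using False by (simp add: pos_divide_le_eq)
        then show ?case by simp
      qed
      then show ?thesis using False by (simp add: tendsto_eventually)
    qed
  qed
  have "Int_stable (range (atMost :: real \<Rightarrow> real set))"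
    by (auto simp: Int_stable_def Int_atMost)
  moreover have "range (atMost :: real \<Rightarrow> real set) \<subseteq> Pow UNIV" by simp
  moreover have "J \<in> sigma_sets UNIV (range atMost)" using J by (simp add: borel_eq_atMost)
  ultimately have "P (indicator J)"
  proof (induction rule: sigma_sets_induct_disjoint)
    case (basic A)
    then show ?case using atMost by auto
  next
    case empty
    then show ?case unfolding P_def by simp
  next
    case (compl A)
    have "(\<lambda>x. real n - (\<Sum>i<n. indicator A (L x i) :: real)) \<in> borel_measurable M"
      using compl unfolding P_def by (intro borel_measurable_diff borel_measurable_const)
    moreover have "(\<Sum>i<n. indicator (UNIV - A) (L x i)) = real n - (\<Sum>i<n. indicator A (L x i) :: real)" for x
    proof -
      have "indicator (UNIV - A) t = 1 - (indicator A t :: real)" for t by (simp add: indicator_def)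
      then show ?thesis by (simp add: sum_subtractf)
    qed
    ultimately show ?case unfolding P_def by simp
  next
    case (union A)
    show ?case
    proof (rule lim[of "\<lambda>m t. \<Sum>k<m. indicator (A k) t"])
      fix m
      have "(\<lambda>x. \<Sum>k<m. \<Sum>i<n. indicator (A k) (L x i) :: real) \<in> borel_measurable M"
        by (rule borel_measurable_sum) (rule union(3)[unfolded P_def])
      moreover have "(\<Sum>k<m. \<Sum>i<n. indicator (A k) (L x i) :: real) = (\<Sum>i<n. \<Sum>k<m. indicator (A k) (L x i))" for x
        by (rule sum.swap)
      ultimately show "P (\<lambda>t. \<Sum>k<m. indicator (A k) t)" unfolding P_def by simp
    next
      fix t
      have "(\<lambda>k. indicator (A k) t :: real) sums indicator (\<Union>k. A k) t"
        using union(1) by (intro indicator_sums) (auto simp: disjoint_family_on_def)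
      then show "(\<lambda>m. \<Sum>k<m. indicator (A k) t) \<longlonglongrightarrow> (indicator (\<Union>k. A k) t :: real)"
        by (simp add: sums_def)
    qed
  qed
  then show ?thesis unfolding P_def .
qed

section \<open>Concentration of quadratic forms in bounded variables\<close>

lemma exp_le_quadratic:
  fixes x :: real
  assumes "\<bar>x\<bar> \<le> 1"
  shows "exp x \<le> 1 + x + x\<^sup>2"
proof (cases "x \<ge> 0")
  case True
  then show ?thesis using assms exp_bound[of x] by simp
next
  case False
  define y where "y = - x"
  have y: "0 < y" "y \<le> 1" using False assms unfolding y_def by auto
  have "1 \<le> (1 - y + y\<^sup>2) * (1 + y)" using y by (simp add: algebra_simps power2_eq_square)
  moreover have "1 + y \<le> exp y" by (rule exp_ge_add_one_self)
  moreover have "1 - y + y\<^sup>2 \<ge> 0" using y by (simp add: add_nonneg_nonneg)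
  ultimately have "1 \<le> (1 - y + y\<^sup>2) * exp y" by (meson mult_left_mono order_trans)
  then have "exp (- y) \<le> 1 - y + y\<^sup>2" by (simp add: exp_minus field_simps)
  then show ?thesis unfolding y_def by simp
qed

text \<open>
  A bounded centred variable satisfies \<open>E exp X \<le> 1 + E X\<^sup>2\<close>, from \<open>exp x \<le> 1 + x + x\<^sup>2\<close> on \<open>[-1, 1]\<close>.
\<close>

lemma (in prob_space) nn_integral_exp_le:
  assumes X: "X \<in> borel_measurable M" and b: "AE x in M. \<bar>X x\<bar> \<le> (1::real)"
    and 0: "expectation X = 0" and V: "expectation (\<lambda>x. (X x)\<^sup>2) \<le> V"
  shows "(\<integral>\<^sup>+x. ennreal (exp (X x)) \<partial>M) \<le> ennreal (exp V)"
proof -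
  have iX: "integrable M X"
    by (rule integrable_const_bound[where B = 1]) (use b X in auto)
  have iX2: "integrable M (\<lambda>x. (X x)\<^sup>2)"
  proof (rule integrable_const_bound[where B = 1])
    show "AE x in M. norm ((X x)\<^sup>2) \<le> 1" using b
    proof eventually_elim
      case (elim x)
      then show ?case by (simp add: abs_square_le_1)
    qed
  qed (use X in measurable)
  have "(\<integral>\<^sup>+x. ennreal (exp (X x)) \<partial>M) \<le> (\<integral>\<^sup>+x. ennreal (1 + X x + (X x)\<^sup>2) \<partial>M)"
  proof (rule nn_integral_mono_AE)
    show "AE x in M. ennreal (exp (X x)) \<le> ennreal (1 + X x + (X x)\<^sup>2)"
      using b by eventually_elim (rule ennreal_leI, rule exp_le_quadratic)
  qed
  also have "\<dots> = ennreal (expectation (\<lambda>x. 1 + X x + (X x)\<^sup>2))"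
  proof (rule nn_integral_eq_integral)
    show "AE x in M. 0 \<le> 1 + X x + (X x)\<^sup>2" using b by eventually_elim (auto simp: abs_le_iff intro!: add_nonneg_nonneg)
  qed (use iX iX2 in auto)
  also have "expectation (\<lambda>x. 1 + X x + (X x)\<^sup>2) = 1 + expectation X + expectation (\<lambda>x. (X x)\<^sup>2)"
    using iX iX2 by (simp add: prob_space)
  also have "ennreal \<dots> \<le> ennreal (exp V)"
    using V 0 exp_ge_add_one_self[of V] by (intro ennreal_leI) linarith
  finally show ?thesis .
qed

text \<open>
  An exponential supermartingale: the coordinates are integrated out in decreasing order of \<open>r\<close>. The increment
  \<open>h p u y\<close> sees the earlier coordinates only through the linear form \<open>u\<close>, and its conditional exponential
  moment is bounded uniformly in \<open>u\<close>.
\<close>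

lemma product_exp_moment:
  fixes r :: "'i \<Rightarrow> nat" and S :: "'i \<Rightarrow> 'i \<Rightarrow> real" and h :: "'i \<Rightarrow> real \<Rightarrow> real \<Rightarrow> real"
    and \<mu> :: "'i \<Rightarrow> real measure"
  assumes prob: "\<And>p. prob_space (\<mu> p)" and sets: "\<And>p. sets (\<mu> p) = sets borel"
    and h: "\<And>p. (\<lambda>(u, y). h p u y) \<in> borel_measurable (borel \<Otimes>\<^sub>M borel)"
    and inj: "inj r" and J: "finite J"
    and step: "\<And>p u. p \<in> J \<Longrightarrow> (\<integral>\<^sup>+y. ennreal (exp (h p u y)) \<partial>\<mu> p) \<le> ennreal (exp (V p))"
  shows "(\<integral>\<^sup>+x. ennreal (exp (\<Sum>p\<in>J. h p (\<Sum>q\<in>{q\<in>J. r q < r p}. S p q * x q) (x p))) \<partial>PiM J \<mu>)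
     \<le> ennreal (exp (\<Sum>p\<in>J. V p))"
  using J step
proof (induction rule: finite_ranking_induct[where f = r])
  case empty
  have "prob_space (PiM {} \<mu>)" by (intro prob_space_PiM prob)
  from prob_space.emeasure_space_1[OF this] show ?case by simp
next
  case (insert x J)
  interpret product_sigma_finite \<mu>
    unfolding product_sigma_finite_def using prob prob_space_imp_sigma_finite by blast
  have lt: "r q < r x" if "q \<in> J" "x \<notin> J" for q
  proof -
    have "r q \<noteq> r x" using inj that by (auto dest: injD)
    then show ?thesis using insert(2)[OF that(1)] by simp
  qed
  show ?case
  proof (cases "x \<in> J")
    case True
    then have "insert x J = J" by auto
    then show ?thesis using insert.IH insert.prems by (simp add: insert_absorb)
  next
    case False
    define f where "f A y = (\<Sum>p\<in>A. h p (\<Sum>q\<in>{q\<in>A. r q < r p}. S p q * y q) (y p))" for A y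
    have fm: "(\<lambda>y. ennreal (exp (f A y))) \<in> borel_measurable (PiM A \<mu>)" if "finite A" for A
    proof -
      have comp: "(\<lambda>y. y q) \<in> borel_measurable (PiM A \<mu>)" if "q \<in> A" for q
        using measurable_component_singleton[OF that, of \<mu>] by (simp cong: measurable_cong_sets add: sets)
      have "(\<lambda>y. h p (\<Sum>q\<in>{q\<in>A. r q < r p}. S p q * y q) (y p)) \<in> borel_measurable (PiM A \<mu>)" if "p \<in> A" for p
      proof -
        have "(\<lambda>y. (\<Sum>q\<in>{q\<in>A. r q < r p}. S p q * y q, y p)) \<in> PiM A \<mu> \<rightarrow>\<^sub>M borel \<Otimes>\<^sub>M borel"
          by (intro measurable_Pair borel_measurable_sum borel_measurable_times borel_measurable_const comp that) auto
        from measurable_compose[OF this h[of p]] show ?thesis by simp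
      qed
      then have "f A \<in> borel_measurable (PiM A \<mu>)" unfolding f_def by (intro borel_measurable_sum) auto
      then show ?thesis by measurable
    qed
    have upd: "f (insert x J) (y(x := v)) = f J y + h x (\<Sum>q\<in>J. S x q * y q) v" for y v
    proof -
      have "f (insert x J) (y(x := v)) =
         h x (\<Sum>q\<in>{q\<in>insert x J. r q < r x}. S x q * (y(x := v)) q) v
         + (\<Sum>p\<in>J. h p (\<Sum>q\<in>{q\<in>insert x J. r q < r p}. S p q * (y(x := v)) q) ((y(x := v)) p))"
        unfolding f_def using insert(1) False by simp
      also have "{q\<in>insert x J. r q < r x} = J" using lt False by auto
      also have "(\<Sum>q\<in>J. S x q * (y(x := v)) q) = (\<Sum>q\<in>J. S x q * y q)"
        using False by (intro sum.cong) auto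
      also have "(\<Sum>p\<in>J. h p (\<Sum>q\<in>{q\<in>insert x J. r q < r p}. S p q * (y(x := v)) q) ((y(x := v)) p)) = f J y"
        unfolding f_def
      proof (intro sum.cong refl)
        fix p assume p: "p \<in> J"
        have "{q\<in>insert x J. r q < r p} = {q\<in>J. r q < r p}" using lt[OF p False] by auto
        moreover have "(\<Sum>q\<in>{q\<in>J. r q < r p}. S p q * (y(x := v)) q) = (\<Sum>q\<in>{q\<in>J. r q < r p}. S p q * y q)"
          using False by (intro sum.cong) auto
        moreover have "(y(x := v)) p = y p" using p False by auto
        ultimately show "h p (\<Sum>q\<in>{q\<in>insert x J. r q < r p}. S p q * (y(x := v)) q) ((y(x := v)) p)
           = h p (\<Sum>q\<in>{q\<in>J. r q < r p}. S p q * y q) (y p)" by simp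
      qed
      finally show ?thesis by (rule trans[OF _ add.commute])
    qed
    have "(\<integral>\<^sup>+y. ennreal (exp (f (insert x J) y)) \<partial>PiM (insert x J) \<mu>)
      = (\<integral>\<^sup>+y. (\<integral>\<^sup>+v. ennreal (exp (f (insert x J) (y(x := v)))) \<partial>\<mu> x) \<partial>PiM J \<mu>)"
      using insert(1) False fm[of "insert x J"] by (intro product_nn_integral_insert) auto
    also have "\<dots> = (\<integral>\<^sup>+y. ennreal (exp (f J y)) * (\<integral>\<^sup>+v. ennreal (exp (h x (\<Sum>q\<in>J. S x q * y q) v)) \<partial>\<mu> x) \<partial>PiM J \<mu>)"
    proof (intro nn_integral_cong)
      fix y
      have "(\<lambda>v. h x (\<Sum>q\<in>J. S x q * y q) v) \<in> borel_measurable (\<mu> x)"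
        using measurable_compose[OF measurable_Pair1' h[of x], of "\<Sum>q\<in>J. S x q * y q"]
        by (simp cong: measurable_cong_sets add: sets)
      then show "(\<integral>\<^sup>+v. ennreal (exp (f (insert x J) (y(x := v)))) \<partial>\<mu> x)
        = ennreal (exp (f J y)) * (\<integral>\<^sup>+v. ennreal (exp (h x (\<Sum>q\<in>J. S x q * y q) v)) \<partial>\<mu> x)"
        unfolding upd exp_add ennreal_mult'[OF exp_ge_zero]
        by (intro nn_integral_cmult) measurable
    qed
    also have "\<dots> \<le> (\<integral>\<^sup>+y. ennreal (exp (V x)) * ennreal (exp (f J y)) \<partial>PiM J \<mu>)"
    proof (rule nn_integral_mono)
      fix y
      show "ennreal (exp (f J y)) * (\<integral>\<^sup>+v. ennreal (exp (h x (\<Sum>q\<in>J. S x q * y q) v)) \<partial>\<mu> x)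
          \<le> ennreal (exp (V x)) * ennreal (exp (f J y))"
        unfolding mult.commute[of "ennreal (exp (V x))"]
        by (rule mult_left_mono[OF insert.prems]) auto
    qed
    also have "\<dots> = ennreal (exp (V x)) * (\<integral>\<^sup>+y. ennreal (exp (f J y)) \<partial>PiM J \<mu>)"
      using fm[OF insert(1)] by (intro nn_integral_cmult)
    also have "\<dots> \<le> ennreal (exp (V x)) * ennreal (exp (\<Sum>p\<in>J. V p))"
      using insert.IH insert.prems unfolding f_def by (intro mult_left_mono) auto
    also have "\<dots> = ennreal (exp (\<Sum>p\<in>insert x J. V p))"
      using insert(1) False by (simp add: exp_add ennreal_mult')
    finally show ?thesis unfolding f_def .
  qed
qed

lemma markov_exp:
  assumes "prob_space M" and f: "f \<in> borel_measurable M"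
    and le: "(\<integral>\<^sup>+x. ennreal (exp (f x)) \<partial>M) \<le> ennreal (exp 1)"
  shows "measure M {x \<in> space M. f x > t} \<le> exp (1 - t)"
proof -
  interpret prob_space M by fact
  have s: "{x \<in> space M. f x > t} \<in> sets M" using f by measurable
  have "ennreal (exp t) * emeasure M {x \<in> space M. f x > t} = (\<integral>\<^sup>+x. ennreal (exp t) * indicator {x \<in> space M. f x > t} x \<partial>M)"
    using s by (simp add: nn_integral_cmult_indicator)
  also have "\<dots> \<le> (\<integral>\<^sup>+x. ennreal (exp (f x)) \<partial>M)"
    by (intro nn_integral_mono) (auto simp: indicator_def intro!: ennreal_leI)
  also note le
  finally have "ennreal (exp t * measure M {x \<in> space M. f x > t}) \<le> ennreal (exp 1)"
    by (simp add: emeasure_eq_measure ennreal_mult')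
  then have "exp t * measure M {x \<in> space M. f x > t} \<le> exp 1" by simp
  then show ?thesis by (simp add: exp_diff field_simps)
qed


context
  fixes r :: "'i \<Rightarrow> nat" and \<mu> :: "'i \<Rightarrow> real measure" and J :: "'i set" and K :: real
  assumes prob: "\<And>p. prob_space (\<mu> p)" and sets: "\<And>p. sets (\<mu> p) = sets borel"
    and inj: "inj r" and J: "finite J" and K: "K \<ge> 1"
    and bnd: "\<And>p. p \<in> J \<Longrightarrow> AE y in \<mu> p. \<bar>y\<bar> \<le> K"
    and mean: "\<And>p. p \<in> J \<Longrightarrow> (\<integral>y. y \<partial>\<mu> p) = 0"
    and var: "\<And>p. p \<in> J \<Longrightarrow> (\<integral>y. y\<^sup>2 \<partial>\<mu> p) = 1 / 2"
begin

lemma prob_PiM: "prob_space (PiM J \<mu>)"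
  by (intro prob_space_PiM prob)

lemma coordinate_measurable: "p \<in> J \<Longrightarrow> (\<lambda>y. y p) \<in> borel_measurable (PiM J \<mu>)"
  using measurable_component_singleton[of p J \<mu>] by (simp cong: measurable_cong_sets add: sets)

text \<open>
  The fourth moment is at most \<open>K\<^sup>2\<close> times the second one, which improves on the crude bound \<open>K\<^sup>4\<close>.
\<close>

lemma coordinate_integrable:
  assumes "p \<in> J"
  shows "integrable (\<mu> p) (\<lambda>y. y)" "integrable (\<mu> p) (\<lambda>y. y\<^sup>2)" "integrable (\<mu> p) (\<lambda>y. (y\<^sup>2 - 1 / 2)\<^sup>2)"
    "(\<integral>y. (y\<^sup>2 - 1 / 2)\<^sup>2 \<partial>\<mu> p) \<le> K\<^sup>2 / 2"
proof -
  interpret prob_space "\<mu> p" by (rule prob)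
  have m: "(\<lambda>y. y) \<in> borel_measurable (\<mu> p)" by (simp cong: measurable_cong_sets add: sets)
  have b2: "AE y in \<mu> p. y\<^sup>2 \<le> K\<^sup>2"
    using bnd[OF assms] by eventually_elim (use K in \<open>auto simp flip: abs_le_square_iff\<close>)
  show "integrable (\<mu> p) (\<lambda>y. y)"
    by (rule integrable_const_bound[where B = K]) (use bnd[OF assms] m in auto)
  show i2: "integrable (\<mu> p) (\<lambda>y. y\<^sup>2)"
    by (rule integrable_const_bound[where B = "K\<^sup>2"]) (use b2 m in auto)
  have ge: "AE y in \<mu> p. (y\<^sup>2 - 1 / 2)\<^sup>2 \<le> K\<^sup>2 * y\<^sup>2 + (1 / 4 - y\<^sup>2)"
    using b2
  proof eventually_elim
    case (elim y)
    have "y\<^sup>2 * y\<^sup>2 \<le> K\<^sup>2 * y\<^sup>2" using elim by (intro mult_right_mono) auto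
    then show ?case by (simp add: power2_diff power2_eq_square algebra_simps)
  qed
  show i4: "integrable (\<mu> p) (\<lambda>y. (y\<^sup>2 - 1 / 2)\<^sup>2)"
  proof (rule integrable_const_bound[where B = "(K\<^sup>2)\<^sup>2"])
    show "AE y in \<mu> p. norm ((y\<^sup>2 - 1 / 2)\<^sup>2) \<le> (K\<^sup>2)\<^sup>2"
      using b2
    proof eventually_elim
      case (elim y)
      have "K\<^sup>2 \<ge> 1" using K by simp
      then have "\<bar>y\<^sup>2 - 1 / 2\<bar> \<le> K\<^sup>2" using elim zero_le_power2[of y] by linarith
      then have "\<bar>y\<^sup>2 - 1 / 2\<bar>\<^sup>2 \<le> (K\<^sup>2)\<^sup>2" by (intro power_mono) auto
      then show ?case by simp
    qed
  qed (use m in measurable)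
  have "(\<integral>y. (y\<^sup>2 - 1 / 2)\<^sup>2 \<partial>\<mu> p) \<le> (\<integral>y. K\<^sup>2 * y\<^sup>2 + (1 / 4 - y\<^sup>2) \<partial>\<mu> p)"
    by (rule integral_mono_AE[OF i4 _ ge]) (use i2 in auto)
  also have "\<dots> = K\<^sup>2 * (1 / 2) + (1 / 4 - 1 / 2)"
    using i2 var[OF assms] by (simp add: prob_space)
  finally show "(\<integral>y. (y\<^sup>2 - 1 / 2)\<^sup>2 \<partial>\<mu> p) \<le> K\<^sup>2 / 2" by simp
qed

lemma linear_form_upper_tail:
  assumes s: "s > 0" and c: "(\<Sum>p\<in>J. (c p)\<^sup>2) \<le> s\<^sup>2"
  shows "measure (PiM J \<mu>) {x \<in> space (PiM J \<mu>). (\<Sum>p\<in>J. c p * x p) > t * (K * s)} \<le> exp (1 - t)"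
proof -
  define l where "l = 1 / (K * s)"
  have l: "l > 0" using K s unfolding l_def by simp
  have mgf: "(\<integral>\<^sup>+x. ennreal (exp (\<Sum>p\<in>J. l * c p * x p)) \<partial>PiM J \<mu>)
     \<le> ennreal (exp (\<Sum>p\<in>J. l\<^sup>2 * (c p)\<^sup>2))"
  proof (rule product_exp_moment[OF prob sets _ inj J, where h = "\<lambda>p u y. l * c p * y" and S = "\<lambda>_ _. 0"])
    show "(\<lambda>(u, y). l * c p * y) \<in> borel_measurable (borel \<Otimes>\<^sub>M borel)" for p by measurable
    fix p u assume p: "p \<in> J"
    interpret prob_space "\<mu> p" by (rule prob)
    show "(\<integral>\<^sup>+y. ennreal (exp (l * c p * y)) \<partial>\<mu> p) \<le> ennreal (exp (l\<^sup>2 * (c p)\<^sup>2))"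
    proof (rule nn_integral_exp_le)
      show "(\<lambda>y. l * c p * y) \<in> borel_measurable (\<mu> p)" by (simp cong: measurable_cong_sets add: sets)
      have "(c p)\<^sup>2 \<le> (\<Sum>p\<in>J. (c p)\<^sup>2)" using p J by (intro member_le_sum) auto
      then have "(c p)\<^sup>2 \<le> s\<^sup>2" using c by linarith
      then have cp: "\<bar>c p\<bar> \<le> s" using s by (simp flip: abs_le_square_iff)
      show "AE y in \<mu> p. \<bar>l * c p * y\<bar> \<le> 1"
        using bnd[OF p]
      proof eventually_elim
        case (elim y)
        have "\<bar>c p\<bar> * \<bar>y\<bar> \<le> s * K" using elim s cp by (intro mult_mono) auto
        then have "l * (\<bar>c p\<bar> * \<bar>y\<bar>) \<le> l * (s * K)" using l by (intro mult_left_mono) auto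
        also have "l * (s * K) = 1" unfolding l_def using K s by simp
        finally show ?case using l by (simp add: abs_mult mult.assoc)
      qed
      show "expectation (\<lambda>y. l * c p * y) = 0" using mean[OF p] by simp
      have "expectation (\<lambda>y. (l * c p * y)\<^sup>2) = (l * c p)\<^sup>2 * (1 / 2)"
        unfolding power_mult_distrib[of "l * c p"] using var[OF p] by simp
      also have "\<dots> \<le> l\<^sup>2 * (c p)\<^sup>2" by (simp add: power_mult_distrib)
      finally show "expectation (\<lambda>y. (l * c p * y)\<^sup>2) \<le> l\<^sup>2 * (c p)\<^sup>2" .
    qed
  qed
  have "(\<Sum>p\<in>J. l\<^sup>2 * (c p)\<^sup>2) \<le> l\<^sup>2 * s\<^sup>2"
    unfolding sum_distrib_left[symmetric] using c by (intro mult_left_mono) auto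
  also have "\<dots> = 1 / K\<^sup>2" unfolding l_def using K s by (simp add: power_divide power_mult_distrib)
  also have "\<dots> \<le> 1" using K by simp
  finally have "(\<integral>\<^sup>+x. ennreal (exp (\<Sum>p\<in>J. l * c p * x p)) \<partial>PiM J \<mu>) \<le> ennreal (exp 1)"
    by (intro order_trans[OF mgf] ennreal_leI) simp
  then have "measure (PiM J \<mu>) {x \<in> space (PiM J \<mu>). (\<Sum>p\<in>J. l * c p * x p) > t} \<le> exp (1 - t)"
    by (intro markov_exp prob_PiM borel_measurable_sum borel_measurable_times borel_measurable_const coordinate_measurable)
  also have "{x \<in> space (PiM J \<mu>). (\<Sum>p\<in>J. l * c p * x p) > t} = {x \<in> space (PiM J \<mu>). (\<Sum>p\<in>J. c p * x p) > t * (K * s)}"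
  proof -
    have "(\<Sum>p\<in>J. l * c p * x p) > t \<longleftrightarrow> (\<Sum>p\<in>J. c p * x p) > t * (K * s)" for x
    proof -
      have "(\<Sum>p\<in>J. l * c p * x p) = (\<Sum>p\<in>J. c p * x p) / (K * s)"
        unfolding l_def by (simp add: sum_distrib_left sum_divide_distrib)
      then show ?thesis using K s by (simp add: pos_less_divide_eq)
    qed
    then show ?thesis by simp
  qed
  finally show ?thesis .
qed

lemma linear_form_tail:
  assumes s: "s \<ge> 0" and c: "(\<Sum>p\<in>J. (c p)\<^sup>2) \<le> s\<^sup>2"
  shows "measure (PiM J \<mu>) {x \<in> space (PiM J \<mu>). \<bar>\<Sum>p\<in>J. c p * x p\<bar> > t * (K * s)} \<le> 2 * exp (1 - t)"
proof (cases "s = 0")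
  case True
  then have "(\<Sum>p\<in>J. (c p)\<^sup>2) = 0" using c sum_nonneg[of J "\<lambda>p. (c p)\<^sup>2"] by (intro antisym) auto
  then have "\<forall>p\<in>J. c p = 0" using J by (simp add: sum_nonneg_eq_0_iff)
  then have "{x \<in> space (PiM J \<mu>). \<bar>\<Sum>p\<in>J. c p * x p\<bar> > t * (K * s)} = {}" using True by simp
  then show ?thesis by (simp only: measure_empty) simp
next
  case False
  interpret P: prob_space "PiM J \<mu>" by (rule prob_PiM)
  have ev: "{x \<in> space (PiM J \<mu>). (\<Sum>p\<in>J. d p * x p) > b} \<in> sets (PiM J \<mu>)" for d b
  proof -
    have "(\<lambda>x. \<Sum>p\<in>J. d p * x p) \<in> borel_measurable (PiM J \<mu>)"
      by (intro borel_measurable_sum borel_measurable_times borel_measurable_const coordinate_measurable)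
    then show ?thesis by measurable
  qed
  have "{x \<in> space (PiM J \<mu>). \<bar>\<Sum>p\<in>J. c p * x p\<bar> > t * (K * s)}
     = {x \<in> space (PiM J \<mu>). (\<Sum>p\<in>J. c p * x p) > t * (K * s)} \<union> {x \<in> space (PiM J \<mu>). (\<Sum>p\<in>J. - c p * x p) > t * (K * s)}"
    by (auto simp: sum_negf)
  then have "measure (PiM J \<mu>) {x \<in> space (PiM J \<mu>). \<bar>\<Sum>p\<in>J. c p * x p\<bar> > t * (K * s)}
     \<le> measure (PiM J \<mu>) {x \<in> space (PiM J \<mu>). (\<Sum>p\<in>J. c p * x p) > t * (K * s)} 
       + measure (PiM J \<mu>) {x \<in> space (PiM J \<mu>). (\<Sum>p\<in>J. - c p * x p) > t * (K * s)}"
    by (simp only: measure_Un_le[OF ev ev])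
  also have "\<dots> \<le> exp (1 - t) + exp (1 - t)"
    using s False c by (intro add_mono linear_form_upper_tail) auto
  finally show ?thesis by simp
qed

text \<open>
  Ordering the coordinates by \<open>r\<close>, the centred form is the sum over \<open>p\<close> of
  \<open>x\<^sub>p \<Sum>\<^bsub>q<p\<^esub> T\<^sub>p\<^sub>q x\<^sub>q + S\<^sub>p\<^sub>p (x\<^sub>p\<^sup>2 - 1/2)\<close> with \<open>T\<close> twice the symmetric part of \<open>S\<close>. The inner linear forms are
  at most \<open>b p = t K s p\<close> with high probability, \<open>s p\<close> being the norm of row \<open>p\<close>. Replacing them by \<open>0\<close> beyond
  this level changes the sum only on a small event and makes increments and conditional variances bounded
  by constants: the variances sum to order \<open>(t K \<Phi>)\<^sup>2\<close> and the increments are of order \<open>t K\<^sup>2 \<rho>\<close>. The scale \<open>R\<close> is the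
  sum of the two, so that \<open>product_exp_moment\<close> applies to the sum divided by \<open>R\<close> with total variance at
  most \<open>1\<close>.
\<close>

lemma quadratic_form_upper_tail:
  fixes S :: "'i \<Rightarrow> 'i \<Rightarrow> real"
  assumes \<rho>: "\<rho> > 0" and \<Phi>: "\<Phi> > 0" and t: "t \<ge> 1"
    and row: "\<And>p. p \<in> J \<Longrightarrow> (\<Sum>q\<in>J. (S p q)\<^sup>2) \<le> \<rho>\<^sup>2" "\<And>p. p \<in> J \<Longrightarrow> (\<Sum>q\<in>J. (S q p)\<^sup>2) \<le> \<rho>\<^sup>2"
    and fro: "(\<Sum>p\<in>J. \<Sum>q\<in>J. (S p q)\<^sup>2) \<le> \<Phi>\<^sup>2"
  shows "measure (PiM J \<mu>) {x \<in> space (PiM J \<mu>).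
      (\<Sum>p\<in>J. \<Sum>q\<in>J. S p q * x p * x q) - (\<Sum>p\<in>J. S p p) / 2 > t * (3 * t * K * \<Phi> + 3 * t * K\<^sup>2 * \<rho>)}
     \<le> (1 + 2 * real (card J)) * exp (1 - t)"
proof -
  interpret P: prob_space "PiM J \<mu>" by (rule prob_PiM)
  define T where "T p q = S p q + S q p" for p q
  define s where "s p = sqrt (\<Sum>q\<in>J. (T p q)\<^sup>2)" for p
  define b where "b p = t * (K * s p)" for p
  \<comment> \<open>The increment of the form when coordinate p takes the value y, with the linear form u truncated.\<close>
  define D where "D p u y = y * (if \<bar>u\<bar> \<le> b p then u else 0) + S p p * (y\<^sup>2 - 1 / 2)" for p u y
  define R where "R = 3 * t * K * \<Phi> + 3 * t * K\<^sup>2 * \<rho>"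
  define l where "l = 1 / R"
  have R: "R > 0" unfolding R_def using t K \<rho> \<Phi> by (intro add_pos_pos mult_pos_pos) auto
  have l: "l > 0" unfolding l_def using R by simp
  have s0: "s p \<ge> 0" for p unfolding s_def by (simp add: sum_nonneg)
  have s2: "(s p)\<^sup>2 = (\<Sum>q\<in>J. (T p q)\<^sup>2)" for p unfolding s_def by (simp add: sum_nonneg)
  have T2: "(T p q)\<^sup>2 \<le> 2 * (S p q)\<^sup>2 + 2 * (S q p)\<^sup>2" for p q
    unfolding T_def using sum_squares_bound[of "S p q" "S q p"] by (simp add: power2_sum)
  have srow: "s p \<le> 2 * \<rho>" if p: "p \<in> J" for p
  proof -
    have "(s p)\<^sup>2 \<le> (\<Sum>q\<in>J. 2 * (S p q)\<^sup>2 + 2 * (S q p)\<^sup>2)" unfolding s2 by (intro sum_mono T2)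
    also have "\<dots> = 2 * (\<Sum>q\<in>J. (S p q)\<^sup>2) + 2 * (\<Sum>q\<in>J. (S q p)\<^sup>2)"
      by (simp add: sum.distrib sum_distrib_left)
    also have "\<dots> \<le> (2 * \<rho>)\<^sup>2" using row[OF p] by (simp add: power_mult_distrib)
    finally show ?thesis by (rule power2_le_imp_le) (use \<rho> in simp)
  qed
  have stot: "(\<Sum>p\<in>J. (s p)\<^sup>2) \<le> 4 * \<Phi>\<^sup>2"
  proof -
    have "(\<Sum>p\<in>J. (s p)\<^sup>2) \<le> (\<Sum>p\<in>J. \<Sum>q\<in>J. 2 * (S p q)\<^sup>2 + 2 * (S q p)\<^sup>2)" unfolding s2 by (intro sum_mono T2)
    also have "\<dots> = 2 * (\<Sum>p\<in>J. \<Sum>q\<in>J. (S p q)\<^sup>2) + 2 * (\<Sum>p\<in>J. \<Sum>q\<in>J. (S q p)\<^sup>2)"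
      by (simp add: sum.distrib sum_distrib_left)
    also have "(\<Sum>p\<in>J. \<Sum>q\<in>J. (S q p)\<^sup>2) = (\<Sum>p\<in>J. \<Sum>q\<in>J. (S p q)\<^sup>2)" by (rule sum.swap)
    finally show ?thesis using fro by simp
  qed
  have Sdiag: "\<bar>S p p\<bar> \<le> \<rho>" if p: "p \<in> J" for p
  proof -
    have "(S p p)\<^sup>2 \<le> (\<Sum>q\<in>J. (S p q)\<^sup>2)" using p J by (intro member_le_sum) auto
    then have "(S p p)\<^sup>2 \<le> \<rho>\<^sup>2" using row(1)[OF p] by linarith
    then show ?thesis using \<rho> by (simp flip: abs_le_square_iff)
  qed
  have diagtot: "(\<Sum>p\<in>J. (S p p)\<^sup>2) \<le> \<Phi>\<^sup>2"
  proof -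
    have "(\<Sum>p\<in>J. (S p p)\<^sup>2) \<le> (\<Sum>p\<in>J. \<Sum>q\<in>J. (S p q)\<^sup>2)"
      using J by (intro sum_mono member_le_sum) auto
    then show ?thesis using fro by linarith
  qed
  have b0: "b p \<ge> 0" for p unfolding b_def using t K s0 by simp
  have K2: "K\<^sup>2 \<ge> 1" using K by simp
  have mgf: "(\<integral>\<^sup>+x. ennreal (exp (\<Sum>p\<in>J. l * D p (\<Sum>q\<in>{q\<in>J. r q < r p}. T p q * x q) (x p))) \<partial>PiM J \<mu>)
     \<le> ennreal (exp (\<Sum>p\<in>J. l\<^sup>2 * ((b p)\<^sup>2 + (S p p)\<^sup>2 * K\<^sup>2)))"
  proof (rule product_exp_moment[OF prob sets _ inj J, where h = "\<lambda>p u y. l * D p u y" and S = T])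
    show "(\<lambda>(u, y). l * D p u y) \<in> borel_measurable (borel \<Otimes>\<^sub>M borel)" for p
      unfolding D_def by measurable
    fix p u assume p: "p \<in> J"
    interpret prob_space "\<mu> p" by (rule prob)
    note int = coordinate_integrable[OF p]
    define c where "c = (if \<bar>u\<bar> \<le> b p then u else 0)"
    have c: "\<bar>c\<bar> \<le> b p" using b0[of p] unfolding c_def by auto
    have Dc: "D p u y = c * y + S p p * (y\<^sup>2 - 1 / 2)" for y unfolding D_def c_def by simp
    show "(\<integral>\<^sup>+y. ennreal (exp (l * D p u y)) \<partial>\<mu> p) \<le> ennreal (exp (l\<^sup>2 * ((b p)\<^sup>2 + (S p p)\<^sup>2 * K\<^sup>2)))"
    proof (rule nn_integral_exp_le)
      have "(\<lambda>y. l * D p u y) \<in> borel_measurable borel" unfolding Dc by measurable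
      then show "(\<lambda>y. l * D p u y) \<in> borel_measurable (\<mu> p)" by (simp cong: measurable_cong_sets add: sets)
      show "AE y in \<mu> p. \<bar>l * D p u y\<bar> \<le> 1"
        using bnd[OF p]
      proof eventually_elim
        case (elim y)
        have y2: "y\<^sup>2 \<le> K\<^sup>2" using elim K by (simp flip: abs_le_square_iff)
        have "\<bar>D p u y\<bar> \<le> \<bar>c\<bar> * \<bar>y\<bar> + \<bar>S p p\<bar> * \<bar>y\<^sup>2 - 1 / 2\<bar>"
          unfolding Dc using abs_triangle_ineq[of "c * y" "S p p * (y\<^sup>2 - 1 / 2)"] by (simp add: abs_mult)
        also have "\<dots> \<le> b p * K + \<rho> * K\<^sup>2"
        proof (intro add_mono mult_mono)
          show "\<bar>y\<^sup>2 - 1 / 2\<bar> \<le> K\<^sup>2" using y2 K2 zero_le_power2[of y] by linarith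
        qed (use c elim Sdiag[OF p] b0 \<rho> in auto)
        also have "\<dots> \<le> t * (K * (2 * \<rho>)) * K + t * \<rho> * K\<^sup>2"
        proof (intro add_mono)
          show "b p * K \<le> t * (K * (2 * \<rho>)) * K"
            unfolding b_def using t K srow[OF p] by (intro mult_right_mono mult_left_mono) auto
          have "1 * (\<rho> * K\<^sup>2) \<le> t * (\<rho> * K\<^sup>2)" using t \<rho> by (intro mult_right_mono) auto
          then show "\<rho> * K\<^sup>2 \<le> t * \<rho> * K\<^sup>2" by (simp add: mult.assoc)
        qed
        also have "\<dots> = 3 * t * K\<^sup>2 * \<rho>" by (simp add: power2_eq_square)
        also have "\<dots> \<le> R" unfolding R_def using t K \<Phi> by simp
        finally show ?case using R l unfolding l_def by (simp add: abs_mult)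
      qed
      have iy: "integrable (\<mu> p) (\<lambda>y. c * y)" "integrable (\<mu> p) (\<lambda>y. S p p * (y\<^sup>2 - 1 / 2))"
        using int by auto
      have "expectation (\<lambda>y. y\<^sup>2 - 1 / 2) = 0" using int var[OF p] by (simp add: prob_space)
      then have "expectation (D p u) = 0"
        unfolding Dc using iy mean[OF p] by (simp add: Bochner_Integration.integral_add)
      then show "expectation (\<lambda>y. l * D p u y) = 0" by simp
      have i3: "integrable (\<mu> p) (\<lambda>y. 2 * c\<^sup>2 * y\<^sup>2)" "integrable (\<mu> p) (\<lambda>y. 2 * (S p p)\<^sup>2 * (y\<^sup>2 - 1 / 2)\<^sup>2)"
        using int by auto
      have le: "(D p u y)\<^sup>2 \<le> 2 * c\<^sup>2 * y\<^sup>2 + 2 * (S p p)\<^sup>2 * (y\<^sup>2 - 1 / 2)\<^sup>2" for y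
        unfolding Dc using sum_squares_bound[of "c * y" "S p p * (y\<^sup>2 - 1 / 2)"]
        by (simp add: power2_sum power_mult_distrib)
      have "expectation (\<lambda>y. (D p u y)\<^sup>2) \<le> expectation (\<lambda>y. 2 * c\<^sup>2 * y\<^sup>2 + 2 * (S p p)\<^sup>2 * (y\<^sup>2 - 1 / 2)\<^sup>2)"
      proof (rule integral_mono_AE')
        show "integrable (\<mu> p) (\<lambda>y. 2 * c\<^sup>2 * y\<^sup>2 + 2 * (S p p)\<^sup>2 * (y\<^sup>2 - 1 / 2)\<^sup>2)" using i3 by (rule Bochner_Integration.integrable_add)
      qed (use le in auto)
      also have "\<dots> = 2 * c\<^sup>2 * (1 / 2) + 2 * (S p p)\<^sup>2 * expectation (\<lambda>y. (y\<^sup>2 - 1 / 2)\<^sup>2)"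
        using i3 var[OF p] by (simp add: Bochner_Integration.integral_add)
      also have "\<dots> \<le> (b p)\<^sup>2 + (S p p)\<^sup>2 * K\<^sup>2"
      proof -
        have "c\<^sup>2 \<le> (b p)\<^sup>2" using c b0[of p] by (simp flip: abs_le_square_iff)
        moreover have "2 * (S p p)\<^sup>2 * expectation (\<lambda>y. (y\<^sup>2 - 1 / 2)\<^sup>2) \<le> 2 * (S p p)\<^sup>2 * (K\<^sup>2 / 2)"
          by (intro mult_left_mono int(4)) auto
        ultimately show ?thesis by simp
      qed
      finally have "l\<^sup>2 * expectation (\<lambda>y. (D p u y)\<^sup>2) \<le> l\<^sup>2 * ((b p)\<^sup>2 + (S p p)\<^sup>2 * K\<^sup>2)"
        by (intro mult_left_mono) auto
      then show "expectation (\<lambda>y. (l * D p u y)\<^sup>2) \<le> l\<^sup>2 * ((b p)\<^sup>2 + (S p p)\<^sup>2 * K\<^sup>2)"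
        by (simp add: power_mult_distrib)
    qed
  qed
  have "(\<Sum>p\<in>J. l\<^sup>2 * ((b p)\<^sup>2 + (S p p)\<^sup>2 * K\<^sup>2)) = l\<^sup>2 * ((t * K)\<^sup>2 * (\<Sum>p\<in>J. (s p)\<^sup>2) + (\<Sum>p\<in>J. (S p p)\<^sup>2) * K\<^sup>2)"
    unfolding sum_distrib_left[symmetric] sum.distrib b_def
    by (simp add: power_mult_distrib sum_distrib_left sum_distrib_right mult.assoc)
  also have "\<dots> \<le> l\<^sup>2 * ((t * K)\<^sup>2 * (4 * \<Phi>\<^sup>2) + (t * K)\<^sup>2 * \<Phi>\<^sup>2)"
  proof (intro mult_left_mono add_mono stot)
    have "1 * K \<le> t * K" using t K by (intro mult_right_mono) auto
    then have "K\<^sup>2 \<le> (t * K)\<^sup>2" using K by (intro power_mono) auto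
    then have "(\<Sum>p\<in>J. (S p p)\<^sup>2) * K\<^sup>2 \<le> \<Phi>\<^sup>2 * (t * K)\<^sup>2" using diagtot by (intro mult_mono) (auto simp: sum_nonneg)
    then show "(\<Sum>p\<in>J. (S p p)\<^sup>2) * K\<^sup>2 \<le> (t * K)\<^sup>2 * \<Phi>\<^sup>2" by (simp add: mult.commute)
  qed auto
  also have "\<dots> = l\<^sup>2 * (5 * (t * K * \<Phi>)\<^sup>2)" by (simp add: power_mult_distrib)
  also have "\<dots> \<le> l\<^sup>2 * R\<^sup>2"
  proof (intro mult_left_mono)
    have "3 * (t * K * \<Phi>) \<le> R" unfolding R_def using t K \<rho> by simp
    then have "(3 * (t * K * \<Phi>))\<^sup>2 \<le> R\<^sup>2" using t K \<Phi> by (intro power_mono) auto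
    moreover have "(3 * v)\<^sup>2 = 9 * v\<^sup>2" "0 \<le> v\<^sup>2" for v :: real by (auto simp: power_mult_distrib)
    ultimately show "5 * (t * K * \<Phi>)\<^sup>2 \<le> R\<^sup>2" by (smt (verit))
  qed simp
  also have "\<dots> = 1" unfolding l_def using R by (simp add: power_divide)
  finally have mgf1: "(\<integral>\<^sup>+x. ennreal (exp (\<Sum>p\<in>J. l * D p (\<Sum>q\<in>{q\<in>J. r q < r p}. T p q * x q) (x p))) \<partial>PiM J \<mu>) \<le> ennreal (exp 1)"
    by (intro order_trans[OF mgf] ennreal_leI) simp
  have linm: "(\<lambda>x. \<Sum>q\<in>A. c q * x q) \<in> borel_measurable (PiM J \<mu>)" if "A \<subseteq> J" for A c
    using that by (intro borel_measurable_sum borel_measurable_times borel_measurable_const coordinate_measurable) auto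
  have Dm: "(\<lambda>x. l * D p (\<Sum>q\<in>{q\<in>J. r q < r p}. T p q * x q) (x p)) \<in> borel_measurable (PiM J \<mu>)" if "p \<in> J" for p
  proof -
    have "(\<lambda>x. (\<Sum>q\<in>{q\<in>J. r q < r p}. T p q * x q, x p)) \<in> PiM J \<mu> \<rightarrow>\<^sub>M borel \<Otimes>\<^sub>M borel"
      by (intro measurable_Pair linm coordinate_measurable that) auto
    moreover have "(\<lambda>(u, y). l * D p u y) \<in> borel_measurable (borel \<Otimes>\<^sub>M borel)"
      unfolding D_def by measurable
    ultimately show ?thesis using measurable_compose by fastforce
  qed
  \<comment> \<open>E0: the truncated sum is large; Ep p: the truncation is active at coordinate p.\<close>
  define E0 where "E0 = {x \<in> space (PiM J \<mu>). (\<Sum>p\<in>J. l * D p (\<Sum>q\<in>{q\<in>J. r q < r p}. T p q * x q) (x p)) > t}"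
  define Ep where "Ep p = {x \<in> space (PiM J \<mu>). \<bar>\<Sum>q\<in>J. (if r q < r p then T p q else 0) * x q\<bar> > t * (K * s p)}" for p
  have E0m: "E0 \<in> sets (PiM J \<mu>)"
    unfolding E0_def using borel_measurable_sum[of J, OF Dm] by measurable
  have Epm: "Ep p \<in> sets (PiM J \<mu>)" for p
    unfolding Ep_def using linm[of J "\<lambda>q. if r q < r p then T p q else 0"] by measurable
  have E0p: "measure (PiM J \<mu>) E0 \<le> exp (1 - t)"
    unfolding E0_def by (intro markov_exp prob_PiM borel_measurable_sum Dm mgf1)
  have Epp: "measure (PiM J \<mu>) (Ep p) \<le> 2 * exp (1 - t)" for p
    unfolding Ep_def
  proof (rule linear_form_tail[OF s0])
    show "(\<Sum>q\<in>J. (if r q < r p then T p q else 0)\<^sup>2) \<le> (s p)\<^sup>2"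
      unfolding s2 by (intro sum_mono) auto
  qed
  have sub: "{x \<in> space (PiM J \<mu>). (\<Sum>p\<in>J. \<Sum>q\<in>J. S p q * x p * x q) - (\<Sum>p\<in>J. S p p) / 2 > t * R} \<subseteq> E0 \<union> (\<Union>p\<in>J. Ep p)"
  proof
    fix x assume x: "x \<in> {x \<in> space (PiM J \<mu>). (\<Sum>p\<in>J. \<Sum>q\<in>J. S p q * x p * x q) - (\<Sum>p\<in>J. S p p) / 2 > t * R}"
    show "x \<in> E0 \<union> (\<Union>p\<in>J. Ep p)"
    proof (cases "x \<in> (\<Union>p\<in>J. Ep p)")
      case False
      have Lp: "D p (\<Sum>q\<in>{q\<in>J. r q < r p}. T p q * x q) (x p) = x p * (\<Sum>q\<in>{q\<in>J. r q < r p}. T p q * x q) + S p p * ((x p)\<^sup>2 - 1 / 2)"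
        if p: "p \<in> J" for p
      proof -
        have "(\<Sum>q\<in>J. (if r q < r p then T p q else 0) * x q) = (\<Sum>q\<in>{q\<in>J. r q < r p}. T p q * x q)"
          unfolding sum.inter_filter[OF J] by (intro sum.cong refl) simp
        then have "\<bar>\<Sum>q\<in>{q\<in>J. r q < r p}. T p q * x q\<bar> \<le> b p"
          using False p x unfolding Ep_def b_def by auto
        then show ?thesis unfolding D_def by simp
      qed
      have "(\<Sum>p\<in>J. x p * (\<Sum>q\<in>{q\<in>J. r q < r p}. T p q * x q)) + (\<Sum>p\<in>J. S p p * (x p)\<^sup>2)
         = (\<Sum>p\<in>J. \<Sum>q\<in>J. S p q * x p * x q)"
      proof -
        \<comment> \<open>Lower triangular, upper triangular and diagonal part of the form.\<close>
        define L where "L p q = (if r q < r p then S p q * x p * x q else 0)" for p q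
        define U where "U p q = (if r p < r q then S p q * x p * x q else 0)" for p q
        define Dg where "Dg p q = (if p = q then S p q * x p * x q else 0)" for p q
        have split: "S p q * x p * x q = L p q + U p q + Dg p q" for p q
          using inj unfolding L_def U_def Dg_def by (auto dest: injD)
        have "(\<Sum>p\<in>J. x p * (\<Sum>q\<in>{q\<in>J. r q < r p}. T p q * x q)) = (\<Sum>p\<in>J. \<Sum>q\<in>J. L p q + U q p)"
        proof (rule sum.cong[OF refl])
          fix p assume "p \<in> J"
          have "x p * (\<Sum>q\<in>{q\<in>J. r q < r p}. T p q * x q) = (\<Sum>q\<in>{q\<in>J. r q < r p}. S p q * x p * x q + S q p * x q * x p)"
            unfolding sum_distrib_left T_def by (intro sum.cong refl) (simp add: algebra_simps)
          also have "\<dots> = (\<Sum>q\<in>J. L p q + U q p)"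
            unfolding L_def U_def sum.inter_filter[OF J] by (intro sum.cong refl) simp
          finally show "x p * (\<Sum>q\<in>{q\<in>J. r q < r p}. T p q * x q) = (\<Sum>q\<in>J. L p q + U q p)" .
        qed
        also have "\<dots> = (\<Sum>p\<in>J. \<Sum>q\<in>J. L p q) + (\<Sum>p\<in>J. \<Sum>q\<in>J. U q p)" by (simp only: sum.distrib)
        also have "(\<Sum>p\<in>J. \<Sum>q\<in>J. U q p) = (\<Sum>p\<in>J. \<Sum>q\<in>J. U p q)" by (rule sum.swap)
        finally have 1: "(\<Sum>p\<in>J. x p * (\<Sum>q\<in>{q\<in>J. r q < r p}. T p q * x q)) = (\<Sum>p\<in>J. \<Sum>q\<in>J. L p q) + (\<Sum>p\<in>J. \<Sum>q\<in>J. U p q)" .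
        have "(\<Sum>q\<in>J. Dg p q) = S p p * (x p)\<^sup>2" if "p \<in> J" for p
          unfolding Dg_def using J that by (simp add: power2_eq_square)
        then have 2: "(\<Sum>p\<in>J. \<Sum>q\<in>J. Dg p q) = (\<Sum>p\<in>J. S p p * (x p)\<^sup>2)" by (intro sum.cong) auto
        show ?thesis unfolding split sum.distrib 1 2 ..
      qed
      moreover have "(\<Sum>p\<in>J. D p (\<Sum>q\<in>{q\<in>J. r q < r p}. T p q * x q) (x p))
        = (\<Sum>p\<in>J. x p * (\<Sum>q\<in>{q\<in>J. r q < r p}. T p q * x q)) + (\<Sum>p\<in>J. S p p * (x p)\<^sup>2) - (\<Sum>p\<in>J. S p p) / 2"
      proof -
        have "(\<Sum>p\<in>J. D p (\<Sum>q\<in>{q\<in>J. r q < r p}. T p q * x q) (x p))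
          = (\<Sum>p\<in>J. x p * (\<Sum>q\<in>{q\<in>J. r q < r p}. T p q * x q) + S p p * (x p)\<^sup>2 - S p p / 2)"
          by (intro sum.cong refl) (simp only: Lp, simp add: algebra_simps)
        then show ?thesis by (simp only: sum.distrib sum_subtractf sum_divide_distrib)
      qed
      ultimately have "(\<Sum>p\<in>J. D p (\<Sum>q\<in>{q\<in>J. r q < r p}. T p q * x q) (x p)) > t * R" using x by simp
      then have "l * (\<Sum>p\<in>J. D p (\<Sum>q\<in>{q\<in>J. r q < r p}. T p q * x q) (x p)) > t"
        unfolding l_def using R by (simp add: pos_less_divide_eq)
      then show ?thesis using x unfolding E0_def sum_distrib_left by simp
    qed auto
  qed
  have "measure (PiM J \<mu>) {x \<in> space (PiM J \<mu>). (\<Sum>p\<in>J. \<Sum>q\<in>J. S p q * x p * x q) - (\<Sum>p\<in>J. S p p) / 2 > t * R}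
     \<le> measure (PiM J \<mu>) (E0 \<union> (\<Union>p\<in>J. Ep p))"
    by (rule P.finite_measure_mono[OF sub]) (use E0m Epm J in auto)
  also have "\<dots> \<le> measure (PiM J \<mu>) E0 + measure (PiM J \<mu>) (\<Union>p\<in>J. Ep p)"
    by (rule measure_Un_le) (use E0m Epm J in auto)
  also have "measure (PiM J \<mu>) (\<Union>p\<in>J. Ep p) \<le> (\<Sum>p\<in>J. measure (PiM J \<mu>) (Ep p))"
    by (rule measure_UNION_le[OF J]) (use Epm in auto)
  also have "\<dots> \<le> (\<Sum>p\<in>J. 2 * exp (1 - t))" by (intro sum_mono Epp)
  finally show ?thesis using E0p unfolding R_def[symmetric] by (simp add: algebra_simps)
qed

end

section \<open>One row of a Hermitian matrix as a quadratic form\<close>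

text \<open>
  The inverse of \<open>wigner_coord\<close>: the upper triangle carries the real parts and the lower triangle the
  imaginary parts.
\<close>

definition hermitian_of :: "nat \<Rightarrow> (nat \<times> nat \<Rightarrow> real) \<Rightarrow> complex mat" where
  "hermitian_of n y = mat n n (\<lambda>(j, k). if j < k then Complex (y (j, k)) (y (k, j))
     else if j = k then of_real (y (j, j)) else Complex (y (k, j)) (- y (j, k)))"

lemma hermitian_of_carrier [simp]: "hermitian_of n y \<in> carrier_mat n n"
  by (simp add: hermitian_of_def)

lemma hermitian_of_index:
  "j < n \<Longrightarrow> k < n \<Longrightarrow> hermitian_of n y $$ (j, k) = (if j < k then Complex (y (j, k)) (y (k, j))
     else if j = k then of_real (y (j, j)) else Complex (y (k, j)) (- y (j, k)))"
  by (simp add: hermitian_of_def)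

lemma hermitian_of_cnj:
  "j < n \<Longrightarrow> k < n \<Longrightarrow> cnj (hermitian_of n y $$ (j, k)) = hermitian_of n y $$ (k, j)"
  by (auto simp: hermitian_of_index complex_eq_iff)

lemma hermitian_of_wigner_coord:
  assumes X: "X \<omega> \<in> carrier_mat n n" "mat_adjoint (X \<omega>) = X \<omega>"
  shows "hermitian_of n (\<lambda>p. wigner_coord X p \<omega>) = X \<omega>"
proof (rule eq_matI)
  fix j k assume "j < dim_row (X \<omega>)" "k < dim_col (X \<omega>)"
  then have jk: "j < n" "k < n" using X(1) by auto
  have adj: "cnj (X \<omega> $$ (b, a)) = X \<omega> $$ (a, b)" if "a < n" "b < n" for a b
  proof -
    have "mat_adjoint (X \<omega>) $$ (a, b) = conjugate (X \<omega> $$ (b, a))"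
      using X(1) that unfolding mat_adjoint_def by (simp add: mat_of_rows_def)
    then show ?thesis using X(2) by simp
  qed
  show "hermitian_of n (\<lambda>p. wigner_coord X p \<omega>) $$ (j, k) = X \<omega> $$ (j, k)"
    using adj[OF jk(1,2)] adj[OF jk(2,1)] adj[OF jk(1,1)] unfolding hermitian_of_index[OF jk] wigner_coord_def
    by (auto simp: complex_eq_iff)
qed (use X in \<open>auto simp: hermitian_of_def\<close>)

definition row_coords :: "nat \<Rightarrow> nat \<Rightarrow> (nat \<times> nat) set" where
  "row_coords n i = {p \<in> {..<n} \<times> {..<n}. (fst p = i) \<noteq> (snd p = i)}"

lemma finite_row_coords [simp]: "finite (row_coords n i)"
  by (simp add: row_coords_def)

lemma sum_row_coords:
  fixes g :: "nat \<times> nat \<Rightarrow> 'b::comm_monoid_add"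
  assumes "i < n"
  shows "(\<Sum>p\<in>row_coords n i. g p) = (\<Sum>j\<in>{..<n} - {i}. g (i, j) + g (j, i))"
proof -
  have "row_coords n i = (\<lambda>j. (i, j)) ` ({..<n} - {i}) \<union> (\<lambda>j. (j, i)) ` ({..<n} - {i})"
    using assms unfolding row_coords_def by (auto simp: image_iff)
  then have "(\<Sum>p\<in>row_coords n i. g p) = (\<Sum>p\<in>(\<lambda>j. (i, j)) ` ({..<n} - {i}). g p) + (\<Sum>p\<in>(\<lambda>j. (j, i)) ` ({..<n} - {i}). g p)"
    by (simp only:) (rule sum.union_disjoint, auto)
  also have "\<dots> = (\<Sum>j\<in>{..<n} - {i}. g (i, j)) + (\<Sum>j\<in>{..<n} - {i}. g (j, i))"
    by (simp add: sum.reindex inj_on_def)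
  finally show ?thesis by (simp add: sum.distrib)
qed

lemma card_row_coords: "i < n \<Longrightarrow> card (row_coords n i) \<le> 2 * n"
  using sum_row_coords[of i n "\<lambda>_. 1 :: nat"] by simp

definition row_other :: "nat \<Rightarrow> nat \<times> nat \<Rightarrow> nat" where
  "row_other i p = (if fst p = i then snd p else fst p)"

text \<open>
  The factor with which coordinate \<open>p\<close> enters row \<open>i\<close>: \<open>1\<close> for real parts and \<open>\<plusminus>\<i>\<close> for imaginary parts, with the
  minus sign when the entry of the row lies below the diagonal.
\<close>

definition row_phase :: "nat \<Rightarrow> nat \<times> nat \<Rightarrow> complex" where
  "row_phase i p = (if fst p < snd p then 1 else if snd p = i then \<i> else - \<i>)"

lemma norm_row_phase [simp]: "cmod (row_phase i p) = 1"
  by (simp add: row_phase_def)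

lemma row_entry:
  assumes "i < n" "j < n" "j \<noteq> i"
  shows "hermitian_of n y $$ (i, j) = row_phase i (i, j) * of_real (y (i, j)) + row_phase i (j, i) * of_real (y (j, i))"
  using assms by (auto simp: hermitian_of_index row_phase_def complex_eq_iff)

lemma row_quadratic_form:
  assumes i: "i < n"
  shows "(\<Sum>j\<in>{..<n} - {i}. \<Sum>l\<in>{..<n} - {i}. hermitian_of n y $$ (i, j) * B j l * hermitian_of n y $$ (l, i))
    = (\<Sum>p\<in>row_coords n i. \<Sum>q\<in>row_coords n i.
        (row_phase i p * B (row_other i p) (row_other i q) * cnj (row_phase i q)) * of_real (y p) * of_real (y q))"
proof -
  define e where "e = row_phase i"
  have H: "hermitian_of n y $$ (i, j) = e (i, j) * of_real (y (i, j)) + e (j, i) * of_real (y (j, i))"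
    if "j \<in> {..<n} - {i}" for j
    using row_entry[OF i, of j y] that unfolding e_def by auto
  have H': "hermitian_of n y $$ (l, i) = cnj (e (i, l)) * of_real (y (i, l)) + cnj (e (l, i)) * of_real (y (l, i))"
    if "l \<in> {..<n} - {i}" for l
  proof -
    have "hermitian_of n y $$ (l, i) = cnj (hermitian_of n y $$ (i, l))"
      using that i by (intro hermitian_of_cnj[symmetric]) auto
    then show ?thesis unfolding H[OF that] by simp
  qed
  define f where "f p q = (e p * B (row_other i p) (row_other i q) * cnj (e q)) * of_real (y p) * of_real (y q)" for p q
  have "(\<Sum>p\<in>row_coords n i. \<Sum>q\<in>row_coords n i. f p q)
     = (\<Sum>j\<in>{..<n} - {i}. \<Sum>l\<in>{..<n} - {i}. (f (i, j) (i, l) + f (j, i) (i, l)) + (f (i, j) (l, i) + f (j, i) (l, i)))"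
    by (simp only: sum_row_coords[OF i] sum.distrib)
  also have "\<dots> = (\<Sum>j\<in>{..<n} - {i}. \<Sum>l\<in>{..<n} - {i}. hermitian_of n y $$ (i, j) * B j l * hermitian_of n y $$ (l, i))"
  proof (intro sum.cong refl)
    fix j l assume jl: "j \<in> {..<n} - {i}" "l \<in> {..<n} - {i}"
    have o: "row_other i (i, j) = j" "row_other i (j, i) = j" "row_other i (i, l) = l" "row_other i (l, i) = l"
      using jl by (auto simp: row_other_def)
    show "(f (i, j) (i, l) + f (j, i) (i, l)) + (f (i, j) (l, i) + f (j, i) (l, i))
        = hermitian_of n y $$ (i, j) * B j l * hermitian_of n y $$ (l, i)"
      unfolding f_def o H[OF jl(1)] H'[OF jl(2)] by (simp add: algebra_simps)
  qed
  finally show ?thesis unfolding f_def e_def by (rule sym)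
qed

lemma row_coeff_trace:
  assumes i: "i < n"
  shows "(\<Sum>p\<in>row_coords n i. row_phase i p * B (row_other i p) (row_other i p) * cnj (row_phase i p))
     = 2 * (\<Sum>j\<in>{..<n} - {i}. B j j)"
proof -
  have 1: "row_phase i p * b * cnj (row_phase i p) = b" for p and b :: complex
    by (simp add: row_phase_def)
  show ?thesis
    unfolding sum_row_coords[OF i] sum_distrib_left 1 by (intro sum.cong refl) (auto simp: row_other_def)
qed

lemma row_coeff_norm:
  assumes i: "i < n"
  shows "(\<Sum>q\<in>row_coords n i. (cmod (row_phase i p * B (row_other i q) * cnj (row_phase i q)))\<^sup>2) = 2 * (\<Sum>l\<in>{..<n} - {i}. (cmod (B l))\<^sup>2)"
  unfolding sum_row_coords[OF i] sum_distrib_left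
  by (intro sum.cong refl) (auto simp: row_other_def norm_mult)

lemma square_Re_Im_le: "(Re z)\<^sup>2 \<le> (cmod z)\<^sup>2" "(Im z)\<^sup>2 \<le> (cmod z)\<^sup>2"
  by (auto simp: cmod_power2)

context
  fixes \<mu> :: "nat \<times> nat \<Rightarrow> real measure" and n i :: nat and K :: real
  assumes prob: "\<And>p. prob_space (\<mu> p)" and sets: "\<And>p. sets (\<mu> p) = sets borel"
    and i: "i < n" and K: "K \<ge> 1"
    and bnd: "\<And>p. p \<in> row_coords n i \<Longrightarrow> AE y in \<mu> p. \<bar>y\<bar> \<le> K"
    and mean: "\<And>p. p \<in> row_coords n i \<Longrightarrow> (\<integral>y. y \<partial>\<mu> p) = 0"
    and var: "\<And>p. p \<in> row_coords n i \<Longrightarrow> (\<integral>y. y\<^sup>2 \<partial>\<mu> p) = 1 / 2"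
begin

text \<open>
  Each of the four one-sided deviations of real and imaginary part is a real quadratic form in the
  coordinates of the row. Its coefficients have modulus \<open>|B\<^sub>j\<^sub>l|\<close>, each pair \<open>(j, l)\<close> occurring four times; this
  accounts for the factors \<open>1/2\<close> in the assumptions on the norms.
\<close>

lemma row_form_tail:
  fixes B :: "nat \<Rightarrow> nat \<Rightarrow> complex"
  assumes \<rho>: "\<rho> > 0" and \<Phi>: "\<Phi> > 0" and t: "t \<ge> 1"
    and row: "\<And>j. j < n \<Longrightarrow> j \<noteq> i \<Longrightarrow> (\<Sum>l\<in>{..<n}-{i}. (cmod (B j l))\<^sup>2) \<le> (\<rho> / 2)\<^sup>2"
      "\<And>j. j < n \<Longrightarrow> j \<noteq> i \<Longrightarrow> (\<Sum>l\<in>{..<n}-{i}. (cmod (B l j))\<^sup>2) \<le> (\<rho> / 2)\<^sup>2"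
    and fro: "(\<Sum>j\<in>{..<n}-{i}. \<Sum>l\<in>{..<n}-{i}. (cmod (B j l))\<^sup>2) \<le> (\<Phi> / 2)\<^sup>2"
  shows "emeasure (PiM (row_coords n i) \<mu>) {y \<in> space (PiM (row_coords n i) \<mu>).
      cmod ((\<Sum>j\<in>{..<n} - {i}. \<Sum>l\<in>{..<n} - {i}. hermitian_of n y $$ (i, j) * B j l * hermitian_of n y $$ (l, i))
         - (\<Sum>j\<in>{..<n} - {i}. B j j)) > 2 * (t * (3 * t * K * \<Phi> + 3 * t * K\<^sup>2 * \<rho>))}
     \<le> ennreal (4 * (1 + 4 * real n) * exp (1 - t))"
proof -
  define J where "J = row_coords n i"
  define C where "C p q = row_phase i p * B (row_other i p) (row_other i q) * cnj (row_phase i q)" for p q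
  define R where "R = t * (3 * t * K * \<Phi> + 3 * t * K\<^sup>2 * \<rho>)"
  interpret P: prob_space "PiM J \<mu>" by (intro prob_space_PiM prob)
  have other: "row_other i p < n \<and> row_other i p \<noteq> i" if "p \<in> J" for p
    using that unfolding J_def row_coords_def row_other_def by auto
  have Crow: "(\<Sum>q\<in>J. (cmod (C p q))\<^sup>2) \<le> \<rho>\<^sup>2" if "p \<in> J" for p
  proof -
    have "(\<Sum>q\<in>J. (cmod (C p q))\<^sup>2) = 2 * (\<Sum>l\<in>{..<n} - {i}. (cmod (B (row_other i p) l))\<^sup>2)"
      unfolding J_def C_def by (rule row_coeff_norm[OF i])
    also have "\<dots> \<le> 2 * (\<rho> / 2)\<^sup>2" using row(1) other[OF that] by simp
    finally show ?thesis by (simp add: power_divide) (smt (verit) zero_le_power2)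
  qed
  have Ccol: "(\<Sum>q\<in>J. (cmod (C q p))\<^sup>2) \<le> \<rho>\<^sup>2" if "p \<in> J" for p
  proof -
    have "(\<Sum>q\<in>J. (cmod (C q p))\<^sup>2) = (\<Sum>q\<in>J. (cmod (row_phase i p * B (row_other i q) (row_other i p) * cnj (row_phase i q)))\<^sup>2)"
      unfolding C_def by (simp add: norm_mult)
    also have "\<dots> = 2 * (\<Sum>l\<in>{..<n} - {i}. (cmod (B l (row_other i p)))\<^sup>2)"
      unfolding J_def by (rule row_coeff_norm[OF i, where B = "\<lambda>l. B l (row_other i p)"])
    also have "\<dots> \<le> 2 * (\<rho> / 2)\<^sup>2" using row(2) other[OF that] by simp
    finally show ?thesis by (simp add: power_divide) (smt (verit) zero_le_power2)
  qed
  have Cfro: "(\<Sum>p\<in>J. \<Sum>q\<in>J. (cmod (C p q))\<^sup>2) \<le> \<Phi>\<^sup>2"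
  proof -
    have "(\<Sum>p\<in>J. \<Sum>q\<in>J. (cmod (C p q))\<^sup>2) = (\<Sum>p\<in>J. 2 * (\<Sum>l\<in>{..<n} - {i}. (cmod (B (row_other i p) l))\<^sup>2))"
      unfolding J_def C_def by (intro sum.cong refl row_coeff_norm[OF i])
    also have "\<dots> = 4 * (\<Sum>j\<in>{..<n}-{i}. \<Sum>l\<in>{..<n}-{i}. (cmod (B j l))\<^sup>2)"
      unfolding J_def sum_row_coords[OF i] sum_distrib_left[symmetric]
      by (simp add: row_other_def sum_distrib_left)
    also have "\<dots> \<le> \<Phi>\<^sup>2" using fro by (simp add: power_divide)
    finally show ?thesis .
  qed
  define Q where "Q y = (\<Sum>p\<in>J. \<Sum>q\<in>J. C p q * of_real (y p) * of_real (y q)) - (\<Sum>p\<in>J. C p p) / 2" for y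
  have Qe: "(\<Sum>j\<in>{..<n} - {i}. \<Sum>l\<in>{..<n} - {i}. hermitian_of n y $$ (i, j) * B j l * hermitian_of n y $$ (l, i))
         - (\<Sum>j\<in>{..<n} - {i}. B j j) = Q y" for y
    unfolding row_quadratic_form[OF i] Q_def C_def J_def row_coeff_trace[OF i] by simp
  define E where "E S = {y \<in> space (PiM J \<mu>). (\<Sum>p\<in>J. \<Sum>q\<in>J. S p q * y p * y q) - (\<Sum>p\<in>J. S p p) / 2 > R}" for S
  have comp: "(\<lambda>y. y p) \<in> borel_measurable (PiM J \<mu>)" if "p \<in> J" for p
    using measurable_component_singleton[OF that, of \<mu>] by (simp cong: measurable_cong_sets add: sets)
  have Em: "E S \<in> sets (PiM J \<mu>)" for S
  proof -
    have "(\<lambda>y. (\<Sum>p\<in>J. \<Sum>q\<in>J. S p q * y p * y q) - (\<Sum>p\<in>J. S p p) / 2) \<in> borel_measurable (PiM J \<mu>)"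
      by (intro borel_measurable_diff borel_measurable_sum borel_measurable_times borel_measurable_const comp)
    then show ?thesis unfolding E_def by measurable
  qed
  have bound: "measure (PiM J \<mu>) (E S) \<le> (1 + 4 * real n) * exp (1 - t)"
    if S: "\<And>p q. (S p q)\<^sup>2 \<le> (cmod (C p q))\<^sup>2" for S
  proof -
    have "measure (PiM J \<mu>) (E S) \<le> (1 + 2 * real (card J)) * exp (1 - t)"
      unfolding E_def R_def
    proof (rule quadratic_form_upper_tail[OF prob sets _ _ K _ _ _ \<rho> \<Phi> t])
      show "inj prod_encode" by (rule inj_prod_encode)
      show "(\<Sum>q\<in>J. (S p q)\<^sup>2) \<le> \<rho>\<^sup>2" if "p \<in> J" for p
        using sum_mono[of J "\<lambda>q. (S p q)\<^sup>2" "\<lambda>q. (cmod (C p q))\<^sup>2"] S Crow[OF that] by fastforce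
      show "(\<Sum>q\<in>J. (S q p)\<^sup>2) \<le> \<rho>\<^sup>2" if "p \<in> J" for p
        using sum_mono[of J "\<lambda>q. (S q p)\<^sup>2" "\<lambda>q. (cmod (C q p))\<^sup>2"] S Ccol[OF that] by fastforce
      show "(\<Sum>p\<in>J. \<Sum>q\<in>J. (S p q)\<^sup>2) \<le> \<Phi>\<^sup>2"
        by (rule order_trans[OF _ Cfro]) (intro sum_mono S)
    qed (use bnd mean var in \<open>auto simp: J_def\<close>)
    also have "\<dots> \<le> (1 + 2 * real (2 * n)) * exp (1 - t)"
      using card_row_coords[OF i] unfolding J_def by (intro mult_right_mono add_mono mult_left_mono) auto
    finally show ?thesis by simp
  qed
  define S1 where "S1 p q = Re (C p q)" for p q
  define S2 where "S2 p q = - Re (C p q)" for p q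
  define S3 where "S3 p q = Im (C p q)" for p q
  define S4 where "S4 p q = - Im (C p q)" for p q
  have ReQ: "Re (Q y) = (\<Sum>p\<in>J. \<Sum>q\<in>J. S1 p q * y p * y q) - (\<Sum>p\<in>J. S1 p p) / 2"
    and ReQ': "- Re (Q y) = (\<Sum>p\<in>J. \<Sum>q\<in>J. S2 p q * y p * y q) - (\<Sum>p\<in>J. S2 p p) / 2"
    and ImQ: "Im (Q y) = (\<Sum>p\<in>J. \<Sum>q\<in>J. S3 p q * y p * y q) - (\<Sum>p\<in>J. S3 p p) / 2"
    and ImQ': "- Im (Q y) = (\<Sum>p\<in>J. \<Sum>q\<in>J. S4 p q * y p * y q) - (\<Sum>p\<in>J. S4 p p) / 2" for y
    unfolding Q_def S1_def S2_def S3_def S4_def by (simp_all add: sum_negf)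
  have sub: "{y \<in> space (PiM J \<mu>). cmod (Q y) > 2 * R} \<subseteq> (E S1 \<union> E S2) \<union> (E S3 \<union> E S4)"
  proof
    fix y assume y: "y \<in> {y \<in> space (PiM J \<mu>). cmod (Q y) > 2 * R}"
    then have "2 * R < \<bar>Re (Q y)\<bar> + \<bar>Im (Q y)\<bar>" using cmod_le[of "Q y"] by simp
    then have "Re (Q y) > R \<or> - Re (Q y) > R \<or> Im (Q y) > R \<or> - Im (Q y) > R" by linarith
    moreover have "E S1 = {y \<in> space (PiM J \<mu>). Re (Q y) > R}" unfolding E_def ReQ ..
    moreover have "E S2 = {y \<in> space (PiM J \<mu>). - Re (Q y) > R}" unfolding E_def ReQ' ..
    moreover have "E S3 = {y \<in> space (PiM J \<mu>). Im (Q y) > R}" unfolding E_def ImQ ..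
    moreover have "E S4 = {y \<in> space (PiM J \<mu>). - Im (Q y) > R}" unfolding E_def ImQ' ..
    ultimately show "y \<in> (E S1 \<union> E S2) \<union> (E S3 \<union> E S4)"
      using y by blast
  qed
  have "measure (PiM J \<mu>) ((E S1 \<union> E S2) \<union> (E S3 \<union> E S4))
    \<le> (measure (PiM J \<mu>) (E S1) + measure (PiM J \<mu>) (E S2)) + (measure (PiM J \<mu>) (E S3) + measure (PiM J \<mu>) (E S4))"
    by (intro order_trans[OF measure_Un_le] add_mono measure_Un_le sets.Un Em)
  also have "\<dots> \<le> 4 * (1 + 4 * real n) * exp (1 - t)"
  proof -
    define c where "c = (1 + 4 * real n) * exp (1 - t)"
    have "measure (PiM J \<mu>) (E S1) \<le> c" "measure (PiM J \<mu>) (E S2) \<le> c"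
      "measure (PiM J \<mu>) (E S3) \<le> c" "measure (PiM J \<mu>) (E S4) \<le> c"
      unfolding c_def by (intro bound; simp add: S1_def S2_def S3_def S4_def square_Re_Im_le)+
    then show ?thesis unfolding mult.assoc[of 4] c_def[symmetric] by linarith
  qed
  finally have "emeasure (PiM J \<mu>) ((E S1 \<union> E S2) \<union> (E S3 \<union> E S4)) \<le> ennreal (4 * (1 + 4 * real n) * exp (1 - t))"
    by (simp add: P.emeasure_eq_measure ennreal_leI)
  moreover have "emeasure (PiM J \<mu>) {y \<in> space (PiM J \<mu>). cmod (Q y) > 2 * R} \<le> emeasure (PiM J \<mu>) ((E S1 \<union> E S2) \<union> (E S3 \<union> E S4))"
    by (rule emeasure_mono[OF sub]) (intro sets.Un Em)
  ultimately show ?thesis unfolding Qe R_def[symmetric] J_def[symmetric] by (rule order_trans[rotated])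
qed

end

section \<open>Decoupling a row\<close>

text \<open>
  Setting the coordinates of row \<open>i\<close> to \<open>0\<close> removes the row and the column and keeps the dimension. The diagonal
  entry stays, since the formulas for the decoupled resolvent only involve the other indices.
\<close>

definition decouple :: "nat \<Rightarrow> nat \<Rightarrow> (nat \<times> nat \<Rightarrow> real) \<Rightarrow> nat \<times> nat \<Rightarrow> real" where
  "decouple n i y p = (if p \<in> row_coords n i then 0 else y p)"

definition decoupled_resolvent :: "nat \<Rightarrow> complex mat \<Rightarrow> complex \<Rightarrow> nat \<Rightarrow> (nat \<times> nat \<Rightarrow> real) \<Rightarrow> nat \<Rightarrow> nat \<Rightarrow> complex" where
  "decoupled_resolvent n A z i y = resolvent (deformed_wigner n (hermitian_of n (decouple n i y)) A) z"

definition frobenius_minor :: "nat \<Rightarrow> nat \<Rightarrow> (nat \<Rightarrow> nat \<Rightarrow> complex) \<Rightarrow> real" where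
  "frobenius_minor n i B = sqrt (\<Sum>j\<in>{..<n}-{i}. \<Sum>l\<in>{..<n}-{i}. (cmod (B j l))\<^sup>2)"

definition row_fluctuation :: "nat \<Rightarrow> nat \<Rightarrow> (nat \<Rightarrow> nat \<Rightarrow> complex) \<Rightarrow> (nat \<times> nat \<Rightarrow> real) \<Rightarrow> complex" where
  "row_fluctuation n i B y =
     (\<Sum>j\<in>{..<n} - {i}. \<Sum>l\<in>{..<n} - {i}. hermitian_of n y $$ (i, j) * B j l * hermitian_of n y $$ (l, i))
       - (\<Sum>j\<in>{..<n} - {i}. B j j)"

text \<open>
  The deviation bound of \<open>row_form_tail\<close> for the resolvent \<open>B\<close> at height \<open>h\<close>. The norm of a row of \<open>B\<close> is at most
  \<open>1/h\<close>, and the summand \<open>1/h\<close> next to the Frobenius norm keeps that parameter positive.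
\<close>

definition row_threshold :: "nat \<Rightarrow> nat \<Rightarrow> real \<Rightarrow> real \<Rightarrow> real \<Rightarrow> (nat \<Rightarrow> nat \<Rightarrow> complex) \<Rightarrow> real" where
  "row_threshold n i t K h B = 2 * (t * (3 * t * K * (2 * frobenius_minor n i B + 1 / h) + 3 * t * K\<^sup>2 * (2 / h)))"

definition row_bad :: "nat \<Rightarrow> complex mat \<Rightarrow> complex \<Rightarrow> real \<Rightarrow> real \<Rightarrow> nat \<Rightarrow> (nat \<times> nat \<Rightarrow> real) \<Rightarrow> bool" where
  "row_bad n A z t K i y \<longleftrightarrow>
     cmod (row_fluctuation n i (decoupled_resolvent n A z i y) y)
       > row_threshold n i t K (Im z) (decoupled_resolvent n A z i y)"

lemma deformed_wigner_carrier [simp]: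
  "A \<in> carrier_mat n n \<Longrightarrow> H \<in> carrier_mat n n \<Longrightarrow> deformed_wigner n H A \<in> carrier_mat n n"
  by (simp add: deformed_wigner_def)

lemma deformed_wigner_index:
  "A \<in> carrier_mat n n \<Longrightarrow> H \<in> carrier_mat n n \<Longrightarrow> j < n \<Longrightarrow> k < n \<Longrightarrow>
    deformed_wigner n H A $$ (j, k) = of_real (1 / sqrt (real n)) * H $$ (j, k) + A $$ (j, k)"
  by (simp add: deformed_wigner_def)

definition real_diagonal :: "nat \<Rightarrow> complex mat \<Rightarrow> bool" where
  "real_diagonal n A \<longleftrightarrow> A \<in> carrier_mat n n \<and> (\<forall>j<n. \<forall>k<n. A $$ (j, k) = (if j = k then of_real (Re (A $$ (j, j))) else 0))"

lemma real_diagonal_carrier: "real_diagonal n A \<Longrightarrow> A \<in> carrier_mat n n"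
  by (simp add: real_diagonal_def)

lemma hermitian_deformed:
  assumes "real_diagonal n A"
  shows "hermitian_on n (\<lambda>j k. deformed_wigner n (hermitian_of n y) A $$ (j, k))"
  unfolding hermitian_on_def
proof (intro allI impI)
  fix j k assume jk: "j < n" "k < n"
  have A: "A \<in> carrier_mat n n" using assms by (simp add: real_diagonal_def)
  have "cnj (A $$ (j, k)) = A $$ (k, j)"
  proof -
    have "A $$ (j, k) = (if j = k then of_real (Re (A $$ (j, j))) else 0)" "A $$ (k, j) = (if k = j then of_real (Re (A $$ (k, k))) else 0)"
      using assms jk unfolding real_diagonal_def by blast+
    then show ?thesis by (metis complex_cnj_complex_of_real complex_cnj_zero)
  qed
  then show "deformed_wigner n (hermitian_of n y) A $$ (k, j) = cnj (deformed_wigner n (hermitian_of n y) A $$ (j, k))"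
    by (simp only: deformed_wigner_index[OF A hermitian_of_carrier] jk complex_cnj_add complex_cnj_mult
        complex_cnj_complex_of_real hermitian_of_cnj[OF jk])
qed

lemma hermitian_of_cong:
  assumes "\<And>p. p \<in> {..<n} \<times> {..<n} \<Longrightarrow> y p = y' p"
  shows "hermitian_of n y = hermitian_of n y'"
  unfolding hermitian_of_def by (rule cong_mat) (auto simp: assms)

lemma measurable_hermitian_of:
  assumes "j < n" "k < n" "(\<lambda>x. f x (j, k)) \<in> borel_measurable N" "(\<lambda>x. f x (k, j)) \<in> borel_measurable N"
  shows "(\<lambda>x. hermitian_of n (f x) $$ (j, k)) \<in> borel_measurable N"
proof -
  have C: "Complex a b = of_real a + \<i> * of_real b" for a b by (simp add: complex_eq_iff)
  consider "j < k" | "j = k" | "\<not> j < k" "j \<noteq> k" by linarith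
  then show ?thesis
  proof cases
    case 1
    then show ?thesis unfolding hermitian_of_index[OF assms(1,2)] C using assms(3,4) by simp
  next
    case 2
    then show ?thesis unfolding hermitian_of_index[OF assms(1,2)] using assms(3) by simp
  next
    case 3
    then show ?thesis unfolding hermitian_of_index[OF assms(1,2)] C using assms(3,4) by simp
  qed
qed

context
  fixes \<mu> :: "nat \<times> nat \<Rightarrow> real measure" and n i :: nat and K t :: real and A :: "complex mat" and z :: complex
  assumes prob: "\<And>p. prob_space (\<mu> p)" and sets: "\<And>p. sets (\<mu> p) = sets borel"
    and i: "i < n" and K: "K \<ge> 1" and t: "t \<ge> 1" and A: "real_diagonal n A" and z: "Im z > 0"
    and bnd: "\<And>p. p \<in> row_coords n i \<Longrightarrow> AE y in \<mu> p. \<bar>y\<bar> \<le> K"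
    and mean: "\<And>p. p \<in> row_coords n i \<Longrightarrow> (\<integral>y. y \<partial>\<mu> p) = 0"
    and var: "\<And>p. p \<in> row_coords n i \<Longrightarrow> (\<integral>y. y\<^sup>2 \<partial>\<mu> p) = 1 / 2"
begin

lemma PiM_coordinate_measurable: "p \<in> S \<Longrightarrow> (\<lambda>y. y p) \<in> borel_measurable (PiM S \<mu>)"
  using measurable_component_singleton[of p S \<mu>] by (simp cong: measurable_cong_sets add: sets)

lemma measurable_fluctuation:
  assumes S: "row_coords n i \<subseteq> S"
    and B: "\<And>j l. j < n \<Longrightarrow> l < n \<Longrightarrow> (\<lambda>y. B y j l) \<in> borel_measurable (PiM S \<mu>)"
  shows "(\<lambda>y. row_fluctuation n i (B y) y) \<in> borel_measurable (PiM S \<mu>)"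
proof -
  have H: "(\<lambda>y. hermitian_of n y $$ (i, j)) \<in> borel_measurable (PiM S \<mu>)"
    "(\<lambda>y. hermitian_of n y $$ (j, i)) \<in> borel_measurable (PiM S \<mu>)" if "j \<in> {..<n} - {i}" for j
    using that i S by (auto intro!: measurable_hermitian_of PiM_coordinate_measurable simp: row_coords_def)
  show ?thesis unfolding row_fluctuation_def
    by (intro borel_measurable_diff borel_measurable_sum borel_measurable_times H B) auto
qed

lemma measurable_row_bad:
  "{y \<in> space (PiM ({..<n} \<times> {..<n}) \<mu>). row_bad n A z t K i y} \<in> sets (PiM ({..<n} \<times> {..<n}) \<mu>)"
proof -
  let ?P = "PiM ({..<n} \<times> {..<n}) \<mu>"
  have B: "(\<lambda>y. decoupled_resolvent n A z i y j l) \<in> borel_measurable ?P" if "j < n" "l < n" for j l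
    unfolding decoupled_resolvent_def
  proof (rule borel_measurable_resolvent[OF _ _ that])
    fix a b assume ab: "a < n" "b < n"
    have "(\<lambda>y. hermitian_of n (decouple n i y) $$ (a, b)) \<in> borel_measurable ?P"
    proof (rule measurable_hermitian_of[OF ab])
      show "(\<lambda>x. decouple n i x (a, b)) \<in> borel_measurable ?P"
        using ab by (cases "(a, b) \<in> row_coords n i") (simp_all add: decouple_def PiM_coordinate_measurable)
      show "(\<lambda>x. decouple n i x (b, a)) \<in> borel_measurable ?P"
        using ab by (cases "(b, a) \<in> row_coords n i") (simp_all add: decouple_def PiM_coordinate_measurable)
    qed
    then show "(\<lambda>y. deformed_wigner n (hermitian_of n (decouple n i y)) A $$ (a, b)) \<in> borel_measurable ?P"
      unfolding deformed_wigner_index[OF real_diagonal_carrier[OF A] hermitian_of_carrier ab] by simp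
  qed (use real_diagonal_carrier[OF A] in simp)
  have "(\<lambda>y. row_fluctuation n i (decoupled_resolvent n A z i y) y) \<in> borel_measurable ?P"
    by (rule measurable_fluctuation[OF _ B]) (auto simp: row_coords_def)
  moreover have "(\<lambda>y. row_threshold n i t K (Im z) (decoupled_resolvent n A z i y)) \<in> borel_measurable ?P"
  proof -
    have "(\<lambda>y. \<Sum>j\<in>{..<n}-{i}. \<Sum>l\<in>{..<n}-{i}. (cmod (decoupled_resolvent n A z i y j l))\<^sup>2) \<in> borel_measurable ?P"
    proof (intro borel_measurable_sum borel_measurable_power)
      fix j l assume "j \<in> {..<n}-{i}" "l \<in> {..<n}-{i}"
      then have "(\<lambda>y. decoupled_resolvent n A z i y j l) \<in> borel_measurable ?P" by (intro B) auto
      then show "(\<lambda>y. cmod (decoupled_resolvent n A z i y j l)) \<in> borel_measurable ?P" by measurable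
    qed
    then show ?thesis unfolding row_threshold_def frobenius_minor_def by measurable
  qed
  ultimately show ?thesis unfolding row_bad_def by measurable
qed

text \<open>
  Fubini: for fixed remaining coordinates the decoupled resolvent is constant and \<open>row_form_tail\<close> applies to the
  coordinates of row \<open>i\<close>.
\<close>

lemma row_bad_emeasure:
  "emeasure (PiM ({..<n} \<times> {..<n}) \<mu>) {y \<in> space (PiM ({..<n} \<times> {..<n}) \<mu>). row_bad n A z t K i y}
     \<le> ennreal (4 * (1 + 4 * real n) * exp (1 - t))"
proof -
  define P where "P = {..<n} \<times> {..<n}"
  define J where "J = row_coords n i"
  define S where "S = P - J"
  have JP: "J \<subseteq> P" unfolding J_def P_def row_coords_def by auto
  have fin: "finite S" "finite J" unfolding S_def P_def J_def by auto
  have SJ: "S \<inter> J = {}" "S \<union> J = P" using JP unfolding S_def by auto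
  interpret product_sigma_finite \<mu>
    unfolding product_sigma_finite_def using prob prob_space_imp_sigma_finite by blast
  interpret PS: prob_space "PiM S \<mu>" by (intro prob_space_PiM prob)
  define bad where "bad = {y \<in> space (PiM P \<mu>). row_bad n A z t K i y}"
  define c where "c = ennreal (4 * (1 + 4 * real n) * exp (1 - t))"
  have bads: "bad \<in> sets (PiM P \<mu>)" unfolding bad_def P_def by (rule measurable_row_bad)
  have "emeasure (PiM P \<mu>) bad = (\<integral>\<^sup>+y. indicator bad y \<partial>PiM P \<mu>)" using bads by simp
  also have "\<dots> = (\<integral>\<^sup>+b. (\<integral>\<^sup>+a. indicator bad (merge S J (b, a)) \<partial>PiM J \<mu>) \<partial>PiM S \<mu>)"
    using product_nn_integral_fold[OF SJ(1) fin, of "indicator bad"] bads unfolding SJ(2) by simp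
  also have "\<dots> \<le> (\<integral>\<^sup>+b. c \<partial>PiM S \<mu>)"
  proof (rule nn_integral_mono)
    fix b assume b: "b \<in> space (PiM S \<mu>)"
    define B where "B = resolvent (deformed_wigner n (hermitian_of n (decouple n i b)) A) z"
    have Bm: "decoupled_resolvent n A z i (merge S J (b, a)) = B" for a
    proof -
      have "hermitian_of n (decouple n i (merge S J (b, a))) = hermitian_of n (decouple n i b)"
        by (rule hermitian_of_cong) (auto simp: decouple_def merge_def S_def J_def P_def)
      then show ?thesis unfolding decoupled_resolvent_def B_def by simp
    qed
    have Hm: "hermitian_of n (merge S J (b, a)) $$ (i, j) = hermitian_of n a $$ (i, j)"
      "hermitian_of n (merge S J (b, a)) $$ (j, i) = hermitian_of n a $$ (j, i)" if "j \<in> {..<n} - {i}" for a j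
    proof -
      have J: "(i, j) \<in> J" "(j, i) \<in> J" using that i unfolding J_def row_coords_def by auto
      then have "merge S J (b, a) (i, j) = a (i, j)" "merge S J (b, a) (j, i) = a (j, i)"
        unfolding merge_def S_def by auto
      then show "hermitian_of n (merge S J (b, a)) $$ (i, j) = hermitian_of n a $$ (i, j)"
        "hermitian_of n (merge S J (b, a)) $$ (j, i) = hermitian_of n a $$ (j, i)"
        using that i by (auto simp: hermitian_of_index)
    qed
    have fl: "row_fluctuation n i B (merge S J (b, a)) = row_fluctuation n i B a" for a
    proof -
      have "(\<Sum>j\<in>{..<n} - {i}. \<Sum>l\<in>{..<n} - {i}. hermitian_of n (merge S J (b, a)) $$ (i, j) * B j l * hermitian_of n (merge S J (b, a)) $$ (l, i))
        = (\<Sum>j\<in>{..<n} - {i}. \<Sum>l\<in>{..<n} - {i}. hermitian_of n a $$ (i, j) * B j l * hermitian_of n a $$ (l, i))"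
        by (intro sum.cong refl) (simp only: Hm)
      then show ?thesis unfolding row_fluctuation_def by simp
    qed
    define T where "T = row_threshold n i t K (Im z) B"
    define badb where "badb = {a \<in> space (PiM J \<mu>). cmod (row_fluctuation n i B a) > T}"
    have "(\<lambda>a. row_fluctuation n i B a) \<in> borel_measurable (PiM J \<mu>)"
      by (rule measurable_fluctuation) (auto simp: J_def)
    then have badbs: "badb \<in> sets (PiM J \<mu>)" unfolding badb_def by measurable
    have "(\<integral>\<^sup>+a. indicator bad (merge S J (b, a)) \<partial>PiM J \<mu>) = (\<integral>\<^sup>+a. indicator badb a \<partial>PiM J \<mu>)"
    proof (rule nn_integral_cong)
      fix a assume a: "a \<in> space (PiM J \<mu>)"
      have sp: "merge S J (b, a) \<in> space (PiM P \<mu>)"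
        using a b unfolding space_PiM SJ(2)[symmetric] by (subst PiE_cancel_merge[OF SJ(1)]) (auto simp: PiE_def)
      have "row_bad n A z t K i (merge S J (b, a)) \<longleftrightarrow> cmod (row_fluctuation n i B a) > T"
        unfolding row_bad_def Bm fl T_def ..
      then show "indicator bad (merge S J (b, a)) = indicator badb a"
        using a sp unfolding bad_def badb_def by (simp add: indicator_def)
    qed
    also have "\<dots> = emeasure (PiM J \<mu>) badb" using badbs by simp
    also have "\<dots> \<le> c"
    proof -
      define V where "V j k = deformed_wigner n (hermitian_of n (decouple n i b)) A $$ (j, k)" for j k
      have hV: "hermitian_on n V" unfolding V_def by (rule hermitian_deformed[OF A])
      have rB: "is_resolvent n V z B"
        unfolding B_def V_def by (rule is_resolvent_resolvent) (use real_diagonal_carrier[OF A] z hermitian_deformed[OF A] in auto)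
      have F0: "frobenius_minor n i B \<ge> 0" unfolding frobenius_minor_def by (simp add: sum_nonneg)
      show ?thesis unfolding badb_def T_def row_threshold_def c_def J_def row_fluctuation_def
      proof (rule row_form_tail[OF prob sets i K bnd mean var])
        show "(\<Sum>l\<in>{..<n} - {i}. (cmod (B j l))\<^sup>2) \<le> (2 / Im z / 2)\<^sup>2" if "j < n" "j \<noteq> i" for j
        proof -
          have "(\<Sum>l\<in>{..<n} - {i}. (cmod (B j l))\<^sup>2) \<le> (\<Sum>l<n. (cmod (B j l))\<^sup>2)" by (intro sum_mono2) auto
          then show ?thesis using resolvent_row_bound(1)[OF hV rB that(1) z] by simp
        qed
        show "(\<Sum>l\<in>{..<n} - {i}. (cmod (B l j))\<^sup>2) \<le> (2 / Im z / 2)\<^sup>2" if "j < n" "j \<noteq> i" for j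
        proof -
          have "(\<Sum>l\<in>{..<n} - {i}. (cmod (B l j))\<^sup>2) \<le> (\<Sum>l<n. (cmod (B l j))\<^sup>2)" by (intro sum_mono2) auto
          then show ?thesis using resolvent_row_bound(2)[OF hV rB that(1) z] by simp
        qed
        have "(\<Sum>j\<in>{..<n}-{i}. \<Sum>l\<in>{..<n}-{i}. (cmod (B j l))\<^sup>2) = (frobenius_minor n i B)\<^sup>2"
          unfolding frobenius_minor_def by (simp add: sum_nonneg)
        also have "\<dots> \<le> ((2 * frobenius_minor n i B + 1 / Im z) / 2)\<^sup>2"
          using F0 z by (intro power_mono) auto
        finally show "(\<Sum>j\<in>{..<n}-{i}. \<Sum>l\<in>{..<n}-{i}. (cmod (B j l))\<^sup>2) \<le> ((2 * frobenius_minor n i B + 1 / Im z) / 2)\<^sup>2" .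
        show "2 * frobenius_minor n i B + 1 / Im z > 0" using F0 z by (simp add: add_nonneg_pos)
      qed (use z t in auto)
    qed
    finally show "(\<integral>\<^sup>+a. indicator bad (merge S J (b, a)) \<partial>PiM J \<mu>) \<le> c" .
  qed
  also have "\<dots> = c" by (simp add: PS.emeasure_space_1)
  finally show ?thesis unfolding bad_def c_def P_def .
qed

end


lemma row_bad_cong:
  assumes "\<And>p. p \<in> {..<n} \<times> {..<n} \<Longrightarrow> y p = y' p"
  shows "row_bad n A z t K i y = row_bad n A z t K i y'"
proof -
  have "hermitian_of n y = hermitian_of n y'" by (rule hermitian_of_cong[OF assms])
  moreover have "hermitian_of n (decouple n i y) = hermitian_of n (decouple n i y')"
    by (rule hermitian_of_cong) (simp add: decouple_def assms)
  ultimately show ?thesis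
    unfolding row_bad_def row_fluctuation_def decoupled_resolvent_def by simp
qed

lemma atom_law_moments:
  assumes "atom_law \<nu> v"
  shows "prob_space \<nu>" "sets \<nu> = sets borel" "(\<integral>y. y \<partial>\<nu>) = 0" "(\<integral>y. y\<^sup>2 \<partial>\<nu>) = v" "integrable \<nu> (\<lambda>y. y\<^sup>2)"
  using assms unfolding atom_law_def real_distribution_def real_distribution_axioms_def by auto

lemma wigner_coord_measurable:
  assumes w: "wigner_hermitian M n \<nu> \<nu>' X" and p: "p \<in> {..<n} \<times> {..<n}"
  shows "wigner_coord X p \<in> borel_measurable M"
proof -
  interpret prob_space M using w by (simp add: wigner_hermitian_def)
  have "indep_vars (\<lambda>_. borel) (wigner_coord X) ({..<n} \<times> {..<n})" using w by (simp add: wigner_hermitian_def)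
  then show ?thesis using p unfolding indep_vars_def by blast
qed

lemma wigner_coord_law:
  assumes w: "wigner_hermitian M n \<nu> \<nu>' X" and p: "p \<in> {..<n} \<times> {..<n}"
  shows "distr M borel (wigner_coord X p) = (if fst p = snd p then \<nu>' else \<nu>)"
  using w p unfolding wigner_hermitian_def by auto

lemma wigner_coord_bounded:
  assumes w: "wigner_hermitian M n \<nu> \<nu>' X" and p: "p \<in> {..<n} \<times> {..<n}"
    and b: "AE \<omega> in M. \<forall>i<n. \<forall>j<n. cmod (X \<omega> $$ (i, j)) \<le> K"
  shows "AE y in (if fst p = snd p then \<nu>' else \<nu>). \<bar>y\<bar> \<le> K"
  unfolding wigner_coord_law[OF w p, symmetric]
proof (subst AE_distr_iff[OF wigner_coord_measurable[OF w p]])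
  show "AE \<omega> in M. \<bar>wigner_coord X p \<omega>\<bar> \<le> K"
    using b
  proof eventually_elim
    case (elim \<omega>)
    have "cmod (X \<omega> $$ (fst p, snd p)) \<le> K" "cmod (X \<omega> $$ (snd p, fst p)) \<le> K" using elim p by auto
    then show ?case
      using abs_Re_le_cmod[of "X \<omega> $$ (fst p, snd p)"] abs_Im_le_cmod[of "X \<omega> $$ (snd p, fst p)"]
      unfolding wigner_coord_def by (auto split: prod.split)
  qed
qed measurable

text \<open>
  The diagonal entries have variance \<open>1\<close>, which a smaller bound would preclude.
\<close>

lemma wigner_bound_ge_1:
  assumes w: "wigner_hermitian M n \<nu> \<nu>' X" and n: "n > 0"
    and b: "AE \<omega> in M. \<forall>i<n. \<forall>j<n. cmod (X \<omega> $$ (i, j)) \<le> K"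
  shows "K \<ge> 1"
proof -
  have law: "atom_law \<nu>' 1" using w by (simp add: wigner_hermitian_def)
  note m = atom_law_moments[OF law]
  interpret N: prob_space \<nu>' by (rule m(1))
  have "(0, 0) \<in> {..<n} \<times> {..<n}" using n by simp
  from wigner_coord_bounded[OF w this b] have bd: "AE y in \<nu>'. \<bar>y\<bar> \<le> K" unfolding fst_conv snd_conv if_P[OF refl] .
  have K0: "K \<ge> 0"
  proof (rule ccontr)
    assume "\<not> K \<ge> 0"
    have "AE y in \<nu>'. False" using bd by eventually_elim (use \<open>\<not> K \<ge> 0\<close> in linarith)
    then show False by (simp only: N.AE_False)
  qed
  have "AE y in \<nu>'. y\<^sup>2 \<le> K\<^sup>2" using bd by eventually_elim (use K0 in \<open>auto simp flip: abs_le_square_iff\<close>)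
  then have "(\<integral>y. y\<^sup>2 \<partial>\<nu>') \<le> (\<integral>y. K\<^sup>2 \<partial>\<nu>')" by (intro integral_mono_AE m(5)) auto
  then have "1\<^sup>2 \<le> K\<^sup>2" using m(4) by (simp add: N.prob_space)
  then show ?thesis using K0 by (rule power2_le_imp_le)
qed

text \<open>
  By independence the coordinates have a product law, so that \<open>row_bad_emeasure\<close> applies to their joint
  distribution.
\<close>

lemma wigner_row_bad:
  assumes w: "wigner_hermitian M n \<nu> \<nu>' X" and i: "i < n" and t: "t \<ge> 1" and A: "real_diagonal n A" and z: "Im z > 0"
    and b: "AE \<omega> in M. \<forall>i<n. \<forall>j<n. cmod (X \<omega> $$ (i, j)) \<le> K"
  shows "{\<omega> \<in> space M. row_bad n A z t K i (\<lambda>p. wigner_coord X p \<omega>)} \<in> sets M"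
    "measure M {\<omega> \<in> space M. row_bad n A z t K i (\<lambda>p. wigner_coord X p \<omega>)} \<le> 4 * (1 + 4 * real n) * exp (1 - t)"
proof -
  interpret prob_space M using w by (simp add: wigner_hermitian_def)
  define P where "P = {..<n} \<times> {..<n}"
  define \<mu> where "\<mu> p = (if fst p = snd p then \<nu>' else \<nu>)" for p :: "nat \<times> nat"
  have laws: "atom_law \<nu> (1/2)" "atom_law \<nu>' 1" using w by (auto simp: wigner_hermitian_def)
  note m = atom_law_moments[OF laws(1)] and m' = atom_law_moments[OF laws(2)]
  have prob: "prob_space (\<mu> p)" and sets: "sets (\<mu> p) = sets borel" for p
    using m m' unfolding \<mu>_def by auto
  have off: "\<mu> p = \<nu>" if "p \<in> row_coords n i" for p
    using that unfolding \<mu>_def row_coords_def by auto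
  have K: "K \<ge> 1" using wigner_bound_ge_1[OF w _ b] i by simp
  have bnd: "AE y in \<mu> p. \<bar>y\<bar> \<le> K" if "p \<in> row_coords n i" for p
    using wigner_coord_bounded[OF w _ b, of p] that unfolding \<mu>_def row_coords_def by auto
  define Y where "Y \<omega> = (\<lambda>p\<in>P. wigner_coord X p \<omega>)" for \<omega>
  have Ym: "Y \<in> M \<rightarrow>\<^sub>M PiM P (\<lambda>_. borel)"
    unfolding Y_def using wigner_coord_measurable[OF w] unfolding P_def by (intro measurable_restrict) auto
  have "distr M (PiM P (\<lambda>_. borel)) Y = PiM P (\<lambda>p. distr M borel (wigner_coord X p))"
    unfolding Y_def
  proof (subst indep_vars_iff_distr_eq_PiM'[symmetric])
    show "P \<noteq> {}" using i unfolding P_def by auto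
    show "indep_vars (\<lambda>_. borel) (wigner_coord X) P" using w unfolding P_def by (simp add: wigner_hermitian_def)
  qed (use wigner_coord_measurable[OF w] in \<open>auto simp: P_def\<close>)
  also have "\<dots> = PiM P \<mu>"
    by (rule PiM_cong) (auto simp: wigner_coord_law[OF w] \<mu>_def P_def)
  finally have D: "distr M (PiM P (\<lambda>_. borel)) Y = PiM P \<mu>" .
  have sP: "sets (PiM P \<mu>) = sets (PiM P (\<lambda>_. borel))" by (rule sets_PiM_cong) (auto simp: sets)
  have spP: "space (PiM P \<mu>) = space (PiM P (\<lambda>_. borel))" by (rule sets_eq_imp_space_eq[OF sP])
  define bad where "bad = {y \<in> space (PiM P \<mu>). row_bad n A z t K i y}"
  have bads: "bad \<in> sets (PiM P \<mu>)"
    unfolding bad_def P_def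
    by (rule measurable_row_bad[OF prob sets i K t A z bnd]) (use off m in auto)
  have pre: "{\<omega> \<in> space M. row_bad n A z t K i (\<lambda>p. wigner_coord X p \<omega>)} = Y -` bad \<inter> space M"
  proof -
    have "row_bad n A z t K i (\<lambda>p. wigner_coord X p \<omega>) = row_bad n A z t K i (Y \<omega>)" for \<omega>
      by (rule row_bad_cong) (simp add: Y_def P_def)
    then show ?thesis using measurable_space[OF Ym] unfolding bad_def spP by auto
  qed
  show "{\<omega> \<in> space M. row_bad n A z t K i (\<lambda>p. wigner_coord X p \<omega>)} \<in> sets M"
    unfolding pre using measurable_sets[OF Ym] bads sP by simp
  have "emeasure M (Y -` bad \<inter> space M) = emeasure (PiM P \<mu>) bad"
    using emeasure_distr[OF Ym] bads sP D by simp
  also have "\<dots> \<le> ennreal (4 * (1 + 4 * real n) * exp (1 - t))"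
    unfolding bad_def P_def
    by (rule row_bad_emeasure[OF prob sets i K t A z bnd]) (use off m in auto)
  finally show "measure M {\<omega> \<in> space M. row_bad n A z t K i (\<lambda>p. wigner_coord X p \<omega>)} \<le> 4 * (1 + 4 * real n) * exp (1 - t)"
    unfolding pre by (simp add: emeasure_eq_measure)
qed

text \<open>
  The Schur complement, with the quadratic form replaced by the trace of the decoupled resolvent and that
  trace by the full one. The Frobenius norm is expressed through \<open>Im s\<close> by the Ward identity.
\<close>

theorem local_equation:
  fixes n i :: nat and y A z
  defines "W \<equiv> deformed_wigner n (hermitian_of n y) A"
  defines "G \<equiv> resolvent W z"
  defines "s \<equiv> (\<Sum>j<n. G j j) / of_nat n"
  assumes i: "i < n" and A: "real_diagonal n A" and z: "Im z > 0" and K: "K \<ge> 1" and t: "t \<ge> 1"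
    and good: "\<not> row_bad n A z t K i y" and diag: "\<bar>y (i, i)\<bar> \<le> K"
  shows "cmod (1 / G i i - (A $$ (i, i) - (z + s)))
     \<le> K / sqrt (real n) + (6 * t\<^sup>2 * K * (2 * sqrt ((real n * Im s + 1 / Im z) / Im z) + 1 / Im z)
           + 12 * t\<^sup>2 * K\<^sup>2 / Im z + 1 / Im z) / real n"
proof -
  define V where "V j k = deformed_wigner n (hermitian_of n (decouple n i y)) A $$ (j, k)" for j k
  define B where "B = decoupled_resolvent n A z i y"
  define H where "H = hermitian_of n y"
  have n: "real n > 0" using i by simp
  have Ac: "A \<in> carrier_mat n n" using A by (simp add: real_diagonal_def)
  have A0: "A $$ (j, k) = 0" if "j < n" "k < n" "j \<noteq> k" for j k using A that by (simp add: real_diagonal_def)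
  have hW: "hermitian_on n (\<lambda>j k. W $$ (j, k))" unfolding W_def by (rule hermitian_deformed[OF A])
  have hV: "hermitian_on n V" unfolding V_def by (rule hermitian_deformed[OF A])
  have rG: "is_resolvent n (\<lambda>j k. W $$ (j, k)) z G"
    unfolding G_def by (rule is_resolvent_resolvent) (use Ac z hW in \<open>auto simp: W_def\<close>)
  have rB: "is_resolvent n V z B"
    unfolding B_def decoupled_resolvent_def V_def by (rule is_resolvent_resolvent) (use Ac z hermitian_deformed[OF A] in auto)
  have We: "W $$ (j, k) = of_real (1 / sqrt (real n)) * H $$ (j, k) + A $$ (j, k)" if "j < n" "k < n" for j k
    unfolding W_def H_def by (rule deformed_wigner_index[OF Ac _ that]) simp
  have VW: "V j k = W $$ (j, k)" if jk: "j < n" "k < n" "j \<noteq> i" "k \<noteq> i" for j k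
  proof -
    have nr: "(j, k) \<notin> row_coords n i" "(k, j) \<notin> row_coords n i" using jk by (auto simp: row_coords_def)
    have "hermitian_of n (decouple n i y) $$ (j, k) = hermitian_of n y $$ (j, k)"
      unfolding hermitian_of_index[OF jk(1,2)] using nr by (auto simp: decouple_def)
    then show ?thesis
      unfolding V_def We[OF jk(1,2)] deformed_wigner_index[OF Ac hermitian_of_carrier jk(1,2)] H_def by simp
  qed
  have V0: "V j i = 0" if j: "j < n" "j \<noteq> i" for j
  proof -
    have r: "(j, i) \<in> row_coords n i" "(i, j) \<in> row_coords n i" using j i by (auto simp: row_coords_def)
    have "hermitian_of n (decouple n i y) $$ (j, i) = 0"
      unfolding hermitian_of_index[OF j(1) i] using r j by (auto simp: decouple_def complex_eq_iff)
    then show ?thesis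
      unfolding V_def deformed_wigner_index[OF Ac hermitian_of_carrier j(1) i] using A0[OF j(1) i j(2)] by simp
  qed
  note ctx = hW hV i z rG rB VW V0
  define Q where "Q = (\<Sum>j\<in>{..<n} - {i}. \<Sum>l\<in>{..<n} - {i}. H $$ (i, j) * B j l * H $$ (l, i))"
  have "1 / G i i = W $$ (i, i) - z - (\<Sum>j\<in>{..<n}-{i}. \<Sum>l\<in>{..<n}-{i}. W $$ (i, j) * B j l * W $$ (l, i))"
    by (rule schur_complement[OF ctx])
  also have "(\<Sum>j\<in>{..<n}-{i}. \<Sum>l\<in>{..<n}-{i}. W $$ (i, j) * B j l * W $$ (l, i)) = Q / of_nat n"
  proof -
    have c2: "complex_of_real (1 / sqrt (real n)) * complex_of_real (1 / sqrt (real n)) = 1 / of_nat n"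
      using n by (simp flip: of_real_mult add: real_sqrt_mult_self) 
    have "W $$ (i, j) * B j l * W $$ (l, i) = H $$ (i, j) * B j l * H $$ (l, i) / of_nat n"
      if "j \<in> {..<n}-{i}" "l \<in> {..<n}-{i}" for j l
    proof -
      have "W $$ (i, j) = of_real (1 / sqrt (real n)) * H $$ (i, j)" "W $$ (l, i) = of_real (1 / sqrt (real n)) * H $$ (l, i)"
        using that i A0 by (auto simp: We)
      then have "W $$ (i, j) * B j l * W $$ (l, i)
        = (complex_of_real (1 / sqrt (real n)) * complex_of_real (1 / sqrt (real n))) * (H $$ (i, j) * B j l * H $$ (l, i))"
        by (simp only: mult_ac)
      then show ?thesis unfolding c2 by simp
    qed
    then show ?thesis unfolding Q_def sum_divide_distrib by (intro sum.cong refl) auto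
  qed
  also have "W $$ (i, i) = of_real (y (i, i) / sqrt (real n)) + A $$ (i, i)"
    unfolding We[OF i i] H_def using i by (simp add: hermitian_of_index)
  finally have g: "1 / G i i = of_real (y (i, i) / sqrt (real n)) + A $$ (i, i) - z - Q / of_nat n" .
  define TB where "TB = (\<Sum>j\<in>{..<n}-{i}. B j j)"
  define TG where "TG = (\<Sum>j<n. G j j)"
  have tr: "cmod (TG - TB) \<le> 1 / Im z" unfolding TG_def TB_def by (rule decoupled_trace[OF ctx])
  have fl: "row_fluctuation n i B y = Q - TB" unfolding row_fluctuation_def Q_def TB_def H_def ..
  have sT: "s = TG / of_nat n" unfolding s_def TG_def ..
  have eq: "1 / G i i - (A $$ (i, i) - (z + s)) = of_real (y (i, i) / sqrt (real n)) + ((TG - TB) - (Q - TB)) / of_nat n"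
    unfolding g sT by (simp add: diff_divide_distrib)
  have F: "frobenius_minor n i B \<le> sqrt ((real n * Im s + 1 / Im z) / Im z)"
  proof -
    have "Im z * (\<Sum>j\<in>{..<n}-{i}. \<Sum>l\<in>{..<n}-{i}. (cmod (B j l))\<^sup>2) \<le> Im TB"
      unfolding TB_def by (rule decoupled_trace_frobenius[OF ctx])
    also have "Im TB \<le> Im TG + 1 / Im z" using tr abs_Im_le_cmod[of "TG - TB"] by simp
    also have "Im TG = real n * Im s"
    proof -
      have "TG = of_real (real n) * s" unfolding sT using n by simp
      then show ?thesis by (simp only: times_complex.sel Re_complex_of_real Im_complex_of_real)
    qed
    finally have "(\<Sum>j\<in>{..<n}-{i}. \<Sum>l\<in>{..<n}-{i}. (cmod (B j l))\<^sup>2) \<le> (real n * Im s + 1 / Im z) / Im z"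
      using z by (simp add: pos_le_divide_eq mult.commute)
    then show ?thesis unfolding frobenius_minor_def by (rule real_sqrt_le_mono)
  qed
  have flb: "cmod (Q - TB) \<le> 6 * t\<^sup>2 * K * (2 * sqrt ((real n * Im s + 1 / Im z) / Im z) + 1 / Im z) + 12 * t\<^sup>2 * K\<^sup>2 / Im z"
  proof -
    have "cmod (Q - TB) \<le> row_threshold n i t K (Im z) B"
      using good unfolding row_bad_def B_def[symmetric] fl by simp
    also have "\<dots> = 6 * t\<^sup>2 * K * (2 * frobenius_minor n i B + 1 / Im z) + 12 * t\<^sup>2 * K\<^sup>2 / Im z"
      unfolding row_threshold_def by (simp add: algebra_simps power2_eq_square)
    also have "\<dots> \<le> 6 * t\<^sup>2 * K * (2 * sqrt ((real n * Im s + 1 / Im z) / Im z) + 1 / Im z) + 12 * t\<^sup>2 * K\<^sup>2 / Im z"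
      using F K t by (intro add_mono mult_left_mono) auto
    finally show ?thesis .
  qed
  have "cmod (1 / G i i - (A $$ (i, i) - (z + s))) \<le> cmod (of_real (y (i, i) / sqrt (real n))) + cmod (((TG - TB) - (Q - TB)) / of_nat n)"
    unfolding eq by (rule norm_triangle_ineq)
  also have "cmod (of_real (y (i, i) / sqrt (real n))) = \<bar>y (i, i)\<bar> / sqrt (real n)" by (simp only: norm_of_real abs_divide) simp
  also have "\<dots> \<le> K / sqrt (real n)" using diag by (intro divide_right_mono) auto
  also have "cmod (((TG - TB) - (Q - TB)) / of_nat n) \<le> (1 / Im z + cmod (Q - TB)) / real n"
    using norm_triangle_ineq4[of "TG - TB" "Q - TB"] tr
    by (simp only: norm_divide norm_of_nat) (intro divide_right_mono, auto)
  also have "(1 / Im z + cmod (Q - TB)) / real n \<le> (6 * t\<^sup>2 * K * (2 * sqrt ((real n * Im s + 1 / Im z) / Im z) + 1 / Im z)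
           + 12 * t\<^sup>2 * K\<^sup>2 / Im z + 1 / Im z) / real n"
    using flb by (intro divide_right_mono) auto
  finally show ?thesis by simp
qed

section \<open>The averaged self-consistent equation\<close>

text \<open>
  Two disjoint classes of \<open>n/2\<close> indices exhaust \<open>{..<n}\<close>, so an average over the source is an average over its
  two values.
\<close>

lemma source_sum:
  fixes d :: "nat \<Rightarrow> real" and f :: "real \<Rightarrow> complex"
  assumes n: "n > 0" and a: "a > 0"
    and c: "2 * card {i. i < n \<and> d i = a} = n" "2 * card {i. i < n \<and> d i = - a} = n"
  shows "\<forall>i<n. d i = a \<or> d i = - a" "(\<Sum>i<n. f (d i)) = of_nat n * ((f a + f (- a)) / 2)"
proof -
  define P where "P = {i. i < n \<and> d i = a}"
  define Q where "Q = {i. i < n \<and> d i = - a}"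
  have fin: "finite P" "finite Q" unfolding P_def Q_def by auto
  have dis: "P \<inter> Q = {}" using a unfolding P_def Q_def by auto
  have "card (P \<union> Q) = n" using card_Un_disjoint[OF fin dis] c unfolding P_def[symmetric] Q_def[symmetric] by simp
  moreover have "P \<union> Q \<subseteq> {..<n}" unfolding P_def Q_def by auto
  ultimately have PQ: "P \<union> Q = {..<n}" by (intro card_subset_eq) auto
  then show "\<forall>i<n. d i = a \<or> d i = - a" unfolding P_def Q_def by blast
  have "(\<Sum>i<n. f (d i)) = (\<Sum>i\<in>P. f (d i)) + (\<Sum>i\<in>Q. f (d i))"
    unfolding PQ[symmetric] by (rule sum.union_disjoint[OF fin dis])
  also have "(\<Sum>i\<in>P. f (d i)) = of_nat (card P) * f a"
  proof -
    have "(\<Sum>i\<in>P. f (d i)) = (\<Sum>i\<in>P. f a)" by (intro sum.cong) (auto simp: P_def)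
    then show ?thesis by simp
  qed
  also have "(\<Sum>i\<in>Q. f (d i)) = of_nat (card Q) * f (- a)"
  proof -
    have "(\<Sum>i\<in>Q. f (d i)) = (\<Sum>i\<in>Q. f (- a))" by (intro sum.cong) (auto simp: Q_def)
    then show ?thesis by simp
  qed
  finally have s: "(\<Sum>i<n. f (d i)) = of_nat (card P) * f a + of_nat (card Q) * f (- a)" .
  have "of_nat n = (2 * of_nat (card P) :: complex)" "of_nat n = (2 * of_nat (card Q) :: complex)"
    using c unfolding P_def[symmetric] Q_def[symmetric] by (metis of_nat_mult of_nat_numeral)+
  then have "of_nat (card P) = (of_nat n / 2 :: complex)" "of_nat (card Q) = (of_nat n / 2 :: complex)" by auto
  then show "(\<Sum>i<n. f (d i)) = of_nat n * ((f a + f (- a)) / 2)"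
    unfolding s by (simp add: algebra_simps)
qed

text \<open>
  The error is allowed to grow with \<open>Im s\<close>, so \<open>Im s\<close> has to be bounded: if it were large, all
  \<open>1/g i\<close> would have modulus at least \<open>1\<close>, and then \<open>|s| \<le> 1\<close> as an average of the \<open>g i\<close>. At distance \<open>k\<close> from
  the poles the errors of the individual equations are then amplified by at most \<open>2/k\<^sup>2\<close>, and averaging the
  \<open>g i\<close> gives the Stieltjes transform of the source.
\<close>

lemma approximate_source_equation:
  fixes n :: nat and g :: "nat \<Rightarrow> complex" and d :: "nat \<Rightarrow> real"
  defines "s \<equiv> (\<Sum>i<n. g i) / of_nat n"
  assumes n: "n > 0" and a: "a > 0" and k: "0 < k" "k \<le> 1" and th: "0 \<le> \<theta>" "\<theta> \<le> k ^ 3 / 10"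
    and c: "2 * card {i. i < n \<and> d i = a} = n" "2 * card {i. i < n \<and> d i = - a} = n"
    and z: "Im z > 0" and Is: "Im s > 0"
    and g: "\<And>i. i < n \<Longrightarrow> g i \<noteq> 0"
    and err: "\<And>i. i < n \<Longrightarrow> cmod (1 / g i - (of_real (d i) - (z + s))) \<le> \<theta> * (1 + sqrt (Im s))"
  shows "Im s \<le> 3 / 2"
    and "k \<le> cmod (z + s - of_real a) \<Longrightarrow> k \<le> cmod (z + s + of_real a) \<Longrightarrow>
         cmod (s - source_stieltjes a (z + s)) \<le> k"
proof -
  define e where "e i = 1 / g i - (of_real (d i) - (z + s))" for i
  have k3: "k ^ 3 \<le> k" using k by (metis power_decreasing[of 1 3 k] le_less one_le_numeral power_one_right)
  have th1: "\<theta> \<le> 1 / 10" using th k k3 by linarith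
  have avg: "cmod s \<le> B" if B: "\<And>i. i < n \<Longrightarrow> cmod (g i) \<le> B" for B
  proof -
    have "cmod (\<Sum>i<n. g i) \<le> (\<Sum>i<n. B)" by (intro sum_norm_le) (use B in auto)
    then show ?thesis unfolding s_def using n by (simp add: norm_divide divide_le_eq mult.commute)
  qed
  show s32: "Im s \<le> 3 / 2"
  proof (rule ccontr)
    assume "\<not> Im s \<le> 3 / 2"
    then have big: "Im s > 3 / 2" by simp
    have sq: "sqrt (Im s) \<le> Im s"
      using big by (intro real_le_lsqrt) (auto simp: power2_eq_square)
    have "cmod (g i) \<le> 1" if i: "i < n" for i
    proof -
      have "\<theta> * (1 + sqrt (Im s)) \<le> (1 / 10) * (1 + Im s)" using th1 th sq big by (intro mult_mono) auto
      then have ei: "cmod (e i) \<le> (1 / 10) * (1 + Im s)" using err[OF i] unfolding e_def by linarith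
      have "Im (1 / g i) = Im (e i) - Im z - Im s" unfolding e_def by simp
      moreover have "q \<le> - 1" if "q = p - v - x" "c \<le> 1 / 10 * (1 + x)" "\<bar>p\<bar> \<le> c" "v > 0" "x > 3 / 2" for p q c v x :: real
        using that by (simp add: abs_le_iff)
      ultimately have "Im (1 / g i) \<le> - 1" using ei abs_Im_le_cmod[of "e i"] z big by blast
      then have "cmod (1 / g i) \<ge> 1" using abs_Im_le_cmod[of "1 / g i"] by linarith
      then show ?thesis using g[OF i] by (simp add: norm_divide le_divide_eq)
    qed
    then have "cmod s \<le> 1" by (rule avg)
    then show False using abs_Im_le_cmod[of s] big by linarith
  qed
  assume far: "k \<le> cmod (z + s - of_real a)" "k \<le> cmod (z + s + of_real a)"
  have src: "\<forall>i<n. d i = a \<or> d i = - a" by (rule source_sum(1)[OF n a c])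
  have bfar: "k \<le> cmod (of_real (d i) - (z + s))" if "i < n" for i
  proof -
    have "cmod (of_real a - (z + s)) = cmod (z + s - of_real a)" by (rule norm_minus_commute)
    moreover have "cmod (of_real (- a) - (z + s)) = cmod (z + s + of_real a)"
    proof -
      have "of_real (- a) - (z + s) = - (z + s + of_real a)" by simp
      then show ?thesis by (simp only: norm_minus_cancel)
    qed
    ultimately show ?thesis using src that far by metis
  qed
  have ek: "cmod (e i) \<le> k ^ 3 / 4" if i: "i < n" for i
  proof -
    have "sqrt (Im s) \<le> 3 / 2" by (rule real_le_lsqrt) (use s32 Is in \<open>auto simp: power2_eq_square\<close>)
    then have "\<theta> * (1 + sqrt (Im s)) \<le> (k ^ 3 / 10) * (5 / 2)" using th Is k by (intro mult_mono) auto
    then show ?thesis using err[OF i] unfolding e_def by simp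
  qed
  have diff: "cmod (g i - 1 / (of_real (d i) - (z + s))) \<le> k" if i: "i < n" for i
  proof -
    define b where "b = of_real (d i) - (z + s)"
    have b: "k \<le> cmod b" "b \<noteq> 0" using bfar[OF i] k unfolding b_def by auto
    have ge: "1 / g i = b + e i" unfolding e_def b_def by simp
    have gi: "g i \<noteq> 0" by (rule g[OF i])
    have "k / 2 \<le> cmod (b + e i)"
      using b ek[OF i] k3 k norm_diff_ineq[of b "e i"] by linarith
    then have be: "k / 2 \<le> cmod (b + e i)" "b + e i \<noteq> 0" using k by auto
    have "g i = 1 / (b + e i)" using ge gi by (metis divide_divide_eq_right div_by_1 mult_1)
    moreover have "1 / x - 1 / b = (b - x) / (x * b)" if "x \<noteq> 0" for x :: complex
      using that b(2) by (simp add: field_simps)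
    from this[OF be(2)] have "1 / (b + e i) - 1 / b = - e i / ((b + e i) * b)" by simp
    ultimately have "g i - 1 / b = - e i / ((b + e i) * b)" by simp
    then have "cmod (g i - 1 / b) = cmod (e i) / (cmod (b + e i) * cmod b)" by (simp add: norm_divide norm_mult)
    also have "\<dots> \<le> (k ^ 3 / 4) / ((k / 2) * k)"
      using ek[OF i] be b k by (intro frac_le mult_mono mult_pos_pos) auto
    also have "\<dots> = k / 2" using k by (simp add: power3_eq_cube)
    finally show ?thesis using k unfolding b_def by simp
  qed
  have F: "(\<Sum>i<n. 1 / (of_real (d i) - (z + s))) = of_nat n * source_stieltjes a (z + s)"
    using source_sum(2)[OF n a c, of "\<lambda>x. 1 / (of_real x - (z + s))"] unfolding source_stieltjes_def by simp
  have "s - source_stieltjes a (z + s) = (\<Sum>i<n. g i - 1 / (of_real (d i) - (z + s))) / of_nat n"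
  proof -
    have "source_stieltjes a (z + s) = (\<Sum>i<n. 1 / (of_real (d i) - (z + s))) / of_nat n" using F n by simp
    then have "s - source_stieltjes a (z + s) = (\<Sum>i<n. g i) / of_nat n - (\<Sum>i<n. 1 / (of_real (d i) - (z + s))) / of_nat n"
      unfolding s_def by simp
    then show ?thesis by (simp only: sum_subtractf diff_divide_distrib)
  qed
  moreover have "cmod (\<Sum>i<n. g i - 1 / (of_real (d i) - (z + s))) \<le> (\<Sum>i<n. k)"
    by (intro sum_norm_le) (use diff in auto)
  ultimately show "cmod (s - source_stieltjes a (z + s)) \<le> k"
    using n by (simp add: norm_divide divide_le_eq mult.commute)
qed

definition stieltjes :: "nat \<Rightarrow> (nat \<Rightarrow> real) \<Rightarrow> complex \<Rightarrow> complex" where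
  "stieltjes n lam z = (\<Sum>i<n. 1 / (of_real (lam i) - z)) / of_nat n"

lemma Im_stieltjes:
  "Im (stieltjes n lam (Complex E y)) = (\<Sum>i<n. poisson y (lam i - E)) / real n"
proof -
  have "Im (1 / (of_real l - Complex E y)) = poisson y (l - E)" for l
    unfolding Im_inverse_source by (simp add: poisson_def cmod_power2)
  then have "Im (\<Sum>i<n. 1 / (of_real (lam i) - Complex E y)) = (\<Sum>i<n. poisson y (lam i - E))" by simp
  then show ?thesis unfolding stieltjes_def by (simp add: Im_divide_of_nat)
qed

lemma resolvent_lipschitz:
  fixes l :: real
  assumes "Im z > 0" "Im z' > 0"
  shows "cmod (1 / (of_real l - z) - 1 / (of_real l - z')) \<le> cmod (z - z') / (Im z * Im z')"
proof -
  define u where "u = of_real l - z"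
  define v where "v = of_real l - z'"
  have uv: "Im z \<le> cmod u" "Im z' \<le> cmod v"
    using abs_Im_le_cmod[of u] abs_Im_le_cmod[of v] assms unfolding u_def v_def by auto
  then have "u \<noteq> 0" "v \<noteq> 0" using assms by auto
  then have "1 / u - 1 / v = (v - u) / (u * v)" by (simp add: field_simps)
  also have "v - u = z - z'" unfolding u_def v_def by simp
  finally have "cmod (1 / u - 1 / v) = cmod (z - z') / (cmod u * cmod v)" by (simp add: norm_divide norm_mult)
  also have "\<dots> \<le> cmod (z - z') / (Im z * Im z')"
    using uv assms by (intro divide_left_mono mult_mono mult_pos_pos) auto
  finally show ?thesis unfolding u_def v_def .
qed

lemma stieltjes_lipschitz:
  assumes n: "n > 0" and z: "Im z > 0" "Im z' > 0"
  shows "cmod (stieltjes n lam z - stieltjes n lam z') \<le> cmod (z - z') / (Im z * Im z')"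
proof -
  have "stieltjes n lam z - stieltjes n lam z' = (\<Sum>i<n. 1 / (of_real (lam i) - z) - 1 / (of_real (lam i) - z')) / of_nat n"
    unfolding stieltjes_def by (simp add: sum_subtractf diff_divide_distrib)
  moreover have "cmod (\<Sum>i<n. 1 / (of_real (lam i) - z) - 1 / (of_real (lam i) - z')) \<le> (\<Sum>i<n. cmod (z - z') / (Im z * Im z'))"
    by (intro sum_norm_le resolvent_lipschitz z)
  ultimately show ?thesis using n by (simp add: norm_divide divide_le_eq mult.commute)
qed

lemma stieltjes_Im_pos:
  assumes n: "n > 0" and y: "y > 0"
  shows "Im (stieltjes n lam (Complex E y)) > 0"
proof -
  have "poisson y x > 0" for x using y unfolding poisson_def by (intro divide_pos_pos add_nonneg_pos) auto
  then have "(\<Sum>i<n. poisson y (lam i - E)) > 0" using n by (intro sum_pos) auto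
  then show ?thesis unfolding Im_stieltjes using n by simp
qed

lemma stieltjes_Im_le:
  assumes n: "n > 0" and y: "y > 0"
  shows "Im (stieltjes n lam (Complex E y)) \<le> 1 / y"
proof -
  have "poisson y x \<le> 1 / y" for x
  proof -
    have "y / (x\<^sup>2 + y\<^sup>2) \<le> y / y\<^sup>2" using y by (intro divide_left_mono mult_pos_pos add_nonneg_pos) auto
    then show ?thesis using y unfolding poisson_def by (simp add: power2_eq_square)
  qed
  then have "(\<Sum>i<n. poisson y (lam i - E)) \<le> (\<Sum>i<n. 1 / y)" by (intro sum_mono)
  then show ?thesis unfolding Im_stieltjes using n by (simp add: divide_le_eq mult.commute)
qed

lemma source_stieltjes_lipschitz:
  assumes k: "k > 0" and w: "k \<le> cmod (w - of_real a)" "k \<le> cmod (w + of_real a)"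
    and w': "k \<le> cmod (w' - of_real a)" "k \<le> cmod (w' + of_real a)"
  shows "cmod (source_stieltjes a w - source_stieltjes a w') \<le> cmod (w - w') / k\<^sup>2"
proof -
  have main: "cmod (1 / (b - w) - 1 / (b - w')) \<le> cmod (w - w') / k\<^sup>2"
    if "k \<le> cmod (b - w)" "k \<le> cmod (b - w')" for b
  proof -
    define u where "u = b - w"
    define v where "v = b - w'"
    have uv: "k \<le> cmod u" "k \<le> cmod v" using that unfolding u_def v_def .
    then have "u \<noteq> 0" "v \<noteq> 0" using k by auto
    then have "1 / u - 1 / v = (v - u) / (u * v)" by (simp add: field_simps)
    also have "v - u = w - w'" unfolding u_def v_def by simp
    finally have "cmod (1 / u - 1 / v) = cmod (w - w') / (cmod u * cmod v)" by (simp add: norm_divide norm_mult)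
    also have "\<dots> \<le> cmod (w - w') / (k * k)"
      using uv k by (intro divide_left_mono mult_mono mult_pos_pos) auto
    finally show ?thesis unfolding u_def v_def by (simp add: power2_eq_square)
  qed
  have flip: "cmod (- of_real a - x) = cmod (x + of_real a)" for x
  proof -
    have "- of_real a - x = - (x + of_real a)" by simp
    then show ?thesis by (simp only: norm_minus_cancel)
  qed
  define P where "P = 1 / (of_real a - w) - 1 / (of_real a - w')"
  define Q where "Q = 1 / (- of_real a - w) - 1 / (- of_real a - w')"
  have "source_stieltjes a w - source_stieltjes a w' = (P + Q) / 2"
    unfolding source_stieltjes_def P_def Q_def by (simp add: diff_divide_distrib add_divide_distrib)
  then have "cmod (source_stieltjes a w - source_stieltjes a w') = cmod (P + Q) / 2"
    by (simp only: norm_divide) simp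
  then have "cmod (source_stieltjes a w - source_stieltjes a w') \<le> (cmod P + cmod Q) / 2"
    using norm_triangle_ineq[of P Q] by simp
  moreover have "cmod P \<le> cmod (w - w') / k\<^sup>2" unfolding P_def
    by (rule main) (use w w' in \<open>simp_all add: norm_minus_commute\<close>)
  moreover have "cmod Q \<le> cmod (w - w') / k\<^sup>2" unfolding Q_def
    by (rule main) (use w w' in \<open>simp_all add: flip\<close>)
  ultimately show ?thesis by argo
qed

text \<open>
  Away from the poles \<open>F\<close> is Lipschitz, so the equation at a grid point implies it nearby with a four times larger
  tolerance.
\<close>

lemma approximate_equation_nearby:
  assumes k: "0 < k" "k \<le> 1" and h: "0 \<le> h" "h \<le> k ^ 3 / 8"
    and ww: "cmod (w - w') \<le> h" and ss: "cmod (s - s') \<le> h"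
    and far: "k \<le> cmod (w - of_real a)" "k \<le> cmod (w + of_real a)"
    and near: "k / 4 \<le> cmod (w' - of_real a) \<Longrightarrow> k / 4 \<le> cmod (w' + of_real a) \<Longrightarrow> cmod (s' - source_stieltjes a w') \<le> k / 4"
  shows "cmod (s - source_stieltjes a w) \<le> k"
proof -
  have k3: "k ^ 3 \<le> k" using k by (metis power_decreasing[of 1 3 k] le_less one_le_numeral power_one_right)
  have "cmod (w - of_real a) \<le> cmod (w' - of_real a) + cmod (w - w')"
    using norm_triangle_ineq[of "w' - of_real a" "w - w'"] by simp
  moreover have "cmod (w + of_real a) \<le> cmod (w' + of_real a) + cmod (w - w')"
    using norm_triangle_ineq[of "w' + of_real a" "w - w'"] by (simp add: add.commute)
  ultimately have far': "k / 2 \<le> cmod (w' - of_real a)" "k / 2 \<le> cmod (w' + of_real a)"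
    using far ww h k3 k by linarith+
  then have 1: "cmod (s' - source_stieltjes a w') \<le> k / 4" using near k by linarith
  have "cmod (source_stieltjes a w - source_stieltjes a w') \<le> cmod (w - w') / (k / 2)\<^sup>2"
    by (rule source_stieltjes_lipschitz) (use k far far' in auto)
  also have "\<dots> \<le> (k ^ 3 / 8) / (k / 2)\<^sup>2" using ww h k by (intro divide_right_mono) auto
  also have "\<dots> = k / 2" using k by (simp add: power2_eq_square power3_eq_cube)
  finally have 2: "cmod (source_stieltjes a w - source_stieltjes a w') \<le> k / 2" .
  have "s - source_stieltjes a w = (s - s') + (s' - source_stieltjes a w') - (source_stieltjes a w - source_stieltjes a w')" by simp
  then have "cmod (s - source_stieltjes a w) \<le> cmod (s - s') + cmod (s' - source_stieltjes a w') + cmod (source_stieltjes a w - source_stieltjes a w')"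
    by (metis norm_triangle_ineq norm_triangle_ineq4 add_right_mono order_trans)
  then show ?thesis using 1 2 ss h k3 k by linarith
qed

section \<open>From the averaged equation to eigenvalue counts\<close>

text \<open>
  The conclusions of \<open>approximate_source_equation\<close> at the point \<open>z\<close>.
\<close>

definition good_point :: "nat \<Rightarrow> (nat \<Rightarrow> real) \<Rightarrow> real \<Rightarrow> real \<Rightarrow> complex \<Rightarrow> bool" where
  "good_point n lam a k z \<longleftrightarrow> Im (stieltjes n lam z) \<le> 3 / 2 \<and>
     (k \<le> cmod (z + stieltjes n lam z - of_real a) \<longrightarrow> k \<le> cmod (z + stieltjes n lam z + of_real a) \<longrightarrow>
      cmod (stieltjes n lam z - source_stieltjes a (z + stieltjes n lam z)) \<le> k)"

text \<open>
  A good point lies within distance \<open>h\<close>, not below the height \<open>t0\<close> from which the Lipschitz constant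
  \<open>1/t0\<^sup>2\<close> of the Stieltjes transform derives.
\<close>

definition covered :: "nat \<Rightarrow> (nat \<Rightarrow> real) \<Rightarrow> real \<Rightarrow> real \<Rightarrow> real \<Rightarrow> real \<Rightarrow> complex \<Rightarrow> bool" where
  "covered n lam a k t0 h z \<longleftrightarrow> (\<exists>z'. t0 \<le> Im z' \<and> cmod (z - z') \<le> h \<and> good_point n lam a k z')"

lemma covered_stieltjes_close:
  assumes n: "n > 0" and t0: "0 < t0" "t0 \<le> Im z" and z': "t0 \<le> Im z'" "cmod (z - z') \<le> h"
  shows "cmod (stieltjes n lam z - stieltjes n lam z') \<le> h / t0\<^sup>2"
proof -
  have "cmod (stieltjes n lam z - stieltjes n lam z') \<le> cmod (z - z') / (Im z * Im z')"
    using t0 z' by (intro stieltjes_lipschitz n) auto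
  also have "\<dots> \<le> h / (t0 * t0)"
  proof (rule frac_le)
    show "0 \<le> h" using z'(2) norm_ge_zero order_trans by blast
    show "t0 * t0 \<le> Im z * Im z'" using t0 z' by (intro mult_mono) auto
  qed (use t0 z' in auto)
  finally show ?thesis by (simp add: power2_eq_square)
qed

lemma covered_Im_le:
  assumes n: "n > 0" and t0: "0 < t0" "t0 \<le> Im z" and c: "covered n lam a k t0 h z" and h: "h / t0\<^sup>2 \<le> 1 / 2"
  shows "Im (stieltjes n lam z) \<le> 2"
proof -
  obtain z' where z': "t0 \<le> Im z'" "cmod (z - z') \<le> h" "good_point n lam a k z'" using c unfolding covered_def by blast
  have "cmod (stieltjes n lam z - stieltjes n lam z') \<le> 1 / 2"
    using covered_stieltjes_close[OF n t0 z'(1,2), of lam] h by linarith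
  then have "Im (stieltjes n lam z - stieltjes n lam z') \<le> 1 / 2"
    using abs_Im_le_cmod[of "stieltjes n lam z - stieltjes n lam z'"] by linarith
  moreover have "Im (stieltjes n lam z') \<le> 3 / 2" using z'(3) by (simp add: good_point_def)
  ultimately show ?thesis by simp
qed

text \<open>
  The curve \<open>w(y) = z + s(z)\<close> over \<open>E\<close> satisfies the hypotheses in \<open>pastur_stable\<close>.
\<close>

lemma stieltjes_close_to_density:
  assumes stab: "pastur_stable a e k t"
    and n: "n > 0" and t0: "0 < t0" "t0 \<le> t" and k: "0 < k" "k \<le> 1" and h: "0 \<le> h" "h + h / t0\<^sup>2 \<le> k ^ 3 / 8"
    and cov: "\<And>y. y \<in> {t0..1} \<Longrightarrow> covered n lam a (k / 4) t0 h (Complex E y)"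
  shows "\<bar>Im (stieltjes n lam (Complex E t0)) - pi * pastur_density a E\<bar> \<le> e"
proof -
  define w where "w y = Complex E y + stieltjes n lam (Complex E y)" for y
  have "\<bar>(Im (w t0) - t0) - pi * pastur_density a E\<bar> \<le> e"
  proof (rule stab[unfolded pastur_stable_def, rule_format, OF t0])
    have C: "Complex E y = of_real E + \<i> * of_real y" for y by (simp add: complex_eq_iff)
    show "continuous_on {t0..1} w"
      unfolding w_def stieltjes_def C
    proof (intro continuous_intros)
      show "\<forall>x\<in>{t0..1}. complex_of_real (lam i) - (complex_of_real E + \<i> * complex_of_real x) \<noteq> 0" for i
        using t0 by (auto simp: complex_eq_iff)
    qed (use n in auto)
    fix y assume y: "y \<in> {t0..1}"
    have y0: "y > 0" using y t0 by auto
    show "y < Im (w y)" using stieltjes_Im_pos[OF n y0, of lam E] unfolding w_def by simp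
    assume far: "k \<le> cmod (w y - of_real a)" "k \<le> cmod (w y + of_real a)"
    obtain z' where z': "t0 \<le> Im z'" "cmod (Complex E y - z') \<le> h" "good_point n lam a (k / 4) z'"
      using cov[OF y] unfolding covered_def by blast
    define w' where "w' = z' + stieltjes n lam z'"
    have SS: "cmod (stieltjes n lam (Complex E y) - stieltjes n lam z') \<le> h / t0\<^sup>2"
      by (rule covered_stieltjes_close[OF n t0(1) _ z'(1,2)]) (use y in simp)
    have h0: "h / t0\<^sup>2 \<ge> 0" using h by simp
    have "cmod (stieltjes n lam (Complex E y) - source_stieltjes a (w y)) \<le> k"
    proof (rule approximate_equation_nearby[OF k _ h(2) _ _ far])
      show "0 \<le> h + h / t0\<^sup>2" using h h0 by linarith
      have "w y - w' = (Complex E y - z') + (stieltjes n lam (Complex E y) - stieltjes n lam z')"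
        unfolding w_def w'_def by simp
      then have "cmod (w y - w') \<le> cmod (Complex E y - z') + cmod (stieltjes n lam (Complex E y) - stieltjes n lam z')"
        by (simp only: norm_triangle_ineq)
      then show "cmod (w y - w') \<le> h + h / t0\<^sup>2" using z'(2) SS by linarith
      show "cmod (stieltjes n lam (Complex E y) - stieltjes n lam z') \<le> h + h / t0\<^sup>2" using SS h by linarith
      show "cmod (stieltjes n lam z' - source_stieltjes a w') \<le> k / 4"
        if "k / 4 \<le> cmod (w' - of_real a)" "k / 4 \<le> cmod (w' + of_real a)"
        using z'(3) that unfolding good_point_def w'_def by blast
    qed
    moreover have "w y - Complex E y = stieltjes n lam (Complex E y)" unfolding w_def by simp
    ultimately show "cmod (w y - Complex E y - source_stieltjes a (w y)) \<le> k" by simp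
  qed
  then show ?thesis unfolding w_def by simp
qed

lemma pastur_density_le_1: "pastur_density a x \<le> 1"
proof -
  have "1 * pastur_density a x \<le> pi * pastur_density a x"
    using pastur_density_nonneg[of a x] pi_ge_two by (intro mult_right_mono) auto
  then show ?thesis using pastur_density_le[of a x] by simp
qed

text \<open>
  The bound on the wide kernel at the midpoint is the bound on \<open>Im s\<close> at height \<open>(u - l)/2\<close>; above height \<open>1\<close> it is
  trivial.
\<close>

lemma counting_from_covering:
  assumes stab: "pastur_stable a e k t"
    and a: "a \<ge> 1" and e: "0 \<le> e" "e \<le> 1"
    and n: "n > 0" and t0: "0 < t0" "t0 \<le> t" and k: "0 < k" "k \<le> 1" and h: "0 \<le> h" "h + h / t0\<^sup>2 \<le> k ^ 3 / 8"
    and lu: "l < u" and tau: "0 < \<tau>" "\<tau> < 1 / 2" and I: "{l<..<u} \<subseteq> I" "I \<subseteq> {l..u}"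
    and t0len: "t0 \<le> (u - l) / 2" "t0 / (\<tau>\<^sup>2 * (u - l)) \<le> 1 / 2"
    and cov: "\<And>E y. E \<in> {l - \<tau> * (u - l)..u + \<tau> * (u - l)} \<Longrightarrow> y \<in> {t0..1} \<Longrightarrow> covered n lam a (k / 4) t0 h (Complex E y)"
  shows "\<bar>real (card {i. i < n \<and> lam i \<in> I}) - real n * integral {l..u} (pastur_density a)\<bar>
     \<le> (2 * \<tau> + e + 7 * (t0 / (\<tau>\<^sup>2 * (u - l)))) * (real n * (u - l))"
proof (rule poisson_counting[OF t0(1) lu tau I continuous_pastur_density[OF a] pastur_density_nonneg pastur_density_le_1 e _ _ t0len(2)])
  fix E assume E: "E \<in> {l - \<tau> * (u - l)..u + \<tau> * (u - l)}"
  have "\<bar>Im (stieltjes n lam (Complex E t0)) - pi * pastur_density a E\<bar> \<le> e"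
    by (rule stieltjes_close_to_density[OF stab n t0 k h cov[OF E]])
  then have "real n * \<bar>(\<Sum>i<n. poisson t0 (lam i - E)) / real n - pi * pastur_density a E\<bar> \<le> real n * e"
    unfolding Im_stieltjes by (intro mult_left_mono) auto
  also have "real n * \<bar>(\<Sum>i<n. poisson t0 (lam i - E)) / real n - pi * pastur_density a E\<bar>
     = \<bar>real n * ((\<Sum>i<n. poisson t0 (lam i - E)) / real n - pi * pastur_density a E)\<bar>"
    by (simp add: abs_mult)
  also have "real n * ((\<Sum>i<n. poisson t0 (lam i - E)) / real n - pi * pastur_density a E)
     = (\<Sum>i<n. poisson t0 (lam i - E)) - real n * (pi * pastur_density a E)"
    using n by (simp add: right_diff_distrib)
  finally show "\<bar>(\<Sum>i<n. poisson t0 (lam i - E)) - real n * (pi * pastur_density a E)\<bar> \<le> e * real n"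
    by (simp add: mult.commute)
next
  define y where "y = (u - l) / 2"
  define E where "E = (l + u) / 2"
  have y0: "y > 0" using lu unfolding y_def by simp
  have h12: "h / t0\<^sup>2 \<le> 1 / 2"
  proof -
    have "k ^ 3 \<le> 1" using k by (simp add: power_le_one)
    then show ?thesis using h by linarith
  qed
  have "Im (stieltjes n lam (Complex E y)) \<le> 2"
  proof (cases "y \<ge> 1")
    case True
    then have "1 / y \<le> 2" using y0 by (simp add: divide_le_eq)
    then show ?thesis using stieltjes_Im_le[OF n y0, of lam E] by linarith
  next
    case False
    have "E \<in> {l - \<tau> * (u - l)..u + \<tau> * (u - l)}"
    proof -
      have "0 \<le> \<tau> * (u - l)" using tau lu by simp
      moreover have "l \<le> E" "E \<le> u" unfolding E_def using lu by auto
      ultimately show ?thesis by auto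
    qed
    moreover have "y \<in> {t0..1}" using False t0len unfolding y_def by auto
    ultimately have "covered n lam a (k / 4) t0 h (Complex E y)" by (rule cov)
    then show ?thesis
      using covered_Im_le[OF n t0(1) _ _ h12, of "Complex E y" lam a "k / 4"] t0len unfolding y_def by simp
  qed
  then show "(\<Sum>i<n. poisson ((u - l) / 2) (lam i - (l + u) / 2)) \<le> 2 * real n"
    unfolding Im_stieltjes y_def[symmetric] E_def[symmetric] using n by (simp add: divide_le_eq)
qed

text \<open>
  The density is small outside a bounded set and bounded by \<open>1\<close>, so its mass in a long interval is a small
  fraction of the length.
\<close>

lemma long_interval:
  assumes a: "a > 1" and d: "\<delta> > 0"
  obtains C where "C \<ge> 1"
    "\<forall>l u. u - l \<ge> C \<longrightarrow> integral {l..u} (pastur_density a) \<le> \<delta> * (u - l) \<and> 1 \<le> \<delta> * (u - l)"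
proof -
  define L where "L = max (max (4 * a) 4) (8 / \<delta>)"
  have L: "L \<ge> 4 * a" "L \<ge> 4" "4 / L \<le> \<delta> / 2"
  proof -
    have "8 / \<delta> \<le> L" "L > 0" unfolding L_def by auto
    then show "4 / L \<le> \<delta> / 2" using d by (simp add: field_simps)
  qed (auto simp: L_def)
  define C where "C = max 1 (max (4 * L / \<delta>) (1 / \<delta>))"
  have den: "pastur_density a x \<le> \<delta> / 2 + (if x \<in> {- L..L} then 1 else 0)" for x
  proof (cases "x \<in> {- L..L}")
    case True
    then show ?thesis using pastur_density_le_1[of a x] d by simp
  next
    case False
    then have "pi * pastur_density a x \<le> 4 / L" using a by (intro pastur_density_outside[OF L(1,2)]) auto
    moreover have "1 * pastur_density a x \<le> pi * pastur_density a x"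
      using pastur_density_nonneg[of a x] pi_ge_two by (intro mult_right_mono) auto
    ultimately show ?thesis using L(3) False by simp
  qed
  have "integral {l..u} (pastur_density a) \<le> \<delta> * (u - l)" if lu: "u - l \<ge> C" for l u
  proof -
    have lu0: "l \<le> u" using lu unfolding C_def by simp
    have i1: "pastur_density a integrable_on {l..u}"
      using a by (intro integrable_continuous_interval continuous_on_subset[OF continuous_pastur_density]) auto
    have inter: "{l..u} \<inter> {- L..L} = {max l (- L)..min u L}" by auto
    have i2: "(\<lambda>x. if x \<in> {- L..L} then 1 else 0 :: real) integrable_on {l..u}"
    proof -
      have "(\<lambda>x. 1 :: real) integrable_on ({- L..L} \<inter> {l..u})"
        unfolding Int_commute[of "{- L..L}"] inter by (rule integrable_const_ivl)
      then show ?thesis using integrable_restrict_Int[of "{- L..L}" "\<lambda>x. 1 :: real" "{l..u}"] by simp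
    qed
    have "integral {l..u} (pastur_density a) \<le> integral {l..u} (\<lambda>x. \<delta> / 2 + (if x \<in> {- L..L} then 1 else 0))"
      by (intro integral_le i1 integrable_add integrable_const_ivl i2 den)
    also have "\<dots> = integral {l..u} (\<lambda>x. \<delta> / 2) + integral {l..u} (\<lambda>x. if x \<in> {- L..L} then 1 else 0)"
      by (rule Henstock_Kurzweil_Integration.integral_add[OF integrable_const_ivl i2])
    also have "integral {l..u} (\<lambda>x. \<delta> / 2) = \<delta> / 2 * (u - l)" using lu0 by simp
    also have "integral {l..u} (\<lambda>x. if x \<in> {- L..L} then 1 else 0) = integral ({- L..L} \<inter> {l..u}) (\<lambda>x. 1 :: real)"
      by (rule integral_restrict_Int)
    also have "\<dots> \<le> 2 * L"
      unfolding Int_commute[of "{- L..L}"] inter using L(2) by (simp add: max_def min_def)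
    finally have "integral {l..u} (pastur_density a) \<le> \<delta> / 2 * (u - l) + 2 * L" by simp
    moreover have "2 * L \<le> \<delta> / 2 * (u - l)"
    proof -
      have "4 * L / \<delta> \<le> u - l" using lu unfolding C_def by simp
      then have "4 * L \<le> \<delta> * (u - l)" using d by (simp add: pos_divide_le_eq mult.commute)
      then show ?thesis by simp
    qed
    ultimately show ?thesis by simp
  qed
  moreover have "1 \<le> \<delta> * (u - l)" if "u - l \<ge> C" for l u
  proof -
    have "1 / \<delta> \<le> u - l" using that unfolding C_def by simp
    then show ?thesis using d by (simp add: pos_divide_le_eq mult.commute)
  qed
  ultimately show ?thesis using that[of C] unfolding C_def by auto
qed

text \<open>
  Every term of \<open>local_equation\<close> is expressed through \<open>K\<^sup>2/(n\<eta>) \<le> b\<^sup>2\<close>; the fluctuation of the quadratic form gives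
  the leading contribution \<open>t\<^sup>2 b \<surd>v\<close> with \<open>v = Im s\<close>.
\<close>

lemma error_numeric:
  fixes K t \<eta> v :: real and n :: nat
  assumes K: "K \<ge> 1" and t: "t \<ge> 1" and n: "n > 0" and y: "0 < \<eta>" "\<eta> \<le> 1" and v: "v \<ge> 0"
    and X: "K\<^sup>2 / (real n * \<eta>) \<le> b\<^sup>2" and b: "0 \<le> b" "b \<le> 1"
  shows "K / sqrt (real n) + (6 * t\<^sup>2 * K * (2 * sqrt ((real n * v + 1 / \<eta>) / \<eta>) + 1 / \<eta>)
           + 12 * t\<^sup>2 * K\<^sup>2 / \<eta> + 1 / \<eta>) / real n \<le> 44 * t\<^sup>2 * b * (1 + sqrt v)"
proof -
  have n0: "real n > 0" using n by simp
  have t2: "t\<^sup>2 \<ge> 1" using t by simp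
  have b2: "b\<^sup>2 \<le> b" using b by (simp add: power2_eq_square mult_left_le)
  define X where "X = K\<^sup>2 / (real n * \<eta>)"
  have Xb: "X \<le> b\<^sup>2" "X \<le> b" using X b2 unfolding X_def by auto
  have KX: "K / (real n * \<eta>) \<le> X" "1 / (real n * \<eta>) \<le> X"
  proof -
    have "K \<le> K\<^sup>2" using K by (simp add: power2_eq_square)
    then show "K / (real n * \<eta>) \<le> X" "1 / (real n * \<eta>) \<le> X"
      unfolding X_def using n0 y K by (auto intro!: divide_right_mono)
  qed
  have 1: "K / sqrt (real n) \<le> b"
  proof (rule power2_le_imp_le)
    have "(K / sqrt (real n))\<^sup>2 = K\<^sup>2 / real n" using n0 by (simp add: power_divide)
    also have "\<dots> \<le> K\<^sup>2 / (real n * \<eta>)" using n0 y by (intro divide_left_mono) (auto simp: mult_left_le)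
    finally show "(K / sqrt (real n))\<^sup>2 \<le> b\<^sup>2" using X by linarith
  qed (rule b)
  have 2: "K * sqrt ((real n * v + 1 / \<eta>) / \<eta>) / real n \<le> b * sqrt v + b"
  proof -
    have "sqrt ((real n * v + 1 / \<eta>) / \<eta>) \<le> sqrt (real n * v / \<eta>) + sqrt (1 / \<eta> / \<eta>)"
      unfolding add_divide_distrib using n0 y v by (intro sqrt_add_le_add_sqrt) auto
    also have "sqrt (1 / \<eta> / \<eta>) = 1 / \<eta>" using y by (simp add: real_sqrt_divide flip: power2_eq_square) 
    finally have "K * sqrt ((real n * v + 1 / \<eta>) / \<eta>) / real n \<le> K * (sqrt (real n * v / \<eta>) + 1 / \<eta>) / real n"
      using K n0 by (intro divide_right_mono mult_left_mono) auto
    also have "\<dots> = K * sqrt (real n * v / \<eta>) / real n + K / (real n * \<eta>)"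
      using n0 y by (simp add: field_simps)
    also have "K * sqrt (real n * v / \<eta>) / real n \<le> b * sqrt v"
    proof (rule power2_le_imp_le)
      have "(sqrt (real n * v / \<eta>))\<^sup>2 = real n * v / \<eta>" using n0 y v by simp
      then have "(K * sqrt (real n * v / \<eta>) / real n)\<^sup>2 = K\<^sup>2 * (real n * v / \<eta>) / (real n)\<^sup>2"
        by (simp only: power_divide power_mult_distrib)
      also have "\<dots> = X * v" unfolding X_def using n0 y by (simp add: power2_eq_square mult_ac)
      also have "\<dots> \<le> b\<^sup>2 * v" using Xb v by (intro mult_right_mono) auto
      finally show "(K * sqrt (real n * v / \<eta>) / real n)\<^sup>2 \<le> (b * sqrt v)\<^sup>2" using v by (simp add: power_mult_distrib)
    qed (use b v in auto)
    finally show ?thesis using KX(1) Xb by linarith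
  qed
  have "(6 * t\<^sup>2 * K * (2 * sqrt ((real n * v + 1 / \<eta>) / \<eta>) + 1 / \<eta>) + 12 * t\<^sup>2 * K\<^sup>2 / \<eta> + 1 / \<eta>) / real n
    = t\<^sup>2 * (12 * (K * sqrt ((real n * v + 1 / \<eta>) / \<eta>) / real n) + 6 * (K / (real n * \<eta>)) + 12 * X) + 1 / (real n * \<eta>)"
    unfolding X_def using n0 y by (simp add: field_simps)
  also have "\<dots> \<le> t\<^sup>2 * (12 * (b * sqrt v + b) + 6 * b + 12 * b) + b"
    using 2 KX Xb t2 by (intro add_mono mult_left_mono) auto
  also have "t\<^sup>2 * (12 * (b * sqrt v + b) + 6 * b + 12 * b) = t\<^sup>2 * (12 * (b * sqrt v) + 30 * b)"
    by (simp add: algebra_simps)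
  finally have 3: "(6 * t\<^sup>2 * K * (2 * sqrt ((real n * v + 1 / \<eta>) / \<eta>) + 1 / \<eta>) + 12 * t\<^sup>2 * K\<^sup>2 / \<eta> + 1 / \<eta>) / real n
     \<le> t\<^sup>2 * (12 * (b * sqrt v) + 30 * b) + b" .
  have "p + q \<le> r + 2 * b" if "p \<le> b" "q \<le> r + b" for p q r :: real using that by simp
  from this[OF 1 3] have "K / sqrt (real n) + (6 * t\<^sup>2 * K * (2 * sqrt ((real n * v + 1 / \<eta>) / \<eta>) + 1 / \<eta>)
           + 12 * t\<^sup>2 * K\<^sup>2 / \<eta> + 1 / \<eta>) / real n \<le> t\<^sup>2 * (12 * (b * sqrt v) + 30 * b) + 2 * b" .
  also have "\<dots> \<le> t\<^sup>2 * (12 * (b * sqrt v) + 30 * b) + t\<^sup>2 * (2 * b)"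
  proof -
    have "1 * (2 * b) \<le> t\<^sup>2 * (2 * b)" using t2 b by (intro mult_right_mono) auto
    then show ?thesis by simp
  qed
  also have "\<dots> \<le> 44 * t\<^sup>2 * b * (1 + sqrt v)"
  proof -
    have "t\<^sup>2 * (b * sqrt v) \<ge> 0" "t\<^sup>2 * b \<ge> 0" using b v by auto
    then show ?thesis by (simp add: algebra_simps)
  qed
  finally show ?thesis .
qed

section \<open>The exceptional event\<close>


lemma external_source_diagonal:
  assumes A: "external_source a n A" and n: "n > 0" and a: "a > 0"
  shows "real_diagonal n A" "\<And>i. i < n \<Longrightarrow> A $$ (i, i) = of_real (Re (A $$ (i, i)))"
    "2 * card {i. i < n \<and> Re (A $$ (i, i)) = a} = n" "2 * card {i. i < n \<and> Re (A $$ (i, i)) = - a} = n"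
proof -
  define P where "P = {i. i < n \<and> A $$ (i, i) = complex_of_real a}"
  define Q where "Q = {i. i < n \<and> A $$ (i, i) = - complex_of_real a}"
  have c: "2 * card P = n" "2 * card Q = n" using A unfolding external_source_def P_def Q_def by auto
  have fin: "finite P" "finite Q" unfolding P_def Q_def by auto
  have dis: "P \<inter> Q = {}" using a unfolding P_def Q_def by (auto simp: complex_eq_iff)
  have "card (P \<union> Q) = n" using card_Un_disjoint[OF fin dis] c by simp
  moreover have "P \<union> Q \<subseteq> {..<n}" unfolding P_def Q_def by auto
  ultimately have PQ: "P \<union> Q = {..<n}" by (intro card_subset_eq) auto
  have val: "A $$ (i, i) = complex_of_real a \<or> A $$ (i, i) = - complex_of_real a" if "i < n" for i
  proof -
    have "i \<in> P \<union> Q" using that unfolding PQ by simp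
    then show ?thesis unfolding P_def Q_def by auto
  qed
  then show dre: "A $$ (i, i) = of_real (Re (A $$ (i, i)))" if "i < n" for i
    using val[OF that] by auto
  have Ac: "A \<in> carrier_mat n n" "diagonal_mat A" using A by (auto simp: external_source_def)
  show "real_diagonal n A"
    unfolding real_diagonal_def
  proof (intro conjI allI impI Ac(1))
    fix j k assume "j < n" "k < n"
    then show "A $$ (j, k) = (if j = k then complex_of_real (Re (A $$ (j, j))) else 0)"
      using Ac dre[of j] unfolding diagonal_mat_def by (cases "j = k") auto
  qed
  have "Re (A $$ (i, i)) = a \<longleftrightarrow> A $$ (i, i) = complex_of_real a" "Re (A $$ (i, i)) = - a \<longleftrightarrow> A $$ (i, i) = - complex_of_real a"
    if "i < n" for i
    using val[OF that] by (elim disjE; use a in \<open>simp add: complex_eq_iff\<close>)+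
  then have "{i. i < n \<and> Re (A $$ (i, i)) = a} = P" "{i. i < n \<and> Re (A $$ (i, i)) = - a} = Q"
    unfolding P_def Q_def by auto
  then show "2 * card {i. i < n \<and> Re (A $$ (i, i)) = a} = n" "2 * card {i. i < n \<and> Re (A $$ (i, i)) = - a} = n"
    using c by simp_all
qed

lemma good_point_of_not_bad:
  assumes n: "n > 0" and a: "a > 0" and A: "external_source a n A"
    and lam: "\<And>z. Im z \<noteq> 0 \<Longrightarrow> (\<Sum>j<n. resolvent (deformed_wigner n (hermitian_of n y) A) z j j) = (\<Sum>i<n. 1 / (of_real (lam i) - z))"
    and K: "K \<ge> 1" and T: "T \<ge> 1" and z: "0 < Im z" "Im z \<le> 1"
    and X: "K\<^sup>2 / (real n * Im z) \<le> b\<^sup>2" and b: "0 \<le> b" "b \<le> 1"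
    and k: "0 < k" "k \<le> 1" and small: "44 * T\<^sup>2 * b \<le> k ^ 3 / 10"
    and good: "\<And>i. i < n \<Longrightarrow> \<not> row_bad n A z T K i y" "\<And>i. i < n \<Longrightarrow> \<bar>y (i, i)\<bar> \<le> K"
  shows "good_point n lam a k z"
proof -
  define W where "W = deformed_wigner n (hermitian_of n y) A"
  define G where "G = resolvent W z"
  define s where "s = (\<Sum>j<n. G j j) / of_nat n"
  note src = external_source_diagonal[OF A n a]
  have Ac: "A \<in> carrier_mat n n" using src(1) by (simp add: real_diagonal_def)
  have S: "stieltjes n lam z = s"
    unfolding stieltjes_def s_def G_def W_def using lam[of z] z by simp
  have Is: "Im s > 0"
    using stieltjes_Im_pos[OF n z(1), of lam "Re z"] unfolding complex_surj S .
  have hW: "hermitian_on n (\<lambda>j k. W $$ (j, k))" unfolding W_def by (rule hermitian_deformed[OF src(1)])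
  have rG: "is_resolvent n (\<lambda>j k. W $$ (j, k)) z G"
    unfolding G_def by (rule is_resolvent_resolvent) (use Ac z hW in \<open>auto simp: W_def\<close>)
  have g: "G i i \<noteq> 0" if "i < n" for i
    using resolvent_diag_Im_pos[OF hW rG that z(1)] by auto
  have err: "cmod (1 / G i i - (of_real (Re (A $$ (i, i))) - (z + s))) \<le> 44 * T\<^sup>2 * b * (1 + sqrt (Im s))" if i: "i < n" for i
  proof -
    have "cmod (1 / G i i - (A $$ (i, i) - (z + s)))
     \<le> K / sqrt (real n) + (6 * T\<^sup>2 * K * (2 * sqrt ((real n * Im s + 1 / Im z) / Im z) + 1 / Im z)
           + 12 * T\<^sup>2 * K\<^sup>2 / Im z + 1 / Im z) / real n"
      unfolding G_def s_def W_def by (rule local_equation[OF i src(1) z(1) K T good(1)[OF i] good(2)[OF i]])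
    also have "\<dots> \<le> 44 * T\<^sup>2 * b * (1 + sqrt (Im s))"
      by (rule error_numeric[OF K T n z _ X b]) (use Is in simp)
    finally show ?thesis by (simp only: src(2)[OF i, symmetric])
  qed
  have th0: "0 \<le> 44 * T\<^sup>2 * b" using b by simp
  note ase = approximate_source_equation[OF n a k th0 small src(3,4) z(1), where g = "\<lambda>i. G i i", folded s_def, OF Is g err]
  show ?thesis unfolding good_point_def S using ase by blast
qed

lemma wigner_hermitian_of:
  assumes w: "wigner_hermitian M n \<nu> \<nu>' X" and "\<omega> \<in> space M"
  shows "hermitian_of n (\<lambda>p. wigner_coord X p \<omega>) = X \<omega>"
  using assms unfolding wigner_hermitian_def by (intro hermitian_of_wigner_coord) auto

lemma measurable_eigenvalue_count:
  assumes w: "wigner_hermitian M n \<nu> \<nu>' X" and A: "real_diagonal n A" and J: "J \<in> sets borel"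
  shows "(\<lambda>\<omega>. real (num_eigenvalues_in (deformed_wigner n (X \<omega>) A) J)) \<in> borel_measurable M"
proof -
  define W where "W \<omega> = deformed_wigner n (X \<omega>) A" for \<omega>
  have Ac: "A \<in> carrier_mat n n" using A by (simp add: real_diagonal_def)
  have Wc: "W \<omega> \<in> carrier_mat n n" if "\<omega> \<in> space M" for \<omega>
    using w that Ac unfolding W_def wigner_hermitian_def by (intro deformed_wigner_carrier) auto
  have Wh: "hermitian_on n (\<lambda>j k. W \<omega> $$ (j, k))" if "\<omega> \<in> space M" for \<omega>
    using hermitian_deformed[OF A, of "\<lambda>p. wigner_coord X p \<omega>"] unfolding wigner_hermitian_of[OF w that] W_def .
  define spec where "spec \<omega> lam \<longleftrightarrow> num_eigenvalues_in (W \<omega>) J = card {i. i < n \<and> lam i \<in> J} \<and>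
      (\<forall>z. Im z \<noteq> 0 \<longrightarrow> (\<Sum>j<n. resolvent (W \<omega>) z j j) = (\<Sum>i<n. 1 / (of_real (lam i) - z)))"
    for \<omega> and lam :: "nat \<Rightarrow> real"
  define L where "L \<omega> = (SOME lam. spec \<omega> lam)" for \<omega>
  have "spec \<omega> (L \<omega>)" if \<omega>: "\<omega> \<in> space M" for \<omega>
  proof -
    have "\<exists>lam. spec \<omega> lam"
    proof (rule hermitian_spectrum[OF Wc[OF \<omega>] Wh[OF \<omega>]])
      fix lam :: "nat \<Rightarrow> real"
      assume "\<And>J. num_eigenvalues_in (W \<omega>) J = card {i. i < n \<and> lam i \<in> J}"
        "\<And>z. Im z \<noteq> 0 \<Longrightarrow> (\<Sum>j<n. resolvent (W \<omega>) z j j) = (\<Sum>i<n. 1 / (of_real (lam i) - z))"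
      then have "spec \<omega> lam" unfolding spec_def by simp
      then show ?thesis by (rule exI[of _ lam])
    qed
    then show ?thesis unfolding L_def by (rule someI_ex)
  qed
  then have L: "\<And>\<omega>. \<omega> \<in> space M \<Longrightarrow> num_eigenvalues_in (W \<omega>) J = card {i. i < n \<and> L \<omega> i \<in> J}"
    "\<And>\<omega> z. \<omega> \<in> space M \<Longrightarrow> Im z \<noteq> 0 \<Longrightarrow> (\<Sum>j<n. resolvent (W \<omega>) z j j) = (\<Sum>i<n. 1 / (of_real (L \<omega> i) - z))"
    unfolding spec_def by auto
  have entry: "(\<lambda>\<omega>. W \<omega> $$ (j, k)) \<in> borel_measurable M" if jk: "j < n" "k < n" for j k
  proof -
    have eq: "W \<omega> $$ (j, k) = of_real (1 / sqrt (real n)) * hermitian_of n (\<lambda>p. wigner_coord X p \<omega>) $$ (j, k) + A $$ (j, k)"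
      if "\<omega> \<in> space M" for \<omega>
      unfolding W_def wigner_hermitian_of[OF w that, symmetric] by (rule deformed_wigner_index[OF Ac hermitian_of_carrier jk])
    have "(\<lambda>\<omega>. hermitian_of n (\<lambda>p. wigner_coord X p \<omega>) $$ (j, k)) \<in> borel_measurable M"
      using jk by (intro measurable_hermitian_of wigner_coord_measurable[OF w]) auto
    then have "(\<lambda>\<omega>. of_real (1 / sqrt (real n)) * hermitian_of n (\<lambda>p. wigner_coord X p \<omega>) $$ (j, k) + A $$ (j, k)) \<in> borel_measurable M"
      by (intro borel_measurable_add borel_measurable_times borel_measurable_const)
    then show ?thesis by (subst measurable_cong[OF eq])
  qed
  have "(\<lambda>\<omega>. \<Sum>i<n. indicator J (L \<omega> i) :: real) \<in> borel_measurable M"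
  proof (rule borel_measurable_linear_statistic[OF _ J])
    fix z :: complex assume z: "Im z \<noteq> 0"
    have "(\<lambda>\<omega>. \<Sum>j<n. resolvent (W \<omega>) z j j) \<in> borel_measurable M"
      by (rule borel_measurable_sum, rule borel_measurable_resolvent[where n = n]) (use Wc entry in auto)
    then show "(\<lambda>\<omega>. \<Sum>i<n. 1 / (of_real (L \<omega> i) - z)) \<in> borel_measurable M"
      by (subst measurable_cong[OF L(2)[OF _ z, symmetric]])
  qed
  moreover have "real (num_eigenvalues_in (W \<omega>) J) = (\<Sum>i<n. indicator J (L \<omega> i))" if "\<omega> \<in> space M" for \<omega>
  proof -
    have 1: "(\<Sum>i\<in>{i\<in>{..<n}. L \<omega> i \<in> J}. 1 :: real) = (\<Sum>i<n. if L \<omega> i \<in> J then 1 else 0)"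
      by (rule sum.inter_filter) simp
    have "(\<Sum>i<n. indicator J (L \<omega> i) :: real) = (\<Sum>i<n. if L \<omega> i \<in> J then 1 else 0)"
      by (intro sum.cong refl) (simp add: indicator_def)
    also have "\<dots> = real (card {i\<in>{..<n}. L \<omega> i \<in> J})" unfolding 1[symmetric] by (simp only: sum_constant mult.right_neutral)
    also have "{i\<in>{..<n}. L \<omega> i \<in> J} = {i. i < n \<and> L \<omega> i \<in> J}" by auto
    finally show ?thesis unfolding L(1)[OF that] by (rule sym)
  qed
  ultimately show ?thesis unfolding W_def[symmetric] using measurable_cong[of M "\<lambda>\<omega>. real (num_eigenvalues_in (W \<omega>) J)" "\<lambda>\<omega>. \<Sum>i<n. indicator J (L \<omega> i)" borel] by blast
qed

text \<open>
  The union of the exceptional events of all grid points and rows, together with the null event that a diagonal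
  entry exceeds \<open>K\<close>.
\<close>

lemma wigner_bad_event:
  assumes w: "wigner_hermitian M n \<nu> \<nu>' X" and A: "real_diagonal n A" and T: "T \<ge> 1"
    and b: "AE \<omega> in M. \<forall>i<n. \<forall>j<n. cmod (X \<omega> $$ (i, j)) \<le> K"
    and Z: "finite Z" "\<And>z. z \<in> Z \<Longrightarrow> Im z > 0"
  obtains Bad where "Bad \<in> sets M" "measure M Bad \<le> real (card Z) * real n * (4 * (1 + 4 * real n) * exp (1 - T))"
    "\<forall>\<omega>\<in>space M - Bad. \<forall>z\<in>Z. \<forall>i<n. \<not> row_bad n A z T K i (\<lambda>p. wigner_coord X p \<omega>)"
    "\<forall>\<omega>\<in>space M - Bad. \<forall>i<n. \<bar>wigner_coord X (i, i) \<omega>\<bar> \<le> K"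
proof -
  interpret prob_space M using w by (simp add: wigner_hermitian_def)
  define R where "R = (\<lambda>(z, i). {\<omega> \<in> space M. row_bad n A z T K i (\<lambda>p. wigner_coord X p \<omega>)})"
  define D where "D i = {\<omega> \<in> space M. \<bar>wigner_coord X (i, i) \<omega>\<bar> > K}" for i
  define c where "c = 4 * (1 + 4 * real n) * exp (1 - T)"
  have Rm: "R p \<in> sets M" and Rp: "measure M (R p) \<le> c" if "p \<in> Z \<times> {..<n}" for p
    using wigner_row_bad[OF w _ T A Z(2) b, of "snd p" "fst p"] that unfolding R_def c_def by (auto split: prod.split)
  have Dm: "D i \<in> sets M" and Dp: "measure M (D i) = 0" if i: "i < n" for i
  proof -
    have "wigner_coord X (i, i) \<in> borel_measurable M" using i by (intro wigner_coord_measurable[OF w]) auto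
    then show Dm: "D i \<in> sets M" unfolding D_def by measurable
    have "AE \<omega> in M. \<omega> \<notin> D i"
      using b
    proof eventually_elim
      case (elim \<omega>)
      then have "cmod (X \<omega> $$ (i, i)) \<le> K" using i by blast
      then show ?case using abs_Re_le_cmod[of "X \<omega> $$ (i, i)"] unfolding D_def wigner_coord_def by simp
    qed
    then show "measure M (D i) = 0" using Dm by (simp add: AE_iff_measurable[OF Dm] prob_eq_0)
  qed
  define Bad where "Bad = (\<Union>p\<in>Z \<times> {..<n}. R p) \<union> (\<Union>i\<in>{..<n}. D i)"
  have fin: "finite (Z \<times> {..<n})" using Z(1) by simp
  have m1: "(\<Union>p\<in>Z \<times> {..<n}. R p) \<in> sets M" using Rm fin by (intro sets.finite_UN) auto
  have m2: "(\<Union>i\<in>{..<n}. D i) \<in> sets M" using Dm by (intro sets.finite_UN) auto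
  have "measure M Bad \<le> measure M (\<Union>p\<in>Z \<times> {..<n}. R p) + measure M (\<Union>i\<in>{..<n}. D i)"
    unfolding Bad_def by (rule measure_Un_le[OF m1 m2])
  also have "measure M (\<Union>p\<in>Z \<times> {..<n}. R p) \<le> (\<Sum>p\<in>Z \<times> {..<n}. measure M (R p))"
    by (rule measure_UNION_le[OF fin Rm])
  also have "\<dots> \<le> (\<Sum>p\<in>Z \<times> {..<n}. c)" by (intro sum_mono Rp)
  also have "\<dots> = real (card Z) * real n * c" by (simp add: card_cartesian_product)
  also have "measure M (\<Union>i\<in>{..<n}. D i) \<le> (\<Sum>i\<in>{..<n}. measure M (D i))"
    by (rule measure_UNION_le) (use Dm in auto)
  also have "\<dots> = 0" using Dp by simp
  finally have p: "measure M Bad \<le> real (card Z) * real n * c" by simp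
  show ?thesis
  proof (rule that[of Bad])
    show "Bad \<in> sets M" unfolding Bad_def by (rule sets.Un[OF m1 m2])
    show "measure M Bad \<le> real (card Z) * real n * (4 * (1 + 4 * real n) * exp (1 - T))" using p unfolding c_def .
    show "\<forall>\<omega>\<in>space M - Bad. \<forall>z\<in>Z. \<forall>i<n. \<not> row_bad n A z T K i (\<lambda>p. wigner_coord X p \<omega>)"
      unfolding Bad_def R_def by blast
    show "\<forall>\<omega>\<in>space M - Bad. \<forall>i<n. \<bar>wigner_coord X (i, i) \<omega>\<bar> \<le> K"
      unfolding Bad_def D_def by (auto simp: not_less)
  qed
qed

definition grid :: "real \<Rightarrow> real \<Rightarrow> real \<Rightarrow> nat \<Rightarrow> nat \<Rightarrow> complex set" where
  "grid l t0 h P Q = (\<lambda>(p, q). Complex (l + real p * h) (t0 + real q * h)) ` ({..<P} \<times> {..<Q})"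

lemma grid_card: "finite (grid l t0 h P Q)" "card (grid l t0 h P Q) \<le> P * Q"
  unfolding grid_def using card_image_le[of "{..<P} \<times> {..<Q}" "\<lambda>(p, q). Complex (l + real p * h) (t0 + real q * h)"]
  by (auto simp: card_cartesian_product)

lemma floor_step:
  fixes h :: real
  assumes h: "h > 0" and x: "0 \<le> x" "x / h < real N"
  obtains p where "p < N" "real p * h \<le> x" "x - real p * h \<le> h"
proof -
  define p where "p = nat \<lfloor>x / h\<rfloor>"
  have nn: "0 \<le> x / h" using x h by simp
  have p1: "real p \<le> x / h" "x / h < real p + 1" using nn unfolding p_def by linarith+
  have "p < N" using p1(1) x(2) by linarith
  moreover have "real p * h \<le> x" using p1(1) h by (simp add: pos_le_divide_eq)
  moreover have "x - real p * h \<le> h"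
  proof -
    have "x < (real p + 1) * h" using p1(2) h by (simp add: pos_divide_less_eq)
    then show ?thesis by (simp add: algebra_simps)
  qed
  ultimately show ?thesis using that by blast
qed

lemma grid_covers:
  assumes h: "h > 0" and E: "l \<le> E" "(E - l) / h < real P" and y: "t0 \<le> y" "(y - t0) / h < real Q"
  obtains z where "z \<in> grid l t0 h P Q" "t0 \<le> Im z" "Im z \<le> y" "cmod (Complex E y - z) \<le> 2 * h"
proof -
  obtain p where p: "p < P" "real p * h \<le> E - l" "E - l - real p * h \<le> h"
    using floor_step[OF h _ E(2)] E(1) by auto
  obtain q where q: "q < Q" "real q * h \<le> y - t0" "y - t0 - real q * h \<le> h"
    using floor_step[OF h _ y(2)] y(1) by auto
  define z where "z = Complex (l + real p * h) (t0 + real q * h)"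
  have "z \<in> grid l t0 h P Q" unfolding z_def grid_def using p q by auto
  moreover have "t0 \<le> Im z" "Im z \<le> y" unfolding z_def using q h by auto
  moreover have "cmod (Complex E y - z) \<le> 2 * h"
    using cmod_le[of "Complex E y - z"] p q unfolding z_def by simp
  ultimately show ?thesis using that by blast
qed

lemma interval_measure:
  fixes I :: "real set"
  assumes I: "{l<..<u} \<subseteq> I" "I \<subseteq> {l..u}" and lu: "l \<le> u"
  shows "I \<in> sets borel" "measure lborel I = u - l"
    "continuous_on UNIV f \<Longrightarrow> (LINT x:I|lborel. f x) = integral {l..u} (f :: real \<Rightarrow> real)"
proof -
  have "I = {l<..<u} \<union> (I \<inter> {l, u})" using I by fastforce
  moreover have "I \<inter> {l, u} \<in> sets borel" by (intro borel_closed finite_imp_closed) auto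
  ultimately show b: "I \<in> sets borel" by (metis borel_open open_greaterThanLessThan sets.Un)
  have ne: "AE x in lborel. x \<noteq> l" "AE x in lborel. x \<noteq> u" by (rule AE_lborel_singleton)+
  have eqv: "AE x in lborel. x \<in> I \<longleftrightarrow> x \<in> {l..u}"
    using ne by eventually_elim (use I in auto)
  have "measure lborel I = measure lborel {l..u}"
    by (rule measure_eq_AE[OF eqv]) (use b in auto)
  then show "measure lborel I = u - l" using lu by simp
  assume f: "continuous_on UNIV f"
  have fm: "f \<in> borel_measurable borel" using f by (rule borel_measurable_continuous_onI)
  have "(LINT x:I|lborel. f x) = (LINT x:{l..u}|lborel. f x)"
    unfolding set_lebesgue_integral_def
  proof (rule integral_cong_AE)
    show "AE x in lborel. indicat_real I x *\<^sub>R f x = indicat_real {l..u} x *\<^sub>R f x"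
      using eqv by eventually_elim (auto simp: indicator_def)
  qed (use b fm in measurable)
  also have "\<dots> = integral {l..u} f"
    by (intro set_borel_integral_eq_integral borel_integrable_atLeastAtMost' continuous_on_subset[OF f]) auto
  finally show "(LINT x:I|lborel. f x) = integral {l..u} f" .
qed

section \<open>The local law\<close>

text \<open>
  With \<open>x = ln n\<close> the union bound is at most \<open>360 C n\<^sup>8 exp (- x\<^sup>2) \<le> exp (9 x - x\<^sup>2)\<close>.
\<close>

lemma probability_numeric:
  fixes x C :: real and n P Q :: nat
  assumes n: "real n = exp x" and x: "x \<ge> 18" "x \<ge> 360 * C" and C: "C \<ge> 1"
    and P: "real P \<le> 3 * C * real n ^ 3" and Q: "real Q \<le> 2 * real n ^ 3" and m: "real m \<le> real P * real Q"
  shows "real m * real n * (4 * (1 + 4 * real n) * exp (1 - x\<^sup>2)) \<le> exp (- (x\<^sup>2 / 2))"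
proof -
  have n1: "real n \<ge> 1" unfolding n using x by simp
  have "real P * real Q \<le> (3 * C * real n ^ 3) * (2 * real n ^ 3)"
    by (rule mult_mono[OF P Q]) (use C in auto)
  also have "\<dots> = 6 * C * real n ^ 6" by (simp add: power_numeral_reduce)
  finally have m': "real m \<le> 6 * C * real n ^ 6" using m by linarith
  have e3: "exp (1 - x\<^sup>2) \<le> 3 * exp (- x\<^sup>2)"
  proof -
    have "exp (1 - x\<^sup>2) = exp 1 * exp (- x\<^sup>2)" by (simp add: exp_add[symmetric])
    also have "\<dots> \<le> 3 * exp (- x\<^sup>2)" using exp_le by (intro mult_right_mono) auto
    finally show ?thesis .
  qed
  have 4: "4 * (1 + 4 * real n) * exp (1 - x\<^sup>2) \<le> (20 * real n) * (3 * exp (- x\<^sup>2))"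
  proof (rule mult_mono[OF _ e3])
    show "4 * (1 + 4 * real n) \<le> 20 * real n" using n1 by simp
  qed auto
  have "real m * real n * (4 * (1 + 4 * real n) * exp (1 - x\<^sup>2)) \<le> (6 * C * real n ^ 6) * real n * ((20 * real n) * (3 * exp (- x\<^sup>2)))"
  proof (rule mult_mono[OF _ 4])
    show "real m * real n \<le> 6 * C * real n ^ 6 * real n" by (rule mult_right_mono[OF m']) simp
  qed (use C in auto)
  also have "\<dots> = 360 * C * (real n ^ 8 * exp (- x\<^sup>2))" by (simp add: power_numeral_reduce)
  also have "\<dots> \<le> exp x * (real n ^ 8 * exp (- x\<^sup>2))"
  proof (rule mult_right_mono)
    show "360 * C \<le> exp x" using x exp_ge_add_one_self[of x] by linarith
  qed simp
  also have "real n ^ 8 = exp (8 * x)" unfolding n using exp_of_nat_mult[of 8 x] by simp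
  also have "exp x * (exp (8 * x) * exp (- x\<^sup>2)) = exp (9 * x - x\<^sup>2)" by (simp flip: exp_add)
  also have "\<dots> \<le> exp (- (x\<^sup>2 / 2))"
  proof -
    have "18 * x \<le> x * x" using x by (intro mult_right_mono) auto
    then show ?thesis by (simp add: power2_eq_square)
  qed
  finally show ?thesis .
qed

text \<open>
  With \<open>x = ln n\<close>, the concentration parameter is \<open>x\<^sup>2\<close>, the spectral resolution \<open>t0 = K\<^sup>2 x\<^sup>1\<^sup>6/n\<close> and the mesh \<open>n\<^sup>-\<^sup>3\<close>.
  The error in the local equation is then of order \<open>x\<^sup>4 \<cdot> x\<^sup>-\<^sup>8\<close>, and \<open>t0/|I| \<le> x\<^sup>-\<^sup>4\<close>; the threshold \<open>x0\<close> makes both small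
  enough for the constants supplied by \<open>pastur_stability\<close> and \<open>counting_from_covering\<close>.
\<close>

theorem eigenvalue_count_large_n:
  fixes a \<delta> :: real
  assumes a: "a > 1" and d: "\<delta> > 0"
  shows "\<exists>x0. \<forall>n M \<nu> \<nu>' X A K I. n > 0 \<longrightarrow> ln (real n) \<ge> x0 \<longrightarrow>
      wigner_hermitian M n \<nu> \<nu>' X \<longrightarrow> external_source a n A \<longrightarrow>
      (AE \<omega> in M. \<forall>i<n. \<forall>j<n. cmod (X \<omega> $$ (i, j)) \<le> K) \<longrightarrow>
      is_interval I \<longrightarrow> bounded I \<longrightarrow> measure lborel I \<ge> K\<^sup>2 * ln (real n) ^ 20 / real n \<longrightarrow>
      (let E = {\<omega> \<in> space M. \<bar>real (num_eigenvalues_in (deformed_wigner n (X (\<omega> :: 'a)) A) I)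
              - real n * (LINT x:I|lborel. pastur_density a x)\<bar> \<le> \<delta> * real n * measure lborel I}
       in E \<in> sets M \<and> measure M E \<ge> 1 - exp (- ((ln (real n))\<^sup>2 / 2)))"
proof -
  define e where "e = min (\<delta> / 4) 1"
  define \<tau> where "\<tau> = min (\<delta> / 8) (1 / 4)"
  \<comment> \<open>Budget: 2\<tau> and e contribute \<delta>/4 each, and g, the bound on the normalised resolution, contributes 7g \<le> \<delta>/4.\<close>
  define g where "g = min (\<delta> / 28) (1 / 2)"
  have e: "0 < e" "e \<le> 1" "e \<le> \<delta> / 4" and tau: "0 < \<tau>" "\<tau> < 1 / 2" "\<tau> \<le> \<delta> / 8"
    and g: "0 < g" "g \<le> 1 / 2" "g \<le> \<delta> / 28"
    using d unfolding e_def \<tau>_def g_def by auto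
  obtain k t where k: "0 < k" "k \<le> 1" and t: "0 < t" "t \<le> 1" and stab: "pastur_stable a e k t"
    by (rule pastur_stability[OF a e(1)])
  obtain C where C: "C \<ge> 1"
    and long': "\<forall>l u. u - l \<ge> C \<longrightarrow> integral {l..u} (pastur_density a) \<le> \<delta> * (u - l) \<and> 1 \<le> \<delta> * (u - l)"
    by (rule long_interval[OF a d])
  have long: "integral {l..u} (pastur_density a) \<le> \<delta> * (u - l)" "1 \<le> \<delta> * (u - l)" if "u - l \<ge> C" for l u
    using long' that by blast+
  define x0 where "x0 = Max {18, 360 * C, C / t, 1 / (\<tau>\<^sup>2 * g), 32 / k ^ 3, 28160 / k ^ 3}"
  \<comment> \<open>For large x = ln n: the constants in x0 ensure in turn the numerical bounds on the union of events, t0 \<le> t,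
    the ratio of t0 to the length, the Lipschitz error of the grid, and the error in the local equation.\<close>
  have main: "let E = {\<omega> \<in> space M. \<bar>real (num_eigenvalues_in (deformed_wigner n (X \<omega>) A) I)
              - real n * (LINT x:I|lborel. pastur_density a x)\<bar> \<le> \<delta> * real n * measure lborel I}
       in E \<in> sets M \<and> measure M E \<ge> 1 - exp (- ((ln (real n))\<^sup>2 / 2))"
    if n: "n > 0" and xn: "ln (real n) \<ge> x0" and w: "wigner_hermitian M n \<nu> \<nu>' X" and A: "external_source a n A"
      and bK: "AE \<omega> in M. \<forall>i<n. \<forall>j<n. cmod (X \<omega> $$ (i, j)) \<le> K" and I: "is_interval I" "bounded I"
      and mI: "measure lborel I \<ge> K\<^sup>2 * ln (real n) ^ 20 / real n"
    for n \<nu> \<nu>' A K I and M :: "'a measure" and X :: "'a \<Rightarrow> complex mat"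
  proof -
    interpret prob_space M using w by (simp add: wigner_hermitian_def)
    define x where "x = ln (real n)"
    have x: "x \<ge> 18" "x \<ge> 360 * C" "x \<ge> C / t" "x \<ge> 1 / (\<tau>\<^sup>2 * g)" "x \<ge> 32 / k ^ 3" "x \<ge> 28160 / k ^ 3"
      using xn unfolding x_def x0_def by auto
    have nx: "real n = exp x" using n unfolding x_def by simp
    have nn: "real n > 0" using n by simp
    have xlen: "x \<le> real n" unfolding nx using exp_ge_add_one_self[of x] by linarith
    have x4: "x \<le> x ^ 4" using x(1) by (metis power_increasing[of 1 4 x] one_le_numeral power_one_right order_trans)
    have K: "K \<ge> 1" by (rule wigner_bound_ge_1[OF w n bK])
    have K2: "K\<^sup>2 \<ge> 1" using K by simp
    define l where "l = Inf I"
    define u where "u = Sup I"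
    have pos: "K\<^sup>2 * x ^ 20 / real n > 0" using K x(1) nn by (intro divide_pos_pos mult_pos_pos) auto
    \<comment> \<open>An empty interval would have length 0, below the positive lower bound.\<close>
    have ne: "I \<noteq> {}"
    proof
      assume "I = {}"
      then show False using mI pos unfolding x_def by simp
    qed
    note sw = is_interval_bounded_sandwich[OF I ne, folded l_def u_def]
    note im = interval_measure[OF sw]
    have mlen: "measure lborel I = u - l" by (rule im(2))
    have intr: "(LINT x:I|lborel. pastur_density a x) = integral {l..u} (pastur_density a)"
      using a by (intro im(3) continuous_pastur_density) simp
    have len: "u - l \<ge> K\<^sup>2 * x ^ 20 / real n" using mI unfolding mlen x_def .
    have lu: "l < u" using len pos by linarith
    define E where "E = {\<omega> \<in> space M. \<bar>real (num_eigenvalues_in (deformed_wigner n (X \<omega>) A) I)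
              - real n * integral {l..u} (pastur_density a)\<bar> \<le> \<delta> * real n * (u - l)}"
    note src = external_source_diagonal[OF A n]
    have Ad: "real_diagonal n A" using a by (intro src(1)) simp
    have Ac: "A \<in> carrier_mat n n" using Ad by (simp add: real_diagonal_def)
    have Em: "E \<in> sets M"
      unfolding E_def using measurable_eigenvalue_count[OF w Ad im(1)] by measurable
    have spectrum: "\<exists>lam. num_eigenvalues_in (deformed_wigner n (X \<omega>) A) I = card {i. i < n \<and> lam i \<in> I} \<and>
        (\<forall>z. Im z \<noteq> 0 \<longrightarrow> (\<Sum>j<n. resolvent (deformed_wigner n (X \<omega>) A) z j j) = (\<Sum>i<n. 1 / (of_real (lam i) - z)))"
      if om: "\<omega> \<in> space M" for \<omega>
    proof (rule hermitian_spectrum)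
      show "deformed_wigner n (X \<omega>) A \<in> carrier_mat n n"
        using w om Ac unfolding wigner_hermitian_def by (intro deformed_wigner_carrier) auto
      show "hermitian_on n (\<lambda>j k. deformed_wigner n (X \<omega>) A $$ (j, k))"
        using hermitian_deformed[OF Ad, of "\<lambda>p. wigner_coord X p \<omega>"] unfolding wigner_hermitian_of[OF w om] .
      fix lam :: "nat \<Rightarrow> real"
      assume "\<And>J. num_eigenvalues_in (deformed_wigner n (X \<omega>) A) J = card {i. i < n \<and> lam i \<in> J}"
        "\<And>z. Im z \<noteq> 0 \<Longrightarrow> (\<Sum>j<n. resolvent (deformed_wigner n (X \<omega>) A) z j j) = (\<Sum>i<n. 1 / (of_real (lam i) - z))"
      then show ?thesis by blast
    qed
    have Ep: "measure M E \<ge> 1 - exp (- (x\<^sup>2 / 2))"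
    proof (cases "u - l \<ge> C")
      case True
      have "E = space M"
      proof -
        have "\<bar>real (num_eigenvalues_in (deformed_wigner n (X \<omega>) A) I) - real n * integral {l..u} (pastur_density a)\<bar> \<le> \<delta> * real n * (u - l)"
          if om: "\<omega> \<in> space M" for \<omega>
        proof -
          obtain lam where "num_eigenvalues_in (deformed_wigner n (X \<omega>) A) I = card {i. i < n \<and> lam i \<in> I}"
            using spectrum[OF om] by blast
          moreover have "card {i. i < n \<and> lam i \<in> I} \<le> card {..<n}" by (intro card_mono) auto
          ultimately have "real (num_eigenvalues_in (deformed_wigner n (X \<omega>) A) I) \<le> real n * 1" by simp
          also have "\<dots> \<le> real n * (\<delta> * (u - l))" by (intro mult_left_mono long(2) True) auto
          finally have 1: "real (num_eigenvalues_in (deformed_wigner n (X \<omega>) A) I) \<le> \<delta> * real n * (u - l)" by (simp add: mult_ac)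
          have "real n * integral {l..u} (pastur_density a) \<le> real n * (\<delta> * (u - l))" by (intro mult_left_mono long(1) True) auto
          then have 2: "real n * integral {l..u} (pastur_density a) \<le> \<delta> * real n * (u - l)" by (simp add: mult_ac)
          have "integral {l..u} (pastur_density a) \<ge> 0"
            using a pastur_density_nonneg
            by (intro integral_nonneg integrable_continuous_interval continuous_on_subset[OF continuous_pastur_density]) auto
          then have "real n * integral {l..u} (pastur_density a) \<ge> 0" by simp
          then show ?thesis using 1 2 by (simp add: abs_le_iff)
        qed
        then show ?thesis unfolding E_def by auto
      qed
      then show ?thesis by (simp add: prob_space)
    next
      case False
      then have lenC: "u - l \<le> C" by simp
      define t0 where "t0 = K\<^sup>2 * x ^ 16 / real n"
      define hh where "hh = 1 / real n ^ 3"
      have x0': "x > 0" using x(1) by simp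
      have t0pos: "t0 > 0" unfolding t0_def using K x0' nn by (intro divide_pos_pos mult_pos_pos) auto
      have "t0 * x ^ 4 \<le> u - l"
        using len unfolding t0_def by (simp flip: power_add add: mult.assoc)
      then have t0le: "t0 \<le> (u - l) / x ^ 4" using x0' by (simp add: pos_le_divide_eq)
      have "(u - l) / x ^ 4 \<le> (u - l) / x" using x4 x0' lu by (intro divide_left_mono mult_pos_pos) auto
      then have t0le': "t0 \<le> (u - l) / x" using t0le by linarith
      have t0t: "t0 \<le> t"
      proof -
        have "(u - l) / x \<le> C / x" using lenC x0' by (intro divide_right_mono) auto
        also have "\<dots> \<le> t" using x(3) t(1) x0' by (simp add: field_simps)
        finally show ?thesis using t0le' by linarith
      qed
      have t0half: "t0 \<le> (u - l) / 2"
      proof -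
        have "(u - l) / x \<le> (u - l) / 2" using x(1) lu by (intro divide_left_mono mult_pos_pos) auto
        then show ?thesis using t0le' by linarith
      qed
      have t0g: "t0 / (\<tau>\<^sup>2 * (u - l)) \<le> g"
      proof -
        have "t0 / (\<tau>\<^sup>2 * (u - l)) \<le> ((u - l) / x) / (\<tau>\<^sup>2 * (u - l))"
          using t0le' tau lu by (intro divide_right_mono) auto
        also have "\<dots> = 1 / (x * \<tau>\<^sup>2)" using lu by simp
        also have "\<dots> \<le> g"
        proof -
          have "1 \<le> x * (\<tau>\<^sup>2 * g)" using x(4) tau g by (simp add: pos_divide_le_eq)
          then show ?thesis using x0' tau by (simp add: pos_divide_le_eq mult_ac)
        qed
        finally show ?thesis .
      qed
      have t0n: "1 / real n \<le> t0"
      proof -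
        have "1 \<le> x ^ 16" using x(1) by (intro one_le_power) simp
        then have "1 * 1 \<le> K\<^sup>2 * x ^ 16" using K2 by (intro mult_mono) auto
        then show ?thesis unfolding t0_def using nn by (intro divide_right_mono) auto
      qed
      have n1: "real n \<ge> 1" using xlen x(1) by simp
      have hpos: "hh > 0" unfolding hh_def using nn by simp
      have hsmall: "2 * hh + 2 * hh / t0\<^sup>2 \<le> k ^ 3 / 8"
      proof -
        have "(1 / real n)\<^sup>2 \<le> t0\<^sup>2" using t0n nn by (intro power_mono) auto
        then have "2 * hh / t0\<^sup>2 \<le> 2 * hh / (1 / real n)\<^sup>2"
          using hpos nn t0pos by (intro divide_left_mono mult_pos_pos) auto
        also have "\<dots> = 2 / real n" unfolding hh_def using nn by (simp add: power2_eq_square power3_eq_cube)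
        finally have "2 * hh / t0\<^sup>2 \<le> 2 / real n" .
        moreover have "2 * hh \<le> 2 / real n"
        proof -
          have "real n ^ 1 \<le> real n ^ 3" using n1 by (intro power_increasing) auto
          then show ?thesis unfolding hh_def using nn by (simp add: divide_left_mono)
        qed
        ultimately have "2 * hh + 2 * hh / t0\<^sup>2 \<le> 4 / real n" by simp
        also have "\<dots> \<le> 4 / x" using xlen x0' by (intro divide_left_mono) auto
        also have "\<dots> \<le> k ^ 3 / 8" using x(5) k x0' by (simp add: field_simps)
        finally show ?thesis .
      qed
      \<comment> \<open>The grid has to cover the interval enlarged by the fraction \<tau> on both sides; it has P columns and Q rows.\<close>
      define l' where "l' = l - \<tau> * (u - l)"
      define P where "P = nat \<lfloor>2 * C * real n ^ 3\<rfloor> + 1"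
      define Q where "Q = n ^ 3 + 1"
      have n31: "real n ^ 3 \<ge> 1" using n1 by simp
      have P: "2 * C * real n ^ 3 < real P" "real P \<le> 3 * C * real n ^ 3"
      proof -
        have c: "C * real n ^ 3 \<ge> 1" using mult_mono[of 1 C 1 "real n ^ 3"] C n31 by simp
        show "2 * C * real n ^ 3 < real P" unfolding P_def by linarith
        have "real (nat \<lfloor>v\<rfloor>) \<le> v" if "v \<ge> 0" for v :: real using that by simp
        from this[of "2 * C * real n ^ 3"] have "real (nat \<lfloor>2 * C * real n ^ 3\<rfloor>) \<le> 2 * C * real n ^ 3" using c by simp
        moreover have "real P = real (nat \<lfloor>2 * C * real n ^ 3\<rfloor>) + 1" unfolding P_def by (simp only: of_nat_add of_nat_1)
        ultimately show "real P \<le> 3 * C * real n ^ 3" using c by linarith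
      qed
      have Q: "real n ^ 3 < real Q" "real Q \<le> 2 * real n ^ 3" unfolding Q_def using n31 by auto
      define Z where "Z = grid l' t0 hh P Q"
      have Zpos: "Im z > 0" if "z \<in> Z" for z
        using that t0pos hpos unfolding Z_def grid_def by (auto intro!: add_pos_nonneg)
      have T1: "x\<^sup>2 \<ge> 1" using x(1) by simp
      obtain Bad where Bad: "Bad \<in> sets M" "measure M Bad \<le> real (card Z) * real n * (4 * (1 + 4 * real n) * exp (1 - x\<^sup>2))"
        "\<forall>\<omega>\<in>space M - Bad. \<forall>z\<in>Z. \<forall>i<n. \<not> row_bad n A z (x\<^sup>2) K i (\<lambda>p. wigner_coord X p \<omega>)"
        "\<forall>\<omega>\<in>space M - Bad. \<forall>i<n. \<bar>wigner_coord X (i, i) \<omega>\<bar> \<le> K"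
        by (rule wigner_bad_event[OF w Ad T1 bK grid_card(1)[of l' t0 hh P Q, folded Z_def] Zpos])
      have "real (card Z) \<le> real P * real Q"
        using grid_card(2)[of l' t0 hh P Q] unfolding Z_def by (metis of_nat_le_iff of_nat_mult)
      then have Badp: "measure M Bad \<le> exp (- (x\<^sup>2 / 2))"
        using Bad(2) probability_numeric[OF nx x(1,2) C P(2) Q(2)] by fastforce
      have sub: "space M - Bad \<subseteq> E"
      proof
        fix \<omega> assume om: "\<omega> \<in> space M - Bad"
        then obtain lam where lam: "num_eigenvalues_in (deformed_wigner n (X \<omega>) A) I = card {i. i < n \<and> lam i \<in> I}"
          "\<forall>z. Im z \<noteq> 0 \<longrightarrow> (\<Sum>j<n. resolvent (deformed_wigner n (X \<omega>) A) z j j) = (\<Sum>i<n. 1 / (of_real (lam i) - z))"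
          using spectrum by blast
        have Xy: "hermitian_of n (\<lambda>p. wigner_coord X p \<omega>) = X \<omega>" using wigner_hermitian_of[OF w] om by blast
        have goodz: "good_point n lam a (k / 4) z" if z: "z \<in> Z" "t0 \<le> Im z" "Im z \<le> 1" for z
        proof (rule good_point_of_not_bad[where y = "\<lambda>p. wigner_coord X p \<omega>" and b = "1 / x ^ 8" and T = "x\<^sup>2", OF n _ A _ K T1 Zpos[OF z(1)] z(3)])
          show "a > 0" using a by simp
          show "(\<Sum>j<n. resolvent (deformed_wigner n (hermitian_of n (\<lambda>p. wigner_coord X p \<omega>)) A) z j j) = (\<Sum>i<n. 1 / (complex_of_real (lam i) - z))"
            if "Im z \<noteq> 0" for z using lam(2) that unfolding Xy by blast
          have "K\<^sup>2 / (real n * Im z) \<le> K\<^sup>2 / (real n * t0)"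
            using z(2) nn t0pos by (intro divide_left_mono mult_left_mono mult_pos_pos) auto
          also have "\<dots> = 1 / x ^ 16" unfolding t0_def using nn K by simp
          also have "\<dots> = (1 / x ^ 8)\<^sup>2" by (simp add: power_divide flip: power_mult)
          finally show "K\<^sup>2 / (real n * Im z) \<le> (1 / x ^ 8)\<^sup>2" .
          show "0 \<le> 1 / x ^ 8" using x0' by simp
          have "1 \<le> x ^ 8" using x(1) by (intro one_le_power) simp
          then show "1 / x ^ 8 \<le> 1" using x0' by (simp add: pos_divide_le_eq)
          show "0 < k / 4" "k / 4 \<le> 1" using k by auto
          have "44 * (x\<^sup>2)\<^sup>2 * (1 / x ^ 8) = 44 / x ^ 4" using x0' by (simp add: field_simps flip: power_add power_mult)
          also have "\<dots> \<le> 44 / x" using x4 x0' by (intro divide_left_mono mult_pos_pos) auto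
          also have "\<dots> \<le> (k / 4) ^ 3 / 10" using x(6) k x0' by (simp add: field_simps)
          finally show "44 * (x\<^sup>2)\<^sup>2 * (1 / x ^ 8) \<le> (k / 4) ^ 3 / 10" .
          show "\<not> row_bad n A z (x\<^sup>2) K i (\<lambda>p. wigner_coord X p \<omega>)" if "i < n" for i using Bad(3) om z(1) that by blast
          show "\<bar>wigner_coord X (i, i) \<omega>\<bar> \<le> K" if "i < n" for i using Bad(4) om that by blast
        qed
        have cov: "covered n lam a (k / 4) t0 (2 * hh) (Complex E0 y)"
          if E0: "E0 \<in> {l - \<tau> * (u - l)..u + \<tau> * (u - l)}" and y: "y \<in> {t0..1}" for E0 y
        proof -
          have "(E0 - l') / hh < real P"
          proof -
            have "2 * \<tau> * (u - l) \<le> 1 * (u - l)" using tau lu by (intro mult_right_mono) auto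
            then have "E0 - l' \<le> 2 * C" using E0 lenC unfolding l'_def by (simp add: algebra_simps)
            then have "(E0 - l') * real n ^ 3 \<le> 2 * C * real n ^ 3" by (intro mult_right_mono) auto
            then show ?thesis using P(1) unfolding hh_def by simp
          qed
          moreover have "(y - t0) / hh < real Q"
          proof -
            have "(y - t0) * real n ^ 3 \<le> 1 * real n ^ 3" using y t0pos by (intro mult_right_mono) auto
            then have "(y - t0) * real n ^ 3 < real Q" using Q(1) by linarith
            then show ?thesis unfolding hh_def by simp
          qed
          moreover have "l' \<le> E0" "t0 \<le> y" using E0 y unfolding l'_def by auto
          ultimately obtain z where "z \<in> grid l' t0 hh P Q" and z2: "t0 \<le> Im z" "Im z \<le> y" "cmod (Complex E0 y - z) \<le> 2 * hh"
            using grid_covers[OF hpos, of l' E0 P t0 y Q] by blast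
          then have z: "z \<in> Z" "t0 \<le> Im z" unfolding Z_def by auto
          have "Im z \<le> 1" using z2(2) y by simp
          then show ?thesis unfolding covered_def using goodz[OF z] z2 by blast
        qed
        have a1: "a \<ge> 1" and e0: "0 \<le> e" and h0: "0 \<le> 2 * hh" using a e hpos by auto
        have t0g2: "t0 / (\<tau>\<^sup>2 * (u - l)) \<le> 1 / 2" using t0g g by linarith
        have "\<bar>real (card {i. i < n \<and> lam i \<in> I}) - real n * integral {l..u} (pastur_density a)\<bar>
          \<le> (2 * \<tau> + e + 7 * (t0 / (\<tau>\<^sup>2 * (u - l)))) * (real n * (u - l))"
          by (rule counting_from_covering[OF stab a1 e0 e(2) n t0pos t0t k h0 hsmall lu tau(1,2) sw(1,2) t0half t0g2 cov])
        also have "\<dots> \<le> \<delta> * (real n * (u - l))"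
        proof (rule mult_right_mono)
          show "2 * \<tau> + e + 7 * (t0 / (\<tau>\<^sup>2 * (u - l))) \<le> \<delta>" using tau(3) e(3) g(3) t0g d by linarith
        qed (use lu in simp)
        finally show "\<omega> \<in> E" using om unfolding E_def lam(1)[symmetric] by (simp add: mult.assoc)
      qed
      have "1 - measure M Bad = measure M (space M - Bad)" using prob_compl[OF Bad(1)] by simp
      also have "\<dots> \<le> measure M E" by (rule finite_measure_mono[OF sub Em])
      finally show ?thesis using Badp by linarith
    qed
    show ?thesis using Em Ep unfolding E_def mlen intr x_def Let_def by simp
  qed
  show ?thesis by (intro exI[of _ x0] allI impI main)
qed

lemma eventually_even_sequentiallyI:
  assumes "eventually P sequentially"
  shows "\<forall>\<^sub>F n in even_sequentially. even n \<and> P n"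
  unfolding even_sequentially_def eventually_inf_principal using assms by (auto elim: eventually_mono)

lemma even_sequentially_le: "even_sequentially \<le> sequentially"
  by (simp add: even_sequentially_def)

theorem theorem1p3:
  fixes a \<epsilon> \<delta> :: real
    and \<nu> \<nu>' :: "real measure"
    and M :: "nat \<Rightarrow> 'a measure"
    and X :: "nat \<Rightarrow> 'a \<Rightarrow> complex mat"
    and A :: "nat \<Rightarrow> complex mat"
    and K :: "nat \<Rightarrow> real"
    and I :: "nat \<Rightarrow> real set"
  assumes "a > 1" and "\<epsilon> > 0" and "\<delta> > 0"
    and "poincare_inequality \<nu>" and "log_sobolev_inequality \<nu>"
    and "poincare_inequality \<nu>'" and "log_sobolev_inequality \<nu>'"
    and "\<And>n. even n \<Longrightarrow> n > 0 \<Longrightarrow> wigner_hermitian (M n) n \<nu> \<nu>' (X n)"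
    and "\<And>n. even n \<Longrightarrow> n > 0 \<Longrightarrow> external_source a n (A n)"
    and "\<And>n. even n \<Longrightarrow> n > 0 \<Longrightarrow>
           AE \<omega> in M n. \<forall>i<n. \<forall>j<n. cmod (X n \<omega> $$ (i, j)) \<le> K n"
    and "\<And>n. even n \<Longrightarrow> n > 0 \<Longrightarrow> is_interval (I n) \<and> bounded (I n)"
    and "\<And>n. even n \<Longrightarrow> n > 0 \<Longrightarrow>
           measure lborel (I n) \<ge> (K n)\<^sup>2 * (ln (real n)) ^ 20 / real n"
  shows "overwhelming_probability M (\<lambda>n. {\<omega> \<in> space (M n).
           \<bar>real (num_eigenvalues_in (deformed_wigner n (X n \<omega>) (A n)) (I n))
              - real n * (LINT x:I n|lborel. pastur_density a x)\<bar>
           \<le> \<delta> * real n * measure lborel (I n)})"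
proof -
  from eigenvalue_count_large_n[OF assms(1,3), where 'a = 'a] obtain x0 where x0: "\<forall>n (M :: 'a measure) \<nu> \<nu>' X A K I. n > 0 \<longrightarrow> ln (real n) \<ge> x0 \<longrightarrow>
      wigner_hermitian M n \<nu> \<nu>' X \<longrightarrow> external_source a n A \<longrightarrow>
      (AE \<omega> in M. \<forall>i<n. \<forall>j<n. cmod (X \<omega> $$ (i, j)) \<le> K) \<longrightarrow>
      is_interval I \<longrightarrow> bounded I \<longrightarrow> measure lborel I \<ge> K\<^sup>2 * ln (real n) ^ 20 / real n \<longrightarrow>
      (let E = {\<omega> \<in> space M. \<bar>real (num_eigenvalues_in (deformed_wigner n (X \<omega>) A) I)
              - real n * (LINT x:I|lborel. pastur_density a x)\<bar> \<le> \<delta> * real n * measure lborel I}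
       in E \<in> sets M \<and> measure M E \<ge> 1 - exp (- ((ln (real n))\<^sup>2 / 2)))"
    by (rule exE)
  define f where "f n = (ln (real n))\<^sup>2 / 2" for n :: nat
  have ln_lim: "filterlim (\<lambda>n. ln (real n)) at_top sequentially"
    by (rule filterlim_compose[OF ln_at_top filterlim_real_sequentially])
  have "filterlim (\<lambda>n. ln (real n) / 2) at_top sequentially"
    unfolding filterlim_at_top
  proof
    fix Z :: real
    have "eventually (\<lambda>n. 2 * Z \<le> ln (real n)) sequentially" using ln_lim unfolding filterlim_at_top by blast
    then show "eventually (\<lambda>n. Z \<le> ln (real n) / 2) sequentially" by eventually_elim simp
  qed
  moreover have "(\<lambda>n. f n / ln (real n)) = (\<lambda>n. ln (real n) / 2)"
  proof
    show "f n / ln (real n) = ln (real n) / 2" for n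
      by (cases "ln (real n) = 0") (simp_all only: f_def power2_eq_square, simp_all)
  qed
  ultimately have "filterlim (\<lambda>n. f n / ln (real n)) at_top sequentially" by (simp only:)
  then have lim: "filterlim (\<lambda>n. f n / ln (real n)) at_top even_sequentially"
    by (rule filterlim_mono[OF _ order_refl even_sequentially_le])
  have "eventually (\<lambda>n. ln (real n) \<ge> x0 \<and> n > 0) sequentially"
    using ln_lim eventually_gt_at_top[of "0::nat"] by (simp add: filterlim_at_top eventually_conj_iff)
  from eventually_even_sequentiallyI[OF this]
  have "\<forall>\<^sub>F n in even_sequentially. {\<omega> \<in> space (M n).
           \<bar>real (num_eigenvalues_in (deformed_wigner n (X n \<omega>) (A n)) (I n))
              - real n * (LINT x:I n|lborel. pastur_density a x)\<bar>
           \<le> \<delta> * real n * measure lborel (I n)} \<in> sets (M n) \<and>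
      measure (M n) {\<omega> \<in> space (M n).
           \<bar>real (num_eigenvalues_in (deformed_wigner n (X n \<omega>) (A n)) (I n))
              - real n * (LINT x:I n|lborel. pastur_density a x)\<bar>
           \<le> \<delta> * real n * measure lborel (I n)} \<ge> 1 - exp (- f n)"
  proof eventually_elim
    case (elim n)
    then have n: "even n" "n > 0" "ln (real n) \<ge> x0" by auto
    show ?case
      using x0[rule_format, OF n(2,3) assms(8)[OF n(1,2)] assms(9)[OF n(1,2)] assms(10)[OF n(1,2)]
          conjunct1[OF assms(11)[OF n(1,2)]] conjunct2[OF assms(11)[OF n(1,2)]] assms(12)[OF n(1,2)]]
      unfolding Let_def f_def .
  qed
  then show ?thesis unfolding overwhelming_probability_def using lim by blast
qed

end
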